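(* Let $S^2\times S^3=\{(x_1,x_2,x_3,x_5,\dots,x_8):x_1^2+x_2^2+x_3^2=1=x_5^2+\dots+x_8^2\}$ be endowed with the Sasaki-Einstein $SU(2)$-structure $(\tilde\eta,\tilde\omega_1,\tilde\omega_2,\tilde\omega_3)$, with metric $g$, given (after restriction) by $$\tilde\eta=\tfrac13\sum_{j=1}^3x_j\beta_j,\quad \tilde\omega_1=\tfrac{\sqrt3}{2}\cdot\tfrac{\sqrt3}{18}\sum_{j=1}^3\alpha_j\wedge\beta_j,\quad \tilde\omega_2=\tfrac{\sqrt3}{2}\Big(\tfrac{2\sqrt3}{9}vol_{S^2}+\tfrac{\sqrt3}{9}\sum_{j=1}^3dx_j\wedge\beta_j\Big),\quad \tilde\omega_3=-\tfrac12d\tilde\eta .$$ Then: (i) The $SU(3)$-structure on $S^2\times S^3\times[0,\pi]$ (coordinate $t$) defined by $$\begin{aligned}F&=\sin^2t\,(\sin t\,\tilde\omega_1+\cos t\,\tilde\omega_3)+\sin t\,\tilde\eta\wedge dt,\\ \Psi_+&=\sin^3t\,\tilde\eta\wedge\tilde\omega_2-\sin^2t\,(-\cos t\,\tilde\omega_1+\sin t\,\tilde\omega_3)\wedge dt,\\ \Psi_-&=\sin^3t\,(-\cos t\,\tilde\omega_1+\sin t\,\tilde\omega_3)\wedge\tilde\eta+\sin^2t\,\tilde\omega_2\wedge dt\end{aligned}$$ is a nearly Kähler structure generating the metric $g_6=dt^2+\sin^2t\,g$ with two conical singularities at $t=0$, $t=\pi$. (ii) The $G_2$-structure on $(S^2\times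 S^3\times[0,\pi])\times[0,\pi]$ (with $q$ the last coordinate) defined by $$\phi=\sin^2q\,F\wedge dq-\sin^3q\,(-\cos q\,\Psi_++\sin q\,\Psi_-)$$ is a nearly parallel $G_2$-structure generating the metric $g_7=dq^2+\sin^2q\,(dt^2+\sin^2t\,g)$ with singularities at $t=0$, $t=\pi$, $q=0$, $q=\pi$.
   Context: On $S^2\times S^3$ put $\alpha_1=2x_3dx_2-2x_2dx_3$, $\alpha_2=-2x_3dx_1+2x_1dx_3$, $\alpha_3=2x_2dx_1-2x_1dx_2$; $\beta_1=2x_8dx_5+2x_7dx_6-2x_6dx_7-2x_5dx_8$, $\beta_2=-2x_7dx_5+2x_8dx_6+2x_5dx_7-2x_6dx_8$, $\beta_3=2x_6dx_5-2x_5dx_6+2x_8dx_7-2x_7dx_8$; and $vol_{S^2}=-x_3\,dx_1\wedge dx_2+x_2\,dx_1\wedge dx_3-x_1\,dx_2\wedge dx_3$. An $SU(2)$-structure on a $5$-manifold is a quadruplet $(\eta,\omega_1,\omega_2,\omega_3)$ for which locally there is a coframe with $\eta=e^5$, $\omega_1=e^{12}+e^{34}$, $\omega_2=e^{13}+e^{42}$, $\omega_3=e^{14}+e^{23}$; its metric makes the coframe orthonormal. It is Sasaki-Einstein if $d\eta=-2\omega_3$, $d\omega_1=3\eta\wedge\omega_2$, $d\omega_2=-3\eta\wedge\omega_1$. An $SU(3)$-structure $(F,\Psi_+,\Psi_-)$ (locally $F=e^{12}+e^{34}+e^{56}$, $\Psi_++i\Psi_-=(e^1+ie^2)\wedge(e^3+ie^4)\wedge(e^5+ie^6)$,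 coframe orthonormal for its metric) is nearly Kähler if $dF=3\Psi_+$, $d\Psi_-=-2F\wedge F$. A $G_2$-structure is a $3$-form $\phi$ on a $7$-manifold locally of the form $\phi=F\wedge e^7-\Psi_-$ with $F=e^{12}+e^{34}+e^{56}$ and $\Psi_++i\Psi_-=(e^1+ie^2)\wedge(e^3+ie^4)\wedge(e^5+ie^6)$; $e^1,\dots,e^7$ is an oriented orthonormal coframe for its metric, and $*\phi=\frac12F\wedge F+\Psi_+\wedge e^7$. It is nearly parallel if $d\phi=4*\phi$. The structures are smooth and satisfy the stated equations for $t\in(0,\pi)$ and $q\in(0,\pi)$; "singularities" refers to the values of $t,q$ where the forms degenerate and the metric takes (to leading order) the cone form $ds^2+s^2g'$ with $s$ the distance parameter to the end. *)

theory Defs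
  imports "HOL-Analysis.Analysis" "HOL-Library.Function_Algebras"
begin

section \<open>Smooth functions and embedded submanifolds\<close>

primrec C_k_on :: "nat \<Rightarrow> 'a::euclidean_space set \<Rightarrow> ('a \<Rightarrow> real) \<Rightarrow> bool" where
  "C_k_on 0 U f \<longleftrightarrow> continuous_on U f"
| "C_k_on (Suc k) U f \<longleftrightarrow>
     f differentiable_on U \<and> (\<forall>v. C_k_on k U (\<lambda>x. frechet_derivative f (at x) v))"

text \<open>Only used for open \<open>U\<close>.\<close>

definition smooth_on :: "'a::euclidean_space set \<Rightarrow> ('a \<Rightarrow> real) \<Rightarrow> bool" where
  "smooth_on U f \<longleftrightarrow> (\<forall>k. C_k_on k U f)"

definition submanifold :: "nat \<Rightarrow> 'a::euclidean_space set \<Rightarrow> bool" where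
  "submanifold n M \<longleftrightarrow> n \<le> DIM('a) \<and>
     (\<forall>p\<in>M. \<exists>U (f :: nat \<Rightarrow> 'a \<Rightarrow> real). open U \<and> p \<in> U \<and>
        (\<forall>i<DIM('a) - n. smooth_on U (f i)) \<and>
        M \<inter> U = {x \<in> U. \<forall>i<DIM('a) - n. f i x = 0} \<and>
        (\<forall>x\<in>M \<inter> U. \<forall>c.
           (\<forall>v. (\<Sum>i<DIM('a) - n. c i * frechet_derivative (f i) (at x) v) = 0) \<longrightarrow>
           (\<forall>i<DIM('a) - n. c i = 0)))"

definition tangent_space :: "'a::euclidean_space set \<Rightarrow> 'a \<Rightarrow> 'a set" where
  "tangent_space M p = {v. \<exists>\<gamma> :: real \<Rightarrow> 'a. \<gamma> 0 = p \<and> (\<forall>\<^sub>F s in at 0. \<gamma> s \<in> M) \<and>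
     (\<gamma> has_vector_derivative v) (at 0)}"

section \<open>Differential forms\<close>

text \<open>
  A form assigns to a point \<open>p\<close> and a list \<open>[v\<^sub>1, \<dots>, v\<^sub>k]\<close> of vectors a value; a \<open>k\<close>-form
  vanishes on lists of length other than \<open>k\<close>. Sums and differences of forms are the pointwise
  ones. The conventions are \<open>(\<alpha> \<and> \<beta>)(u, v) = \<alpha>(u) \<beta>(v) - \<alpha>(v) \<beta>(u)\<close> for 1-forms and
  \<open>d\<alpha>(v\<^sub>0, \<dots>, v\<^sub>k) = \<Sum>\<^sub>i (-1)^i (D\<^bsub>v\<^sub>i\<^esub> \<alpha>)(v\<^sub>0, \<dots>, v\<^sub>i omitted, \<dots>, v\<^sub>k)\<close>, without
  factorial normalizations.
\<close>

type_synonym ('a, 'b) form = "'a \<Rightarrow> 'a list \<Rightarrow> 'b"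

type_synonym 'a riem_metric = "'a \<Rightarrow> 'a \<Rightarrow> 'a \<Rightarrow> real"

definition form_at :: "nat \<Rightarrow> 'a::euclidean_space \<Rightarrow> ('a, real) form \<Rightarrow> bool" where
  "form_at k p \<alpha> \<longleftrightarrow>
     (\<forall>vs. length vs \<noteq> k \<longrightarrow> \<alpha> p vs = 0) \<and>
     (\<forall>vs i. length vs = k \<and> i < k \<longrightarrow> linear (\<lambda>v. \<alpha> p (vs[i := v]))) \<and>
     (\<forall>vs i j. length vs = k \<and> i < j \<and> j < k \<and> vs ! i = vs ! j \<longrightarrow> \<alpha> p vs = 0)"

definition smooth_form :: "nat \<Rightarrow> 'a::euclidean_space set \<Rightarrow> ('a, real) form \<Rightarrow> bool" where
  "smooth_form k U \<alpha> \<longleftrightarrow> (\<forall>p\<in>U. form_at k p \<alpha>) \<and> (\<forall>vs. smooth_on U (\<lambda>p. \<alpha> p vs))"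

definition zero_form :: "('a \<Rightarrow> real) \<Rightarrow> ('a, real) form" where
  "zero_form f = (\<lambda>p vs. if vs = [] then f p else 0)"

definition fscale :: "('a \<Rightarrow> real) \<Rightarrow> ('a, real) form \<Rightarrow> ('a, real) form" (infixr "\<odot>" 75) where
  "f \<odot> \<alpha> = (\<lambda>p vs. f p * \<alpha> p vs)"

definition cscale :: "real \<Rightarrow> ('a, real) form \<Rightarrow> ('a, real) form" (infixr "\<cdot>" 75) where
  "c \<cdot> \<alpha> = (\<lambda>p vs. c * \<alpha> p vs)"

definition shuffle_sign :: "nat \<Rightarrow> nat set \<Rightarrow> 'b::comm_ring_1" where
  "shuffle_sign n S = (- 1) ^ card {(i, j). i < n \<and> j < n \<and> i \<in> S \<and> j \<notin> S \<and> j < i}"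

definition wedge :: "('a, 'b::comm_ring_1) form \<Rightarrow> ('a, 'b) form \<Rightarrow> ('a, 'b) form"
    (infixr "\<and>\<^sub>f" 70) where
  "\<alpha> \<and>\<^sub>f \<beta> = (\<lambda>p vs. \<Sum>S\<in>Pow {..<length vs}.
     shuffle_sign (length vs) S * \<alpha> p (nths vs S) * \<beta> p (nths vs (- S)))"

definition ext_d :: "('a::euclidean_space, real) form \<Rightarrow> ('a, real) form" where
  "ext_d \<alpha> = (\<lambda>p vs. \<Sum>i<length vs.
     (- 1) ^ i * frechet_derivative (\<lambda>y. \<alpha> y (take i vs @ drop (Suc i) vs)) (at p) (vs ! i))"

definition pullback :: "('a::euclidean_space \<Rightarrow> 'b::euclidean_space) \<Rightarrow> ('b, real) form \<Rightarrow> ('a, real) form"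
  where "pullback f \<alpha> = (\<lambda>p vs. \<alpha> (f p) (map (frechet_derivative f (at p)) vs))"

definition complex_form :: "('a, real) form \<Rightarrow> ('a, real) form \<Rightarrow> ('a, complex) form" where
  "complex_form \<alpha> \<beta> = (\<lambda>p vs. Complex (\<alpha> p vs) (\<beta> p vs))"

text \<open>
  Forms on a submanifold \<open>M\<close> are represented by ambient forms that are smooth near \<open>M\<close> and are
  only ever compared on tangent vectors of \<open>M\<close>. As \<open>d\<close> commutes with the restriction to \<open>M\<close>,
  the restriction of \<open>ext_d \<alpha>\<close> is the exterior derivative on \<open>M\<close> of the restriction of \<open>\<alpha>\<close>.
\<close>

definition smooth_form_on :: "nat \<Rightarrow> 'a::euclidean_space set \<Rightarrow> ('a, real) form \<Rightarrow> bool" where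
  "smooth_form_on k M \<alpha> \<longleftrightarrow> (\<exists>W. open W \<and> M \<subseteq> W \<and> smooth_form k W \<alpha>)"

definition eq_at :: "'a::euclidean_space set \<Rightarrow> 'a \<Rightarrow> ('a, 'b) form \<Rightarrow> ('a, 'b) form \<Rightarrow> bool" where
  "eq_at M p \<alpha> \<beta> \<longleftrightarrow> (\<forall>vs. set vs \<subseteq> tangent_space M p \<longrightarrow> \<alpha> p vs = \<beta> p vs)"

definition eq_on :: "'a::euclidean_space set \<Rightarrow> ('a, 'b) form \<Rightarrow> ('a, 'b) form \<Rightarrow> bool" where
  "eq_on M \<alpha> \<beta> \<longleftrightarrow> (\<forall>p\<in>M. eq_at M p \<alpha> \<beta>)"

section \<open>Coframes and the structures defined by them\<close>

definition coframe_at :: "nat \<Rightarrow> 'a::euclidean_space set \<Rightarrow> (nat \<Rightarrow> ('a, real) form) \<Rightarrow> 'a \<Rightarrow> bool" where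
  "coframe_at n M e p \<longleftrightarrow> (\<forall>i\<in>{1..n}. form_at 1 p (e i)) \<and> dim (tangent_space M p) = n \<and>
     (\<forall>c. (\<forall>v\<in>tangent_space M p. (\<Sum>i=1..n. c i * e i p [v]) = 0) \<longrightarrow> (\<forall>i\<in>{1..n}. c i = 0))"

definition orthonormal_at ::
    "nat \<Rightarrow> 'a::euclidean_space set \<Rightarrow> 'a riem_metric \<Rightarrow> (nat \<Rightarrow> ('a, real) form) \<Rightarrow> 'a \<Rightarrow> bool" where
  "orthonormal_at n M g e p \<longleftrightarrow>
     (\<forall>u\<in>tangent_space M p. \<forall>v\<in>tangent_space M p. g p u v = (\<Sum>i=1..n. e i p [u] * e i p [v]))"

definition locally_coframe ::
    "nat \<Rightarrow> 'a::euclidean_space set \<Rightarrow> ((nat \<Rightarrow> ('a, real) form) \<Rightarrow> 'a \<Rightarrow> bool) \<Rightarrow> bool" where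
  "locally_coframe n M Q \<longleftrightarrow>
     (\<forall>p\<in>M. \<exists>U e. open U \<and> p \<in> U \<and> (\<forall>i\<in>{1..n}. smooth_form 1 U (e i)) \<and>
        (\<forall>x\<in>M \<inter> U. coframe_at n M e x \<and> Q e x))"

subsection \<open>SU(2)-structures on 5-manifolds\<close>

definition su2_adapted ::
    "'a::euclidean_space set \<Rightarrow> ('a, real) form \<Rightarrow>
      ('a, real) form \<Rightarrow> ('a, real) form \<Rightarrow> ('a, real) form \<Rightarrow>
      (nat \<Rightarrow> ('a, real) form) \<Rightarrow> 'a \<Rightarrow> bool" where
  "su2_adapted M \<eta> \<omega>1 \<omega>2 \<omega>3 e p \<longleftrightarrow>
     eq_at M p \<eta> (e 5) \<and>
     eq_at M p \<omega>1 (e 1 \<and>\<^sub>f e 2 + e 3 \<and>\<^sub>f e 4) \<and>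
     eq_at M p \<omega>2 (e 1 \<and>\<^sub>f e 3 + e 4 \<and>\<^sub>f e 2) \<and>
     eq_at M p \<omega>3 (e 1 \<and>\<^sub>f e 4 + e 2 \<and>\<^sub>f e 3)"

definition su2_structure ::
    "'a::euclidean_space set \<Rightarrow> ('a, real) form \<Rightarrow>
      ('a, real) form \<Rightarrow> ('a, real) form \<Rightarrow> ('a, real) form \<Rightarrow>
      bool" where
  "su2_structure M \<eta> \<omega>1 \<omega>2 \<omega>3 \<longleftrightarrow> submanifold 5 M \<and>
     smooth_form_on 1 M \<eta> \<and> smooth_form_on 2 M \<omega>1 \<and> smooth_form_on 2 M \<omega>2 \<and> smooth_form_on 2 M \<omega>3 \<and>
     locally_coframe 5 M (su2_adapted M \<eta> \<omega>1 \<omega>2 \<omega>3)"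

text \<open>
  Any two adapted coframes at a point differ by an element of the structure group, which is a
  subgroup of the special orthogonal group; hence adapted orthonormal coframes near every point
  determine the metric of the structure. The same applies to the metrics of the SU(3)- and
  G2-structures below.
\<close>

definition su2_metric ::
    "'a::euclidean_space set \<Rightarrow> ('a, real) form \<Rightarrow>
      ('a, real) form \<Rightarrow> ('a, real) form \<Rightarrow> ('a, real) form \<Rightarrow>
      'a riem_metric \<Rightarrow> bool" where
  "su2_metric M \<eta> \<omega>1 \<omega>2 \<omega>3 g \<longleftrightarrow>
     locally_coframe 5 M (\<lambda>e p. su2_adapted M \<eta> \<omega>1 \<omega>2 \<omega>3 e p \<and> orthonormal_at 5 M g e p)"

definition sasaki_einstein ::
    "'a::euclidean_space set \<Rightarrow> ('a, real) form \<Rightarrow>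
      ('a, real) form \<Rightarrow> ('a, real) form \<Rightarrow> ('a, real) form \<Rightarrow>
      bool" where
  "sasaki_einstein M \<eta> \<omega>1 \<omega>2 \<omega>3 \<longleftrightarrow> su2_structure M \<eta> \<omega>1 \<omega>2 \<omega>3 \<and>
     eq_on M (ext_d \<eta>) ((- 2) \<cdot> \<omega>3) \<and>
     eq_on M (ext_d \<omega>1) (3 \<cdot> (\<eta> \<and>\<^sub>f \<omega>2)) \<and>
     eq_on M (ext_d \<omega>2) ((- 3) \<cdot> (\<eta> \<and>\<^sub>f \<omega>1))"

subsection \<open>SU(3)-structures on 6-manifolds\<close>

definition std_F :: "(nat \<Rightarrow> ('a, real) form) \<Rightarrow> ('a, real) form" where
  "std_F e = e 1 \<and>\<^sub>f e 2 + e 3 \<and>\<^sub>f e 4 + e 5 \<and>\<^sub>f e 6"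

definition std_Psi :: "(nat \<Rightarrow> ('a, real) form) \<Rightarrow> ('a, complex) form" where
  "std_Psi e = complex_form (e 1) (e 2) \<and>\<^sub>f complex_form (e 3) (e 4) \<and>\<^sub>f complex_form (e 5) (e 6)"

definition su3_adapted ::
    "'a::euclidean_space set \<Rightarrow> ('a, real) form \<Rightarrow>
      ('a, real) form \<Rightarrow> ('a, real) form \<Rightarrow> (nat \<Rightarrow>
      ('a, real) form) \<Rightarrow> 'a \<Rightarrow> bool" where
  "su3_adapted M F \<Psi>p \<Psi>m e p \<longleftrightarrow>
     eq_at M p F (std_F e) \<and> eq_at M p (complex_form \<Psi>p \<Psi>m) (std_Psi e)"

definition su3_structure ::
    "'a::euclidean_space set \<Rightarrow> ('a, real) form \<Rightarrow>
      ('a, real) form \<Rightarrow> ('a, real) form \<Rightarrow> bool" where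
  "su3_structure M F \<Psi>p \<Psi>m \<longleftrightarrow> submanifold 6 M \<and>
     smooth_form_on 2 M F \<and> smooth_form_on 3 M \<Psi>p \<and> smooth_form_on 3 M \<Psi>m \<and>
     locally_coframe 6 M (su3_adapted M F \<Psi>p \<Psi>m)"

definition su3_metric ::
    "'a::euclidean_space set \<Rightarrow> ('a, real) form \<Rightarrow>
      ('a, real) form \<Rightarrow> ('a, real) form \<Rightarrow> 'a riem_metric \<Rightarrow>
      bool" where
  "su3_metric M F \<Psi>p \<Psi>m g \<longleftrightarrow>
     locally_coframe 6 M (\<lambda>e p. su3_adapted M F \<Psi>p \<Psi>m e p \<and> orthonormal_at 6 M g e p)"

definition nearly_kaehler ::
    "'a::euclidean_space set \<Rightarrow> ('a, real) form \<Rightarrow>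
      ('a, real) form \<Rightarrow> ('a, real) form \<Rightarrow> bool" where
  "nearly_kaehler M F \<Psi>p \<Psi>m \<longleftrightarrow> su3_structure M F \<Psi>p \<Psi>m \<and>
     eq_on M (ext_d F) (3 \<cdot> \<Psi>p) \<and>
     eq_on M (ext_d \<Psi>m) ((- 2) \<cdot> (F \<and>\<^sub>f F))"

definition su3_degenerate_at ::
    "'a::euclidean_space set \<Rightarrow> ('a, real) form \<Rightarrow>
      ('a, real) form \<Rightarrow> ('a, real) form \<Rightarrow> 'a \<Rightarrow> bool" where
  "su3_degenerate_at M F \<Psi>p \<Psi>m p \<longleftrightarrow> \<not> (\<exists>e. coframe_at 6 M e p \<and> su3_adapted M F \<Psi>p \<Psi>m e p)"

subsection \<open>G2-structures on 7-manifolds\<close>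

definition std_phi :: "(nat \<Rightarrow> ('a, real) form) \<Rightarrow> ('a, real) form" where
  "std_phi e = std_F e \<and>\<^sub>f e 7 - (\<lambda>p vs. Im (std_Psi e p vs))"

text \<open>The Hodge dual of \<open>std_phi e\<close> when \<open>e\<close> is an oriented orthonormal coframe.\<close>

definition std_star_phi :: "(nat \<Rightarrow> ('a, real) form) \<Rightarrow> ('a, real) form" where
  "std_star_phi e = (1 / 2) \<cdot> (std_F e \<and>\<^sub>f std_F e) + (\<lambda>p vs. Re (std_Psi e p vs)) \<and>\<^sub>f e 7"

definition g2_adapted ::
    "'a::euclidean_space set \<Rightarrow> ('a, real) form \<Rightarrow> (nat \<Rightarrow>
      ('a, real) form) \<Rightarrow> 'a \<Rightarrow> bool" where
  "g2_adapted M \<phi> e p \<longleftrightarrow> eq_at M p \<phi> (std_phi e)"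

definition g2_structure ::
    "'a::euclidean_space set \<Rightarrow> ('a, real) form \<Rightarrow> bool" where
  "g2_structure M \<phi> \<longleftrightarrow> submanifold 7 M \<and> smooth_form_on 3 M \<phi> \<and> locally_coframe 7 M (g2_adapted M \<phi>)"

definition g2_metric ::
    "'a::euclidean_space set \<Rightarrow> ('a, real) form \<Rightarrow>
      'a riem_metric \<Rightarrow> bool" where
  "g2_metric M \<phi> g \<longleftrightarrow>
     locally_coframe 7 M (\<lambda>e p. g2_adapted M \<phi> e p \<and> orthonormal_at 7 M g e p)"

definition nearly_parallel ::
    "'a::euclidean_space set \<Rightarrow> ('a, real) form \<Rightarrow> bool" where
  "nearly_parallel M \<phi> \<longleftrightarrow> g2_structure M \<phi> \<and>
     locally_coframe 7 M (\<lambda>e p. g2_adapted M \<phi> e p \<and> eq_at M p (ext_d \<phi>) (4 \<cdot> std_star_phi e))"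

definition g2_degenerate_at ::
    "'a::euclidean_space set \<Rightarrow> ('a, real) form \<Rightarrow> 'a \<Rightarrow> bool" where
  "g2_degenerate_at M \<phi> p \<longleftrightarrow> \<not> (\<exists>e. coframe_at 7 M e p \<and> g2_adapted M \<phi> e p)"

section \<open>Forms and metrics on products with an interval\<close>

text \<open>\<open>d_last\<close> is \<open>dt\<close> on \<open>M \<times> \<real>\<close> and \<open>dq\<close> on \<open>(M \<times> \<real>) \<times> \<real>\<close>.\<close>

definition d_last :: "('a::euclidean_space \<times> real, real) form" where
  "d_last = ext_d (zero_form snd)"

definition cyl_F ::
    "('a::euclidean_space, real) form \<Rightarrow> ('a, real) form \<Rightarrow> ('a, real) form \<Rightarrow> ('a \<times> real, real) form" where
  "cyl_F \<eta> \<omega>1 \<omega>3 =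
     (\<lambda>(x, t). (sin t)\<^sup>2) \<odot> ((\<lambda>(x, t). sin t) \<odot> pullback fst \<omega>1 + (\<lambda>(x, t). cos t) \<odot> pullback fst \<omega>3)
     + (\<lambda>(x, t). sin t) \<odot> (pullback fst \<eta> \<and>\<^sub>f d_last)"

definition cyl_Psi_plus ::
    "('a::euclidean_space, real) form \<Rightarrow> ('a, real) form \<Rightarrow> ('a, real) form \<Rightarrow> ('a, real) form
      \<Rightarrow> ('a \<times> real, real) form" where
  "cyl_Psi_plus \<eta> \<omega>1 \<omega>2 \<omega>3 =
     (\<lambda>(x, t). (sin t)^3) \<odot> (pullback fst \<eta> \<and>\<^sub>f pullback fst \<omega>2)
     - (\<lambda>(x, t). (sin t)\<^sup>2) \<odot>
         (((\<lambda>(x, t). - cos t) \<odot> pullback fst \<omega>1 + (\<lambda>(x, t). sin t) \<odot> pullback fst \<omega>3) \<and>\<^sub>f d_last)"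

definition cyl_Psi_minus ::
    "('a::euclidean_space, real) form \<Rightarrow> ('a, real) form \<Rightarrow> ('a, real) form \<Rightarrow> ('a, real) form
      \<Rightarrow> ('a \<times> real, real) form" where
  "cyl_Psi_minus \<eta> \<omega>1 \<omega>2 \<omega>3 =
     (\<lambda>(x, t). (sin t)^3) \<odot>
         (((\<lambda>(x, t). - cos t) \<odot> pullback fst \<omega>1 + (\<lambda>(x, t). sin t) \<odot> pullback fst \<omega>3) \<and>\<^sub>f pullback fst \<eta>)
     + (\<lambda>(x, t). (sin t)\<^sup>2) \<odot> (pullback fst \<omega>2 \<and>\<^sub>f d_last)"

definition cyl_phi ::
    "('a::euclidean_space, real) form \<Rightarrow> ('a, real) form \<Rightarrow> ('a, real) form \<Rightarrow> ('a \<times> real, real) form" where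
  "cyl_phi F \<Psi>p \<Psi>m =
     (\<lambda>(y, q). (sin q)\<^sup>2) \<odot> (pullback fst F \<and>\<^sub>f d_last)
     - (\<lambda>(y, q). (sin q)^3) \<odot>
         ((\<lambda>(y, q). - cos q) \<odot> pullback fst \<Psi>p + (\<lambda>(y, q). sin q) \<odot> pullback fst \<Psi>m)"

definition sine_cone :: "'a riem_metric \<Rightarrow> ('a \<times> real) riem_metric" where
  "sine_cone g = (\<lambda>(x, t) (u, \<sigma>) (v, \<tau>). \<sigma> * \<tau> + (sin t)\<^sup>2 * g x u v)"

section \<open>Conical ends\<close>

text \<open>
  \<open>h\<close> agrees with \<open>h0\<close> to leading order as the parameter \<open>r\<close> of the end tends to \<open>0\<close>:
  the norm of \<open>h - h0\<close> with respect to \<open>h0\<close> tends to \<open>0\<close>, uniformly on \<open>N\<close>.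
\<close>

definition leading_order ::
    "'a::euclidean_space set \<Rightarrow> ('a \<Rightarrow> real) \<Rightarrow> 'a riem_metric \<Rightarrow> 'a riem_metric \<Rightarrow> bool" where
  "leading_order N r h h0 \<longleftrightarrow>
     (\<forall>\<epsilon>>0. \<exists>\<delta>>0. \<forall>p\<in>N. r p < \<delta> \<longrightarrow>
        (\<forall>v\<in>tangent_space N p. \<bar>h p v v - h0 p v v\<bar> \<le> \<epsilon> * h0 p v v))"

text \<open>
  The cone form \<open>ds\<^sup>2 + s\<^sup>2 g'\<close>, where \<open>s\<close> is a function on the total space and \<open>g'\<close> is pulled back
  by the linear projection \<open>\<pi>\<close> to the link.
\<close>

definition cone_form ::
    "('a::euclidean_space \<Rightarrow> real) \<Rightarrow> ('a \<Rightarrow> 'b) \<Rightarrow> 'b riem_metric \<Rightarrow> 'a riem_metric" where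
  "cone_form s \<pi> g' = (\<lambda>p u v.
     frechet_derivative s (at p) u * frechet_derivative s (at p) v + (s p)\<^sup>2 * g' (\<pi> p) (\<pi> u) (\<pi> v))"

text \<open>
  The end \<open>t = t0\<close> of \<open>M \<times> (0,\<pi>)\<close>, with link metric \<open>g\<close>. At the end itself the structure is
  tested on \<open>T M \<oplus> \<real> dt\<close>, which is the tangent space of \<open>M \<times> \<real>\<close>.
\<close>

definition conical_end_6 ::
    "'a::euclidean_space set \<Rightarrow> ('a \<times> real, real) form \<Rightarrow>
      ('a \<times> real, real) form \<Rightarrow> ('a \<times> real, real) form \<Rightarrow>
      ('a \<times> real) riem_metric \<Rightarrow> 'a riem_metric \<Rightarrow> real \<Rightarrow>
      bool" where
  "conical_end_6 M F \<Psi>p \<Psi>m g6 g t0 \<longleftrightarrow>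
     (\<forall>x\<in>M. su3_degenerate_at (M \<times> UNIV) F \<Psi>p \<Psi>m (x, t0)) \<and>
     (let s = (\<lambda>(x, t). \<bar>t - t0\<bar>)
      in leading_order (M \<times> {0<..<pi}) s g6 (cone_form s fst g))"

text \<open>The end \<open>q = q0\<close> of \<open>(M \<times> (0,\<pi>)) \<times> (0,\<pi>)\<close>, with link \<open>M \<times> (0,\<pi>)\<close> and link metric \<open>g6\<close>.\<close>

definition q_end_7 ::
    "'a::euclidean_space set \<Rightarrow>
      (('a \<times> real) \<times> real, real) form \<Rightarrow>
      (('a \<times> real) \<times> real) riem_metric \<Rightarrow>
      ('a \<times> real) riem_metric \<Rightarrow> real \<Rightarrow> bool" where
  "q_end_7 M \<phi> g7 g6 q0 \<longleftrightarrow>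
     (\<forall>x\<in>M. \<forall>t\<in>{0..pi}. g2_degenerate_at ((M \<times> UNIV) \<times> UNIV) \<phi> ((x, t), q0)) \<and>
     (let s = (\<lambda>(y, q). \<bar>q - q0\<bar>)
      in leading_order ((M \<times> {0<..<pi}) \<times> {0<..<pi}) s g7 (cone_form s fst g6))"

text \<open>
  The end \<open>t = t0\<close> is, for every \<open>q\<close>, a conical end of the slice \<open>q = const\<close>, whose metric is
  \<open>sin\<^sup>2 q (dt\<^sup>2 + sin\<^sup>2 t g)\<close>; the distance parameter of the slice to it is \<open>s = sin q \<bar>t - t0\<bar>\<close>.
  So the leading order of the full metric is \<open>dq\<^sup>2 + (ds\<^sup>2 + s\<^sup>2 g)\<close>.
\<close>

definition t_end_7 ::
    "'a::euclidean_space set \<Rightarrow>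
      (('a \<times> real) \<times> real, real) form \<Rightarrow>
      (('a \<times> real) \<times> real) riem_metric \<Rightarrow> 'a riem_metric \<Rightarrow>
      real \<Rightarrow> bool" where
  "t_end_7 M \<phi> g7 g t0 \<longleftrightarrow>
     (\<forall>x\<in>M. \<forall>q\<in>{0..pi}. g2_degenerate_at ((M \<times> UNIV) \<times> UNIV) \<phi> ((x, t0), q)) \<and>
     (let s = (\<lambda>((x, t), q). sin q * \<bar>t - t0\<bar>)
      in leading_order ((M \<times> {0<..<pi}) \<times> {0<..<pi}) (\<lambda>((x, t), q). \<bar>t - t0\<bar>) g7
           (\<lambda>p u v. snd u * snd v + cone_form s (fst \<circ> fst) g p u v))"

section \<open>The Sasaki-Einstein structure on the product of spheres\<close>

text \<open>
  The coordinate functions \<open>xc i\<close> are labelled \<open>x\<^sub>1, x\<^sub>2, x\<^sub>3\<close> on the first and \<open>x\<^sub>5, \<dots>, x\<^sub>8\<close> on the second factor.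
\<close>

type_synonym R3R4 = "(real^3) \<times> (real^4)"

definition xc :: "nat \<Rightarrow> R3R4 \<Rightarrow> real" where
  "xc i p = (if i \<le> 3 then fst p $ of_nat i else snd p $ of_nat (i - 4))"

definition dx :: "nat \<Rightarrow> (R3R4, real) form" where
  "dx i = ext_d (zero_form (xc i))"

definition S2xS3 :: "R3R4 set" where
  "S2xS3 = {p. (xc 1 p)\<^sup>2 + (xc 2 p)\<^sup>2 + (xc 3 p)\<^sup>2 = 1 \<and>
               (xc 5 p)\<^sup>2 + (xc 6 p)\<^sup>2 + (xc 7 p)\<^sup>2 + (xc 8 p)\<^sup>2 = 1}"

definition alpha :: "nat \<Rightarrow> (R3R4, real) form" where
  "alpha j =
     (if j = 1 then 2 \<cdot> xc 3 \<odot> dx 2 - 2 \<cdot> xc 2 \<odot> dx 3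
      else if j = 2 then (- 2) \<cdot> xc 3 \<odot> dx 1 + 2 \<cdot> xc 1 \<odot> dx 3
      else 2 \<cdot> xc 2 \<odot> dx 1 - 2 \<cdot> xc 1 \<odot> dx 2)"

definition beta :: "nat \<Rightarrow> (R3R4, real) form" where
  "beta j =
     (if j = 1 then 2 \<cdot> xc 8 \<odot> dx 5 + 2 \<cdot> xc 7 \<odot> dx 6 - 2 \<cdot> xc 6 \<odot> dx 7 - 2 \<cdot> xc 5 \<odot> dx 8
      else if j = 2 then (- 2) \<cdot> xc 7 \<odot> dx 5 + 2 \<cdot> xc 8 \<odot> dx 6 + 2 \<cdot> xc 5 \<odot> dx 7 - 2 \<cdot> xc 6 \<odot> dx 8
      else 2 \<cdot> xc 6 \<odot> dx 5 - 2 \<cdot> xc 5 \<odot> dx 6 + 2 \<cdot> xc 8 \<odot> dx 7 - 2 \<cdot> xc 7 \<odot> dx 8)"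

definition vol_S2 :: "(R3R4, real) form" where
  "vol_S2 = (- 1) \<cdot> xc 3 \<odot> (dx 1 \<and>\<^sub>f dx 2) + xc 2 \<odot> (dx 1 \<and>\<^sub>f dx 3) - xc 1 \<odot> (dx 2 \<and>\<^sub>f dx 3)"

definition eta :: "(R3R4, real) form" where
  "eta = (1 / 3) \<cdot> (\<Sum>j=1..3. xc j \<odot> beta j)"

definition omega1 :: "(R3R4, real) form" where
  "omega1 = (sqrt 3 / 2 * (sqrt 3 / 18)) \<cdot> (\<Sum>j=1..3. alpha j \<and>\<^sub>f beta j)"

definition omega2 :: "(R3R4, real) form" where
  "omega2 = (sqrt 3 / 2) \<cdot> ((2 * sqrt 3 / 9) \<cdot> vol_S2 + (sqrt 3 / 9) \<cdot> (\<Sum>j=1..3. dx j \<and>\<^sub>f beta j))"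

definition omega3 :: "(R3R4, real) form" where
  "omega3 = (- (1 / 2)) \<cdot> ext_d eta"

definition F6 :: "(R3R4 \<times> real, real) form" where
  "F6 = cyl_F eta omega1 omega3"

definition Psi_plus6 :: "(R3R4 \<times> real, real) form" where
  "Psi_plus6 = cyl_Psi_plus eta omega1 omega2 omega3"

definition Psi_minus6 :: "(R3R4 \<times> real, real) form" where
  "Psi_minus6 = cyl_Psi_minus eta omega1 omega2 omega3"

definition phi7 :: "((R3R4 \<times> real) \<times> real, real) form" where
  "phi7 = cyl_phi F6 Psi_plus6 Psi_minus6"

end

theory Submission
  imports Defs
begin

text \<open>
  Both assertions are instances of one construction, the sine cone, applied twice. If a coframe
  \<open>e\<close> is adapted to a Sasaki-Einstein SU(2)-structure, then the forms \<open>sin t e\<^sub>j\<close>, with two of the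
  \<open>e\<^sub>j\<close> rotated in their plane by the angle \<open>\<pi>/2 - t\<close>, together with \<open>dt\<close> form a coframe adapted to
  the SU(3)-structure of the first part (\<open>su3_adapted_cone\<close>). The same recipe, with the rotation in
  another plane, leads from SU(3) to G2 (\<open>su3_adapted_cone_rotated\<close>). A rotation does not change the
  sum of squares, so the metrics of these structures are the sine cones \<open>dt\<^sup>2 + sin\<^sup>2 t g\<close>, for
  every metric \<open>g\<close> of the structure below.

  The differential equations are consequences of the Leibniz rule (\<open>ext_d_wedge\<close>) and of the equations
  one dimension lower: the derivatives of the powers of \<open>sin t\<close> and \<open>cos t\<close> produce the terms with
  \<open>dt\<close>, and they combine by \<open>sin\<^sup>2 t + cos\<^sup>2 t = 1\<close> (\<open>nearly_kaehler_cone\<close>,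
  \<open>nearly_parallel_cone\<close>). Besides the structure equations they need that \<open>d \<omega>\<^sub>3\<close> and \<open>d \<Psi>\<^sub>+\<close>
  restrict to zero, which is \<open>d\<^sup>2 = 0\<close> on the manifold; here it follows from explicit formulas.

  The product of the spheres is treated in vector notation. With the position \<open>x\<close> on the two-sphere and
  the vector \<open>\<beta>\<close> of the three forms on the three-sphere, all forms are scalar and triple products of
  \<open>x\<close>, \<open>dx\<close> and \<open>\<beta>\<close>. The structure equations follow from \<open>d \<beta> = - (\<beta> \<times> \<beta>) / 2\<close> and from
  the tangent plane of the two-sphere being orthogonal to \<open>x\<close> (\<open>structure_equations\<close>), and a local
  orthonormal frame of the two-sphere gives an adapted coframe (\<open>se_coframe_at\<close>).

  At \<open>t = 0, \<pi>\<close> and \<open>q = 0, \<pi>\<close> all forms of the cones vanish, whereas the standard forms of a coframe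
  never do (\<open>std_F_nonzero\<close>, \<open>std_phi_nonzero\<close>). The leading order of the metrics at these ends is that
  of \<open>sin r\<close>, which is \<open>r\<close>.
\<close>

section \<open>Smooth functions\<close>

lemma frechet_derivative_apply:
  "(f has_derivative f') (at x) \<Longrightarrow> frechet_derivative f (at x) v = f' v"
  using frechet_derivative_at by metis

lemma C_k_on_differentiable:
  assumes "C_k_on (Suc k) U f" "open U" "x \<in> U"
  shows "(f has_derivative frechet_derivative f (at x)) (at x)"
  using assms by (simp add: differentiable_on_eq_differentiable_at flip: frechet_derivative_works)

lemma C_k_on_cong:
  assumes "open U" "\<And>x. x \<in> U \<Longrightarrow> f x = g x" "C_k_on k U f"
  shows "C_k_on k U g"
  using assms(2,3)
proof (induction k arbitrary: f g)
  case 0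
  then show ?case using continuous_on_cong by force
next
  case (Suc k)
  have g: "(g has_derivative frechet_derivative f (at x)) (at x)" if "x \<in> U" for x
    using C_k_on_differentiable[OF Suc.prems(2) \<open>open U\<close> that] Suc.prems(1) \<open>open U\<close> that
    by (blast intro: has_derivative_transform_within_open)
  have "C_k_on k U (\<lambda>x. frechet_derivative g (at x) v)" for v
    by (rule Suc.IH[of "\<lambda>x. frechet_derivative f (at x) v"])
      (use Suc.prems(2) frechet_derivative_apply[OF g] in auto)
  then show ?case
    using g \<open>open U\<close> by (auto simp: differentiable_on_eq_differentiable_at differentiable_def)
qed

text \<open>
  The value of \<open>frechet_derivative\<close> may be replaced by any formula for the derivative on the open
  set, which turns each closure property below into an induction on the product, chain or quotient rule.
\<close>

lemma C_k_on_derivI: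
  assumes "open U" "\<And>x. x \<in> U \<Longrightarrow> (f has_derivative f' x) (at x)" "\<And>v. C_k_on k U (\<lambda>x. f' x v)"
  shows "C_k_on (Suc k) U f"
proof -
  have "f differentiable_on U"
    using assms(1,2) by (auto simp: differentiable_on_eq_differentiable_at differentiable_def)
  moreover have "C_k_on k U (\<lambda>x. frechet_derivative f (at x) v)" for v
    by (rule C_k_on_cong[OF assms(1) _ assms(3)[of v]]) (simp add: frechet_derivative_apply[OF assms(2)])
  ultimately show ?thesis by simp
qed

lemma C_k_on_pred: "open U \<Longrightarrow> C_k_on (Suc k) U f \<Longrightarrow> C_k_on k U f"
  by (induction k arbitrary: f) (auto simp: differentiable_imp_continuous_on)

lemma C_k_on_subset: "C_k_on k U f \<Longrightarrow> V \<subseteq> U \<Longrightarrow> C_k_on k V f"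
  by (induction k arbitrary: f) (auto intro: continuous_on_subset differentiable_on_subset)

lemma C_k_on_const: "C_k_on k U (\<lambda>x. c)"
  by (induction k arbitrary: c) auto

lemma C_k_on_linear:
  assumes "bounded_linear f" "open U" shows "C_k_on k U f"
proof (cases k)
  case 0 then show ?thesis using assms bounded_linear.linear linear_continuous_on by auto
next
  case (Suc n)
  show ?thesis unfolding Suc
    by (rule C_k_on_derivI[OF assms(2) bounded_linear_imp_has_derivative[OF assms(1)] C_k_on_const])
qed

lemma C_k_on_add:
  assumes "open U" "C_k_on k U f" "C_k_on k U g" shows "C_k_on k U (\<lambda>x. f x + g x)"
  using assms(2,3)
proof (induction k arbitrary: f g)
  case 0 then show ?case by (auto intro: continuous_on_add)
next
  case (Suc k)
  show ?case
    by (rule C_k_on_derivI[OF \<open>open U\<close> has_derivative_add, where k=k])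
      (use Suc \<open>open U\<close> C_k_on_differentiable in \<open>blast | auto\<close>)+
qed

lemma C_k_on_mult:
  assumes "open U" "C_k_on k U f" "C_k_on k U g" shows "C_k_on k U (\<lambda>x. f x * g x)"
  using assms(2,3)
proof (induction k arbitrary: f g)
  case 0 then show ?case by (auto intro: continuous_on_mult)
next
  case (Suc k)
  show ?case
  proof (rule C_k_on_derivI[where
        f' = "\<lambda>x v. f x * frechet_derivative g (at x) v + frechet_derivative f (at x) v * g x"])
    show "C_k_on k U (\<lambda>x. f x * frechet_derivative g (at x) v + frechet_derivative f (at x) v * g x)" for v
      by (intro C_k_on_add \<open>open U\<close> Suc.IH) (use Suc.prems C_k_on_pred[OF \<open>open U\<close>] in auto)
    show "((\<lambda>x. f x * g x) has_derivative
        (\<lambda>v. f x * frechet_derivative g (at x) v + frechet_derivative f (at x) v * g x)) (at x)"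
      if "x \<in> U" for x
      using has_derivative_mult[OF C_k_on_differentiable[OF Suc.prems(1) \<open>open U\<close> that]
          C_k_on_differentiable[OF Suc.prems(2) \<open>open U\<close> that]] .
  qed (rule \<open>open U\<close>)
qed

lemma C_k_on_inverse:
  assumes "open U" "C_k_on k U f" "\<And>x. x \<in> U \<Longrightarrow> f x \<noteq> 0" shows "C_k_on k U (\<lambda>x. inverse (f x))"
  using assms(2)
proof (induction k)
  case 0 then show ?case using assms(3) by (auto intro: continuous_on_inverse)
next
  case (Suc k)
  have inv: "C_k_on k U (\<lambda>x. inverse (f x))"
    using Suc.IH C_k_on_pred[OF \<open>open U\<close> Suc.prems] by blast
  show ?case
  proof (rule C_k_on_derivI[OF \<open>open U\<close>])
    show "C_k_on k U (\<lambda>x. - 1 * (inverse (f x) * frechet_derivative f (at x) v * inverse (f x)))" for v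
      by (intro C_k_on_mult C_k_on_const \<open>open U\<close> inv) (use Suc.prems in auto)
    show "((\<lambda>x. inverse (f x)) has_derivative
        (\<lambda>v. - 1 * (inverse (f x) * frechet_derivative f (at x) v * inverse (f x)))) (at x)"
      if "x \<in> U" for x
      using Deriv.has_derivative_inverse[OF assms(3)[OF that] C_k_on_differentiable[OF Suc.prems \<open>open U\<close> that]]
      by simp
  qed
qed

lemma C_k_on_fst:
  fixes f :: "'a::euclidean_space \<Rightarrow> real" and N :: "'b::euclidean_space set"
  assumes "open U" "open N" "C_k_on k U f" shows "C_k_on k (U \<times> N) (\<lambda>p. f (fst p))"
  using assms(3)
proof (induction k arbitrary: f)
  case 0
  then show ?case by (auto intro: continuous_on_compose2[OF _ continuous_on_fst] continuous_on_id)
next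
  case (Suc k)
  have "open (U \<times> N)" using assms open_Times by blast
  show ?case
  proof (rule C_k_on_derivI[OF \<open>open (U \<times> N)\<close>])
    show "C_k_on k (U \<times> N) (\<lambda>p. frechet_derivative f (at (fst p)) (fst v))" for v
      using Suc by auto
    show "((\<lambda>p. f (fst p)) has_derivative (\<lambda>v. frechet_derivative f (at (fst p)) (fst v))) (at p)"
      if "p \<in> U \<times> N" for p
      using has_derivative_compose[OF has_derivative_fst[OF has_derivative_ident]
          C_k_on_differentiable[OF Suc.prems \<open>open U\<close>]] that
      by auto
  qed
qed

text \<open>Sine and cosine are derivatives of each other up to sign, so neither induction closes without the other.\<close>

lemma C_k_on_sin_cos_snd:
  "C_k_on k UNIV (\<lambda>p::'a::euclidean_space \<times> real. sin (snd p)) \<and>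
   C_k_on k UNIV (\<lambda>p::'a::euclidean_space \<times> real. cos (snd p))"
proof (induction k)
  case 0
  then show ?case by (auto intro!: continuous_intros)
next
  case (Suc k)
  have s: "C_k_on k UNIV (\<lambda>p::'a \<times> real. cos (snd p) * snd v)"
   and c: "C_k_on k UNIV (\<lambda>p::'a \<times> real. sin (snd p) * (- snd v))" for v :: "'a \<times> real"
    by (rule C_k_on_mult; use Suc in \<open>simp add: C_k_on_const\<close>)+
  have "C_k_on (Suc k) UNIV (\<lambda>p::'a \<times> real. sin (snd p))"
    by (rule C_k_on_derivI[where f'="\<lambda>p v. cos (snd p) * snd v"]) (use s c in \<open>auto intro!: derivative_eq_intros\<close>)
  moreover have "C_k_on (Suc k) UNIV (\<lambda>p::'a \<times> real. cos (snd p))"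
    by (rule C_k_on_derivI[where f'="\<lambda>p v. sin (snd p) * (- snd v)"]) (use s c in \<open>auto intro!: derivative_eq_intros\<close>)
  ultimately show ?case ..
qed

lemma smooth_on_has_derivative:
  "smooth_on U f \<Longrightarrow> open U \<Longrightarrow> x \<in> U \<Longrightarrow> (f has_derivative frechet_derivative f (at x)) (at x)"
  using C_k_on_differentiable unfolding smooth_on_def by blast

lemma smooth_on_differentiable: "smooth_on UNIV f \<Longrightarrow> f differentiable (at x)"
  using smooth_on_has_derivative differentiableI by blast

lemma smooth_on_subset: "smooth_on U f \<Longrightarrow> V \<subseteq> U \<Longrightarrow> smooth_on V f"
  unfolding smooth_on_def using C_k_on_subset by blast

lemma smooth_on_const: "smooth_on U (\<lambda>x. c)"
  by (simp add: smooth_on_def C_k_on_const)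

lemma smooth_on_linear: "bounded_linear f \<Longrightarrow> open U \<Longrightarrow> smooth_on U f"
  by (simp add: smooth_on_def C_k_on_linear)

lemma smooth_on_add: "open U \<Longrightarrow> smooth_on U f \<Longrightarrow> smooth_on U g \<Longrightarrow> smooth_on U (\<lambda>x. f x + g x)"
  by (simp add: smooth_on_def C_k_on_add)

lemma smooth_on_mult: "open U \<Longrightarrow> smooth_on U f \<Longrightarrow> smooth_on U g \<Longrightarrow> smooth_on U (\<lambda>x. f x * g x)"
  by (simp add: smooth_on_def C_k_on_mult)

lemma smooth_on_inverse:
  "open U \<Longrightarrow> smooth_on U f \<Longrightarrow> (\<And>x. x \<in> U \<Longrightarrow> f x \<noteq> 0) \<Longrightarrow> smooth_on U (\<lambda>x. inverse (f x))"
  by (simp add: smooth_on_def C_k_on_inverse)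

lemma smooth_on_uminus: "open U \<Longrightarrow> smooth_on U f \<Longrightarrow> smooth_on U (\<lambda>x. - f x)"
  using smooth_on_mult[OF _ smooth_on_const[of U "-1"]] by force

lemma smooth_on_diff: "open U \<Longrightarrow> smooth_on U f \<Longrightarrow> smooth_on U g \<Longrightarrow> smooth_on U (\<lambda>x. f x - g x)"
  using smooth_on_add[OF _ _ smooth_on_uminus] by force

lemma smooth_on_divide:
  "open U \<Longrightarrow> smooth_on U f \<Longrightarrow> smooth_on U g \<Longrightarrow> (\<And>x. x \<in> U \<Longrightarrow> g x \<noteq> 0) \<Longrightarrow>
   smooth_on U (\<lambda>x. f x / g x)"
  by (simp add: divide_inverse smooth_on_mult smooth_on_inverse)

lemma smooth_on_power: "open U \<Longrightarrow> smooth_on U f \<Longrightarrow> smooth_on U (\<lambda>x. f x ^ n)"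
  by (induction n) (auto intro: smooth_on_const smooth_on_mult)

lemma smooth_on_sum:
  "open U \<Longrightarrow> (\<And>i. i \<in> A \<Longrightarrow> smooth_on U (f i)) \<Longrightarrow> smooth_on U (\<lambda>x. \<Sum>i\<in>A. f i x)"
  by (induction A rule: infinite_finite_induct) (auto intro: smooth_on_const smooth_on_add)

lemma smooth_on_fst:
  fixes N :: "'b::euclidean_space set"
  shows "open U \<Longrightarrow> open N \<Longrightarrow> smooth_on U f \<Longrightarrow> smooth_on (U \<times> N) (\<lambda>p. f (fst p))"
  by (simp add: smooth_on_def C_k_on_fst)

lemma smooth_on_sin_snd: "smooth_on U (\<lambda>p::'a::euclidean_space \<times> real. sin (snd p))"
  and smooth_on_cos_snd: "smooth_on U (\<lambda>p::'a::euclidean_space \<times> real. cos (snd p))"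
  unfolding smooth_on_def using C_k_on_subset[OF _ subset_UNIV] C_k_on_sin_cos_snd by blast+

lemmas smooth_intros = smooth_on_const smooth_on_add smooth_on_mult smooth_on_uminus smooth_on_diff
  smooth_on_power smooth_on_sin_snd smooth_on_cos_snd

section \<open>The algebra of forms\<close>

text \<open>
  Contraction with a vector is an antiderivation of the wedge product (\<open>wedge_Cons\<close>), and together
  with the exterior derivative it satisfies Cartan's formula (\<open>ext_d_Cons\<close>). As a form is determined
  by its contractions, the laws of exterior algebra and the Leibniz rule are proved by induction on
  the list of arguments; sums over shuffles occur only in the proof of the antiderivation property.
\<close>

definition contract :: "'a \<Rightarrow> ('a, 'b) form \<Rightarrow> ('a, 'b) form" where
  "contract x \<alpha> = (\<lambda>p vs. \<alpha> p (x # vs))"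

text \<open>
  The degree is a property of the form at one point, because coframes are forms only on an open set.
\<close>

definition homogeneous :: "nat \<Rightarrow> ('a list \<Rightarrow> 'b::zero) \<Rightarrow> bool" where
  "homogeneous k A \<longleftrightarrow> (\<forall>vs. length vs \<noteq> k \<longrightarrow> A vs = 0)"

lemma contract_apply: "contract x \<alpha> p vs = \<alpha> p (x # vs)"
  by (simp add: contract_def)

lemma fscale_apply: "(f \<odot> \<alpha>) p vs = f p * \<alpha> p vs"
  by (simp add: fscale_def)

lemma cscale_apply: "(c \<cdot> \<alpha>) p vs = c * \<alpha> p vs"
  by (simp add: cscale_def)

lemma homogeneousD: "homogeneous k A \<Longrightarrow> length vs \<noteq> k \<Longrightarrow> A vs = 0"
  by (simp add: homogeneous_def)

lemma homogeneous_contract: "homogeneous j (\<alpha> p) \<Longrightarrow> homogeneous (j - 1) (contract x \<alpha> p)"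
  by (auto simp: homogeneous_def contract_def)

lemma homogeneous_contract_Suc: "homogeneous (Suc j) (\<alpha> p) \<Longrightarrow> homogeneous j (contract x \<alpha> p)"
  using homogeneous_contract by fastforce

lemma contract_homogeneous_0: "homogeneous 0 (\<alpha> p) \<Longrightarrow> contract x \<alpha> p = 0"
  by (auto simp: homogeneous_def contract_def)

subsection \<open>The wedge product\<close>

lemma sum_Pow_lessThan_Suc:
  "(\<Sum>S\<in>Pow {..<Suc n}. f S) = (\<Sum>S\<in>Pow {..<n}. f (Suc ` S) + f (insert 0 (Suc ` S)))"
proof -
  have inj: "inj_on (image Suc) X" "inj_on (\<lambda>S. insert 0 (Suc ` S)) X" for X
    by (auto intro!: inj_onI simp: inj_image_eq_iff)
  have P: "Pow {..<Suc n} = image Suc ` Pow {..<n} \<union> (\<lambda>S. insert 0 (Suc ` S)) ` Pow {..<n}"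
    by (simp add: lessThan_Suc_eq_insert_0 Pow_insert image_Pow_surj[OF refl, symmetric] image_image)
  have "image Suc ` Pow {..<n} \<inter> (\<lambda>S. insert 0 (Suc ` S)) ` Pow {..<n} = {}" by auto
  then show ?thesis
    unfolding P by (simp add: sum.union_disjoint sum.reindex[OF inj(1)] sum.reindex[OF inj(2)] sum.distrib)
qed

lemma card_Suc_Suc_image: "card (map_prod Suc Suc ` X) = card X"
  by (rule card_image) (auto intro: inj_onI)

lemma shuffle_sign_insert_0:
  "shuffle_sign (Suc n) (insert 0 (Suc ` S)) = shuffle_sign n S"
proof -
  let ?X = "{(i, j). i < n \<and> j < n \<and> i \<in> S \<and> j \<notin> S \<and> j < i}"
  have "{(i, j). i < Suc n \<and> j < Suc n \<and> i \<in> insert 0 (Suc ` S) \<and> j \<notin> insert 0 (Suc ` S) \<and> j < i}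
      = map_prod Suc Suc ` ?X"
    by (auto simp: image_iff map_prod_def elim!: less_natE)
  then show ?thesis
    by (simp only: shuffle_sign_def card_Suc_Suc_image)
qed

lemma shuffle_sign_Suc_image:
  assumes "S \<subseteq> {..<n}"
  shows "shuffle_sign (Suc n) (Suc ` S) = (- 1) ^ card S * shuffle_sign n S"
proof -
  let ?X = "{(i, j). i < n \<and> j < n \<and> i \<in> S \<and> j \<notin> S \<and> j < i}"
  have eq: "{(i, j). i < Suc n \<and> j < Suc n \<and> i \<in> Suc ` S \<and> j \<notin> Suc ` S \<and> j < i}
      = map_prod Suc Suc ` ?X \<union> (\<lambda>i. (Suc i, 0)) ` S" (is "?L = ?R")
  proof (intro equalityI subsetI)
    fix z assume "z \<in> ?L"
    then obtain i j where "z = (Suc i, j)" "i < n" "i \<in> S" "j < Suc n" "j \<notin> Suc ` S" "j < Suc i" by auto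
    then show "z \<in> ?R" by (cases j) (auto simp: image_iff)
  qed (use assms in auto)
  have "?X \<subseteq> {..<n} \<times> {..<n}" by auto
  then have "finite ?X" "finite S" using assms finite_subset by blast+
  then have "card ?R = card ?X + card S"
    by (subst card_Un_disjoint) (auto simp: card_Suc_Suc_image card_image inj_on_def)
  then show ?thesis
    by (simp add: shuffle_sign_def eq power_add mult.commute)
qed

lemma wedge_Nil: "(\<alpha> \<and>\<^sub>f \<beta>) p [] = \<alpha> p [] * \<beta> p []"
  by (simp add: wedge_def shuffle_sign_def)

text \<open>
  The first argument goes either to \<open>\<alpha>\<close> or to \<open>\<beta>\<close>; in the second case it moves past the \<open>j\<close>
  arguments of \<open>\<alpha>\<close>, which gives the sign.
\<close>

lemma wedge_Cons:
  assumes "homogeneous j (\<alpha> p)"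
  shows "(\<alpha> \<and>\<^sub>f \<beta>) p (x # xs) =
    (contract x \<alpha> \<and>\<^sub>f \<beta>) p xs + (- 1) ^ j * (\<alpha> \<and>\<^sub>f contract x \<beta>) p xs"
proof -
  let ?n = "length xs"
  have *: "(- 1) ^ card S * \<alpha> p (nths xs S) = (- 1) ^ j * \<alpha> p (nths xs S)" if "S \<subseteq> {..<?n}" for S
  proof -
    have "{i. i < ?n \<and> i \<in> S} = S" using that by auto
    then have "length (nths xs S) = card S" by (simp add: length_nths)
    then show ?thesis using homogeneousD[OF assms, of "nths xs S"] by (cases "card S = j") auto
  qed
  have "{j. Suc j \<notin> Suc ` S} = - S" for S by auto
  then have "(\<alpha> \<and>\<^sub>f \<beta>) p (x # xs) = (\<Sum>S\<in>Pow {..<?n}.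
      shuffle_sign (Suc ?n) (Suc ` S) * \<alpha> p (nths xs S) * \<beta> p (x # nths xs (- S)) +
      shuffle_sign ?n S * \<alpha> p (x # nths xs S) * \<beta> p (nths xs (- S)))"
    by (simp add: wedge_def sum_Pow_lessThan_Suc shuffle_sign_insert_0 nths_Cons inj_image_mem_iff
        Compl_eq mult_ac)
  also have "\<dots> = (\<Sum>S\<in>Pow {..<?n}.
      shuffle_sign ?n S * \<alpha> p (x # nths xs S) * \<beta> p (nths xs (- S)) +
      (- 1) ^ j * (shuffle_sign ?n S * \<alpha> p (nths xs S) * \<beta> p (x # nths xs (- S))))"
  proof (rule sum.cong[OF refl])
    fix S assume "S \<in> Pow {..<?n}"
    then have "shuffle_sign (Suc ?n) (Suc ` S) * \<alpha> p (nths xs S) =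
        shuffle_sign ?n S * ((- 1) ^ j * \<alpha> p (nths xs S))"
      using * by (simp add: shuffle_sign_Suc_image mult_ac)
    then show "shuffle_sign (Suc ?n) (Suc ` S) * \<alpha> p (nths xs S) * \<beta> p (x # nths xs (- S)) +
        shuffle_sign ?n S * \<alpha> p (x # nths xs S) * \<beta> p (nths xs (- S)) =
        shuffle_sign ?n S * \<alpha> p (x # nths xs S) * \<beta> p (nths xs (- S)) +
        (- 1) ^ j * (shuffle_sign ?n S * \<alpha> p (nths xs S) * \<beta> p (x # nths xs (- S)))"
      by (simp add: mult_ac)
  qed
  finally show ?thesis
    by (simp add: wedge_def contract_def sum.distrib sum_distrib_left)
qed

lemma wedge_cong: "\<alpha> p = \<alpha>' p \<Longrightarrow> \<beta> p = \<beta>' p \<Longrightarrow> (\<alpha> \<and>\<^sub>f \<beta>) p = (\<alpha>' \<and>\<^sub>f \<beta>') p"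
  by (simp add: wedge_def)

lemma wedge_zero_left: "\<alpha> p = 0 \<Longrightarrow> (\<alpha> \<and>\<^sub>f \<beta>) p vs = 0"
  and wedge_zero_right: "\<beta> p = 0 \<Longrightarrow> (\<alpha> \<and>\<^sub>f \<beta>) p vs = 0"
  by (simp_all add: wedge_def)

lemma wedge_add_left: "((\<alpha> + \<beta>) \<and>\<^sub>f \<gamma>) = (\<alpha> \<and>\<^sub>f \<gamma>) + (\<beta> \<and>\<^sub>f \<gamma>)"
  and wedge_add_right: "(\<gamma> \<and>\<^sub>f (\<alpha> + \<beta>)) = (\<gamma> \<and>\<^sub>f \<alpha>) + (\<gamma> \<and>\<^sub>f \<beta>)"
  and wedge_diff_left: "((\<alpha> - \<beta>) \<and>\<^sub>f \<gamma>) = (\<alpha> \<and>\<^sub>f \<gamma>) - (\<beta> \<and>\<^sub>f \<gamma>)"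
  and wedge_diff_right: "(\<gamma> \<and>\<^sub>f (\<alpha> - \<beta>)) = (\<gamma> \<and>\<^sub>f \<alpha>) - (\<gamma> \<and>\<^sub>f \<beta>)"
  by (simp_all add: wedge_def fun_eq_iff algebra_simps sum.distrib sum_subtractf)

lemma wedge_cscale_left: "((c \<cdot> \<alpha>) \<and>\<^sub>f \<beta>) = c \<cdot> (\<alpha> \<and>\<^sub>f \<beta>)"
  and wedge_cscale_right: "(\<alpha> \<and>\<^sub>f (c \<cdot> \<beta>)) = c \<cdot> (\<alpha> \<and>\<^sub>f \<beta>)"
  and wedge_fscale_left: "((f \<odot> \<alpha>) \<and>\<^sub>f \<beta>) = f \<odot> (\<alpha> \<and>\<^sub>f \<beta>)"
  and wedge_fscale_right: "(\<alpha> \<and>\<^sub>f (f \<odot> \<beta>)) = f \<odot> (\<alpha> \<and>\<^sub>f \<beta>)"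
  by (simp_all add: wedge_def cscale_def fscale_def fun_eq_iff sum_distrib_left mult_ac)

lemmas wedge_linear = wedge_add_left wedge_add_right wedge_diff_left wedge_diff_right
  wedge_cscale_left wedge_cscale_right wedge_fscale_left wedge_fscale_right

lemmas form_apply = plus_fun_apply minus_apply fscale_apply cscale_apply

lemma contract_wedge:
  assumes "homogeneous j (\<alpha> p)"
  shows "contract x (\<alpha> \<and>\<^sub>f \<beta>) p = ((contract x \<alpha> \<and>\<^sub>f \<beta>) + (- 1) ^ j \<cdot> (\<alpha> \<and>\<^sub>f contract x \<beta>)) p"
  by (simp add: fun_eq_iff contract_apply wedge_Cons[of j \<alpha> p, OF assms] form_apply)

lemma homogeneous_wedge:
  assumes "homogeneous j (\<alpha> p)" "homogeneous k (\<beta> p)"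
  shows "homogeneous (j + k) ((\<alpha> \<and>\<^sub>f \<beta>) p)"
proof -
  have "\<alpha> p (nths vs S) * \<beta> p (nths vs (- S)) = 0" if "length vs \<noteq> j + k" for vs S
  proof -
    have "{i. i < length vs \<and> i \<in> S} \<union> {i. i < length vs \<and> i \<in> - S} = {..<length vs}" by auto
    then have "length (nths vs S) + length (nths vs (- S)) = length vs"
      unfolding length_nths by (subst card_Un_disjoint[symmetric]) auto
    then have "length (nths vs S) \<noteq> j \<or> length (nths vs (- S)) \<noteq> k" using that by auto
    then show ?thesis using assms homogeneousD by fastforce
  qed
  then show ?thesis by (simp add: homogeneous_def wedge_def mult.assoc)
qed

lemma wedge_assoc:
  fixes \<alpha> \<beta> \<gamma> :: "('a, real) form"
  assumes "homogeneous j (\<alpha> p)" "homogeneous k (\<beta> p)"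
  shows "((\<alpha> \<and>\<^sub>f \<beta>) \<and>\<^sub>f \<gamma>) p vs = (\<alpha> \<and>\<^sub>f \<beta> \<and>\<^sub>f \<gamma>) p vs"
  using assms
proof (induction vs arbitrary: \<alpha> \<beta> \<gamma> j k)
  case Nil
  show ?case by (simp add: wedge_Nil)
next
  case (Cons x xs)
  note hom = Cons.prems homogeneous_contract[of j \<alpha> p x, OF Cons.prems(1)]
    homogeneous_contract[of k \<beta> p x, OF Cons.prems(2)]
  have "(contract x (\<alpha> \<and>\<^sub>f \<beta>) \<and>\<^sub>f \<gamma>) p =
      (((contract x \<alpha> \<and>\<^sub>f \<beta>) + (- 1) ^ j \<cdot> (\<alpha> \<and>\<^sub>f contract x \<beta>)) \<and>\<^sub>f \<gamma>) p"
    by (rule wedge_cong) (simp_all add: contract_wedge[of j \<alpha>, OF hom(1)])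
  then have "((\<alpha> \<and>\<^sub>f \<beta>) \<and>\<^sub>f \<gamma>) p (x # xs) =
      ((contract x \<alpha> \<and>\<^sub>f \<beta>) \<and>\<^sub>f \<gamma>) p xs + (- 1) ^ j * ((\<alpha> \<and>\<^sub>f contract x \<beta>) \<and>\<^sub>f \<gamma>) p xs +
      (- 1) ^ (j + k) * ((\<alpha> \<and>\<^sub>f \<beta>) \<and>\<^sub>f contract x \<gamma>) p xs"
    using wedge_Cons[of "j + k" "\<alpha> \<and>\<^sub>f \<beta>" p \<gamma> x xs, OF homogeneous_wedge[of j \<alpha> p k \<beta>, OF hom(1,2)]]
    by (simp add: wedge_linear form_apply)
  moreover
  have "(\<alpha> \<and>\<^sub>f contract x (\<beta> \<and>\<^sub>f \<gamma>)) p =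
      (\<alpha> \<and>\<^sub>f ((contract x \<beta> \<and>\<^sub>f \<gamma>) + (- 1) ^ k \<cdot> (\<beta> \<and>\<^sub>f contract x \<gamma>))) p"
    by (rule wedge_cong) (simp_all add: contract_wedge[of k \<beta>, OF hom(2)])
  then have "(\<alpha> \<and>\<^sub>f \<beta> \<and>\<^sub>f \<gamma>) p (x # xs) =
      (contract x \<alpha> \<and>\<^sub>f \<beta> \<and>\<^sub>f \<gamma>) p xs + (- 1) ^ j * ((\<alpha> \<and>\<^sub>f contract x \<beta> \<and>\<^sub>f \<gamma>) p xs +
      (- 1) ^ k * (\<alpha> \<and>\<^sub>f \<beta> \<and>\<^sub>f contract x \<gamma>) p xs)"
    using wedge_Cons[of j \<alpha> p "\<beta> \<and>\<^sub>f \<gamma>", where x = x and xs = xs, OF hom(1)]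
    by (simp add: wedge_linear form_apply)
  ultimately show ?case
    using Cons.IH[of "j - 1" "contract x \<alpha>" k \<beta> \<gamma>, OF hom(3,2)]
      Cons.IH[of j \<alpha> "k - 1" "contract x \<beta>" \<gamma>, OF hom(1,4)]
      Cons.IH[of j \<alpha> k \<beta> "contract x \<gamma>", OF hom(1,2)]
    by (simp add: algebra_simps power_add)
qed

lemma wedge_commute:
  fixes \<alpha> \<beta> :: "('a, real) form"
  assumes "homogeneous j (\<alpha> p)" "homogeneous k (\<beta> p)"
  shows "(\<alpha> \<and>\<^sub>f \<beta>) p vs = (- 1) ^ (j * k) * (\<beta> \<and>\<^sub>f \<alpha>) p vs"
  using assms
proof (induction vs arbitrary: \<alpha> \<beta> j k)
  case Nil
  then show ?case by (cases "j = 0 \<and> k = 0") (auto simp: wedge_Nil homogeneous_def)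
next
  case (Cons x xs)
  have a: "(contract x \<alpha> \<and>\<^sub>f \<beta>) p xs = (- 1) ^ (j * k + k) * (\<beta> \<and>\<^sub>f contract x \<alpha>) p xs"
  proof (cases j)
    case 0
    then show ?thesis
      using Cons.prems(1) contract_homogeneous_0[of \<alpha> p x] by (simp add: wedge_zero_left wedge_zero_right)
  next
    case (Suc i)
    then show ?thesis
      using Cons.IH[of i "contract x \<alpha>" k \<beta>, OF homogeneous_contract_Suc Cons.prems(2)] Cons.prems(1)
      by (simp add: power_add)
  qed
  have b: "(- 1) ^ j * (\<alpha> \<and>\<^sub>f contract x \<beta>) p xs = (- 1) ^ (j * k) * (contract x \<beta> \<and>\<^sub>f \<alpha>) p xs"
  proof (cases k)
    case 0
    then show ?thesis
      using Cons.prems(2) contract_homogeneous_0[of \<beta> p x] by (simp add: wedge_zero_left wedge_zero_right)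
  next
    case (Suc i)
    then show ?thesis
      using Cons.IH[of j \<alpha> i "contract x \<beta>", OF Cons.prems(1) homogeneous_contract_Suc] Cons.prems(2)
      by (simp add: power_add)
  qed
  show ?case
    unfolding wedge_Cons[of j \<alpha>, OF Cons.prems(1)] wedge_Cons[of k \<beta>, OF Cons.prems(2)] a b
    by (simp add: algebra_simps power_add)
qed

lemma wedge_zero_form: "(zero_form f \<and>\<^sub>f \<alpha>) = f \<odot> \<alpha>"
proof -
  have "(zero_form f \<and>\<^sub>f \<alpha>) p vs = f p * \<alpha> p vs" for p vs
  proof (induction vs arbitrary: \<alpha>)
    case Nil show ?case by (simp add: wedge_Nil zero_form_def)
  next
    case (Cons x xs)
    have z: "homogeneous 0 (zero_form f p)" by (simp add: homogeneous_def zero_form_def)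
    then show ?case
      using Cons wedge_Cons[of 0 "zero_form f", OF z] wedge_zero_left[of "contract x (zero_form f)", OF contract_homogeneous_0]
      by (simp add: contract_apply)
  qed
  then show ?thesis by (simp add: fun_eq_iff fscale_apply)
qed

subsection \<open>The exterior derivative\<close>

text \<open>
  This is the Lie derivative along the constant vector field \<open>v\<close>.
\<close>

definition coeff_derivative :: "'a::euclidean_space \<Rightarrow> ('a, real) form \<Rightarrow> ('a, real) form" where
  "coeff_derivative v \<alpha> = (\<lambda>p vs. frechet_derivative (\<lambda>y. \<alpha> y vs) (at p) v)"

definition differentiable_form :: "('a::euclidean_space, real) form \<Rightarrow> bool" where
  "differentiable_form \<alpha> \<longleftrightarrow> (\<forall>vs p. (\<lambda>y. \<alpha> y vs) differentiable (at p))"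

lemma differentiable_formD:
  "differentiable_form \<alpha> \<Longrightarrow> ((\<lambda>y. \<alpha> y vs) has_derivative (\<lambda>v. coeff_derivative v \<alpha> p vs)) (at p)"
  by (simp add: differentiable_form_def coeff_derivative_def frechet_derivative_works)

lemma coeff_derivative_eqI:
  "((\<lambda>y. \<alpha> y vs) has_derivative D) (at p) \<Longrightarrow> coeff_derivative v \<alpha> p vs = D v"
  by (simp add: coeff_derivative_def frechet_derivative_apply)

lemma differentiable_form_contract: "differentiable_form \<alpha> \<Longrightarrow> differentiable_form (contract x \<alpha>)"
  by (simp add: differentiable_form_def contract_def)

lemma coeff_derivative_contract: "coeff_derivative v (contract x \<alpha>) = contract x (coeff_derivative v \<alpha>)"
  by (simp add: coeff_derivative_def contract_def)

lemma
  assumes "differentiable_form \<alpha>" "differentiable_form \<beta>"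
  shows differentiable_form_add: "differentiable_form (\<alpha> + \<beta>)"
    and differentiable_form_diff: "differentiable_form (\<alpha> - \<beta>)"
    and coeff_derivative_add:
      "coeff_derivative v (\<alpha> + \<beta>) = coeff_derivative v \<alpha> + coeff_derivative v \<beta>"
    and coeff_derivative_diff:
      "coeff_derivative v (\<alpha> - \<beta>) = coeff_derivative v \<alpha> - coeff_derivative v \<beta>"
proof -
  note D = differentiable_formD[OF assms(1)] differentiable_formD[OF assms(2)]
  have A: "((\<lambda>y. (\<alpha> + \<beta>) y vs) has_derivative
      (\<lambda>v. coeff_derivative v \<alpha> p vs + coeff_derivative v \<beta> p vs)) (at p)" for p vs
    using has_derivative_add[OF D] by simp
  have B: "((\<lambda>y. (\<alpha> - \<beta>) y vs) has_derivative
      (\<lambda>v. coeff_derivative v \<alpha> p vs - coeff_derivative v \<beta> p vs)) (at p)" for p vs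
    using has_derivative_diff[OF D] by simp
  show "differentiable_form (\<alpha> + \<beta>)" "differentiable_form (\<alpha> - \<beta>)"
    unfolding differentiable_form_def using A B differentiableI by blast+
  show "coeff_derivative v (\<alpha> + \<beta>) = coeff_derivative v \<alpha> + coeff_derivative v \<beta>"
    "coeff_derivative v (\<alpha> - \<beta>) = coeff_derivative v \<alpha> - coeff_derivative v \<beta>"
    by (simp_all add: fun_eq_iff coeff_derivative_eqI[OF A] coeff_derivative_eqI[OF B])
qed

lemma
  assumes "differentiable_form \<alpha>" "differentiable_form \<beta>"
  shows differentiable_form_wedge: "differentiable_form (\<alpha> \<and>\<^sub>f \<beta>)"
    and coeff_derivative_wedge:
      "coeff_derivative v (\<alpha> \<and>\<^sub>f \<beta>) = (coeff_derivative v \<alpha> \<and>\<^sub>f \<beta>) + (\<alpha> \<and>\<^sub>f coeff_derivative v \<beta>)"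
proof -
  note D = differentiable_formD[OF assms(1)] differentiable_formD[OF assms(2)]
  have W: "((\<lambda>y. (\<alpha> \<and>\<^sub>f \<beta>) y vs) has_derivative
      (\<lambda>v. ((coeff_derivative v \<alpha> \<and>\<^sub>f \<beta>) + (\<alpha> \<and>\<^sub>f coeff_derivative v \<beta>)) p vs)) (at p)" for p vs
    unfolding wedge_def plus_fun_apply sum.distrib[symmetric]
    by (rule has_derivative_sum, rule has_derivative_eq_rhs,
        rule has_derivative_mult[OF has_derivative_mult[OF has_derivative_const D(1)] D(2)])
      (simp add: fun_eq_iff algebra_simps)
  show "differentiable_form (\<alpha> \<and>\<^sub>f \<beta>)"
    unfolding differentiable_form_def using W differentiableI by blast
  show "coeff_derivative v (\<alpha> \<and>\<^sub>f \<beta>) = (coeff_derivative v \<alpha> \<and>\<^sub>f \<beta>) + (\<alpha> \<and>\<^sub>f coeff_derivative v \<beta>)"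
    by (intro ext) (rule coeff_derivative_eqI[OF W])
qed

lemma differentiable_form_zero_form:
  "(\<And>p. f differentiable (at p)) \<Longrightarrow> differentiable_form (zero_form f)"
  unfolding differentiable_form_def zero_form_def
proof (intro allI)
  show "(\<And>p. f differentiable (at p)) \<Longrightarrow> (\<lambda>y. if vs = [] then f y else 0) differentiable (at p)"
    for vs :: "'a list" and p
    by (cases "vs = []") simp_all
qed

lemma differentiable_form_fscale:
  "(\<And>p. f differentiable (at p)) \<Longrightarrow> differentiable_form \<alpha> \<Longrightarrow> differentiable_form (f \<odot> \<alpha>)"
  using differentiable_form_wedge[OF differentiable_form_zero_form, of f \<alpha>] by (simp only: wedge_zero_form)

lemma cscale_eq_fscale: "c \<cdot> \<alpha> = (\<lambda>_. c) \<odot> \<alpha>"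
  by (simp add: cscale_def fscale_def)

lemma differentiable_form_cscale: "differentiable_form \<alpha> \<Longrightarrow> differentiable_form (c \<cdot> \<alpha>)"
  by (simp add: cscale_eq_fscale differentiable_form_fscale)

lemma ext_d_Nil: "ext_d \<alpha> p [] = 0"
  by (simp add: ext_d_def)

lemma ext_d_Cons: "ext_d \<alpha> p (x # xs) = coeff_derivative x \<alpha> p xs - ext_d (contract x \<alpha>) p xs"
  by (simp add: ext_d_def coeff_derivative_def contract_def sum.lessThan_Suc_shift sum_negf del: sum.lessThan_Suc)

lemma contract_ext_d: "contract x (ext_d \<alpha>) = coeff_derivative x \<alpha> - ext_d (contract x \<alpha>)"
  by (simp add: fun_eq_iff contract_apply ext_d_Cons)

lemma homogeneous_ext_d:
  assumes "\<And>y. homogeneous k (\<alpha> y)" shows "homogeneous (Suc k) (ext_d \<alpha> p)"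
proof -
  have "(\<lambda>y. \<alpha> y (take i vs @ drop (Suc i) vs)) = (\<lambda>y. 0)" if "length vs \<noteq> Suc k" "i < length vs" for i vs
    using that by (intro ext homogeneousD[OF assms]) auto
  then show ?thesis by (auto simp: homogeneous_def ext_d_def)
qed

lemma
  assumes "differentiable_form \<alpha>" "differentiable_form \<beta>"
  shows ext_d_add: "ext_d (\<alpha> + \<beta>) = ext_d \<alpha> + ext_d \<beta>"
    and ext_d_diff: "ext_d (\<alpha> - \<beta>) = ext_d \<alpha> - ext_d \<beta>"
proof -
  have "frechet_derivative (\<lambda>y. \<alpha> y vs + \<beta> y vs) (at p) v = coeff_derivative v \<alpha> p vs + coeff_derivative v \<beta> p vs"
    "frechet_derivative (\<lambda>y. \<alpha> y vs - \<beta> y vs) (at p) v = coeff_derivative v \<alpha> p vs - coeff_derivative v \<beta> p vs"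
    for p vs v
    using coeff_derivative_add[OF assms] coeff_derivative_diff[OF assms]
    by (simp_all add: coeff_derivative_def fun_eq_iff)
  then show "ext_d (\<alpha> + \<beta>) = ext_d \<alpha> + ext_d \<beta>" "ext_d (\<alpha> - \<beta>) = ext_d \<alpha> - ext_d \<beta>"
    by (simp_all add: ext_d_def fun_eq_iff coeff_derivative_def ring_distribs sum.distrib sum_subtractf)
qed

lemma ext_d_cscale:
  assumes "differentiable_form \<alpha>" shows "ext_d (c \<cdot> \<alpha>) = c \<cdot> ext_d \<alpha>"
proof -
  have "frechet_derivative (\<lambda>y. c * \<alpha> y ws) (at p) v = c * frechet_derivative (\<lambda>y. \<alpha> y ws) (at p) v" for ws p v
    using frechet_derivative_apply[OF has_derivative_mult_right[OF differentiable_formD[OF assms]]]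
    by (simp add: coeff_derivative_def)
  then show ?thesis
    by (simp add: ext_d_def cscale_def sum_distrib_left mult.left_commute)
qed

text \<open>
  Contracting both sides with \<open>x\<close> and using Cartan's formula, the Lie derivative along \<open>x\<close> obeys the
  product rule without signs, and what remains is the Leibniz rule for the pairs \<open>(contract x \<alpha>, \<beta>)\<close>
  and \<open>(\<alpha>, contract x \<beta>)\<close> on a shorter list.
\<close>

theorem ext_d_wedge:
  assumes "differentiable_form \<alpha>" "differentiable_form \<beta>" "\<And>y. homogeneous j (\<alpha> y)"
  shows "ext_d (\<alpha> \<and>\<^sub>f \<beta>) p vs = (ext_d \<alpha> \<and>\<^sub>f \<beta>) p vs + (- 1) ^ j * (\<alpha> \<and>\<^sub>f ext_d \<beta>) p vs"
  using assms
proof (induction vs arbitrary: \<alpha> \<beta> j)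
  case Nil
  then show ?case by (simp add: ext_d_Nil wedge_Nil)
next
  case (Cons x xs)
  note D = Cons.prems(1,2) differentiable_form_contract[of _ x, OF Cons.prems(1)]
    differentiable_form_contract[of _ x, OF Cons.prems(2)]
  have c: "contract x (\<alpha> \<and>\<^sub>f \<beta>) = (contract x \<alpha> \<and>\<^sub>f \<beta>) + (- 1) ^ j \<cdot> (\<alpha> \<and>\<^sub>f contract x \<beta>)"
    by (rule ext) (rule contract_wedge[of j \<alpha>, OF Cons.prems(3)])
  have s: "ext_d ((- 1) ^ j \<cdot> (\<alpha> \<and>\<^sub>f contract x \<beta>)) p xs = (- 1) ^ j * ext_d (\<alpha> \<and>\<^sub>f contract x \<beta>) p xs"
    by (simp only: ext_d_cscale[OF differentiable_form_wedge[OF D(1,4)]] cscale_apply)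
  have i: "(- 1) ^ (j - 1) * (contract x \<alpha> \<and>\<^sub>f ext_d \<beta>) p xs = - ((- 1) ^ j * (contract x \<alpha> \<and>\<^sub>f ext_d \<beta>) p xs)"
    using Cons.prems(3) contract_homogeneous_0[of \<alpha> p x] by (cases j) (auto simp: wedge_zero_left)
  have h: "homogeneous (Suc j) (ext_d \<alpha> p)" using Cons.prems(3) homogeneous_ext_d by blast
  have "ext_d (\<alpha> \<and>\<^sub>f \<beta>) p (x # xs) =
      (coeff_derivative x \<alpha> \<and>\<^sub>f \<beta>) p xs + (\<alpha> \<and>\<^sub>f coeff_derivative x \<beta>) p xs -
      ((ext_d (contract x \<alpha>) \<and>\<^sub>f \<beta>) p xs - (- 1) ^ j * (contract x \<alpha> \<and>\<^sub>f ext_d \<beta>) p xs) -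
      (- 1) ^ j * ((ext_d \<alpha> \<and>\<^sub>f contract x \<beta>) p xs + (- 1) ^ j * (\<alpha> \<and>\<^sub>f ext_d (contract x \<beta>)) p xs)"
    using D Cons.IH[OF D(3,2) homogeneous_contract, of j] Cons.IH[OF D(1,4), of j] Cons.prems(3) s i
    by (simp add: ext_d_Cons coeff_derivative_wedge c ext_d_add differentiable_form_wedge
        differentiable_form_cscale)
  then show ?case
    using wedge_Cons[where \<alpha> = "ext_d \<alpha>" and \<beta> = \<beta> and x = x and xs = xs, OF h]
      wedge_Cons[where \<alpha> = \<alpha> and p = p and \<beta> = "ext_d \<beta>" and x = x and xs = xs, OF Cons.prems(3)]
    by (cases "even j") (simp_all add: contract_ext_d wedge_linear form_apply)
qed

lemma ext_d_fscale:
  assumes "differentiable_form \<alpha>" "\<And>p. f differentiable (at p)"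
  shows "ext_d (f \<odot> \<alpha>) p vs = (ext_d (zero_form f) \<and>\<^sub>f \<alpha>) p vs + f p * ext_d \<alpha> p vs"
proof -
  have "homogeneous 0 (zero_form f y)" for y by (simp add: homogeneous_def zero_form_def)
  from ext_d_wedge[OF differentiable_form_zero_form[OF assms(2)] assms(1) this] show ?thesis
    by (simp add: wedge_zero_form fscale_apply)
qed

subsection \<open>Alternating multilinear maps\<close>

text \<open>
  A recursive description of alternating multilinear maps that matches induction on the list of
  arguments. Only equal neighbours are required to give zero; multilinearity yields antisymmetry
  under exchange of neighbours and hence the case of arbitrary equal arguments.
\<close>

primrec alternating :: "nat \<Rightarrow> ('a::real_vector list \<Rightarrow> real) \<Rightarrow> bool" where
  "alternating 0 A \<longleftrightarrow> (\<forall>vs. vs \<noteq> [] \<longrightarrow> A vs = 0)"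
| "alternating (Suc k) A \<longleftrightarrow> A [] = 0 \<and> (\<forall>vs. linear (\<lambda>x. A (x # vs))) \<and>
     (\<forall>x. alternating k (\<lambda>vs. A (x # vs))) \<and> (\<forall>x vs. A (x # x # vs) = 0)"

lemma alternating_homogeneous: "alternating k A \<Longrightarrow> homogeneous k A"
proof (induction k arbitrary: A)
  case (Suc k)
  have "A vs = 0" if "length vs \<noteq> Suc k" for vs
    using Suc that by (cases vs) (auto simp: homogeneous_def)
  then show ?case by (simp add: homogeneous_def)
qed (simp add: homogeneous_def)

lemma alternating_linear: "alternating k A \<Longrightarrow> linear (\<lambda>x. A (x # vs))"
  by (cases k) (simp_all add: module_hom_zero)

lemma alternating_contract: "alternating k A \<Longrightarrow> alternating (k - 1) (\<lambda>vs. A (x # vs))"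
  by (cases k) simp_all

lemma alternating_double: "alternating k A \<Longrightarrow> A (x # x # vs) = 0"
  by (cases k) simp_all

lemma alternating_zero: "alternating k (\<lambda>vs. 0)"
  by (induction k) (simp_all add: module_hom_zero)

lemma alternating_add: "alternating k A \<Longrightarrow> alternating k B \<Longrightarrow> alternating k (\<lambda>vs. A vs + B vs)"
  by (induction k arbitrary: A B) (auto intro: linear_compose_add)

lemma alternating_scale: "alternating k A \<Longrightarrow> alternating k (\<lambda>vs. c * A vs)"
proof (induction k arbitrary: A)
  case (Suc k)
  have "linear (\<lambda>x. c * A (x # vs))" for vs
    using linear_compose_scale_right[of "\<lambda>x. A (x # vs)" c] Suc.prems by simp
  then show ?case using Suc by auto
qed simp

lemma alternating_swap:
  assumes "alternating k A" shows "A (x # y # vs) = - A (y # x # vs)"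
proof -
  have "A ((x + y) # z # vs) = A (x # z # vs) + A (y # z # vs)" for z
    using linear_add[OF alternating_linear[OF assms]] .
  moreover have "A (z # (x + y) # vs) = A (z # x # vs) + A (z # y # vs)" for z
    using linear_add[OF alternating_linear[OF alternating_contract[OF assms]]] .
  ultimately have "A ((x + y) # (x + y) # vs) = A (x # x # vs) + A (x # y # vs) + (A (y # x # vs) + A (y # y # vs))"
    by simp
  then show ?thesis using alternating_double[OF assms] by simp
qed

lemma alternating_repeated: "alternating k A \<Longrightarrow> x \<in> set vs \<Longrightarrow> A (x # vs) = 0"
proof (induction vs arbitrary: k A)
  case (Cons y ys)
  show ?case
  proof (cases "x = y")
    case False
    then have "A (y # x # ys) = 0"
      using Cons.IH[OF alternating_contract[OF Cons.prems(1)]] Cons.prems(2) by simp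
    then show ?thesis using alternating_swap[OF Cons.prems(1), of x y ys] by simp
  qed (use alternating_double Cons.prems in auto)
qed simp

lemma alternating_linear_slot:
  "alternating k A \<Longrightarrow> i < length vs \<Longrightarrow> linear (\<lambda>v. A (vs[i := v]))"
proof (induction vs arbitrary: k A i)
  case (Cons x xs)
  then show ?case
    using alternating_linear[OF Cons.prems(1)] Cons.IH[OF alternating_contract[OF Cons.prems(1)]]
    by (cases i) simp_all
qed simp

lemma alternating_equal_slots:
  "alternating k A \<Longrightarrow> i < j \<Longrightarrow> j < length vs \<Longrightarrow> vs ! i = vs ! j \<Longrightarrow> A vs = 0"
proof (induction vs arbitrary: k A i j)
  case (Cons x xs)
  then obtain m where m: "j = Suc m" by (cases j) auto
  show ?case
  proof (cases i)
    case 0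
    then have "x \<in> set xs" using Cons.prems m by auto
    then show ?thesis using alternating_repeated Cons.prems by blast
  next
    case (Suc l)
    then show ?thesis using Cons.IH[OF alternating_contract[OF Cons.prems(1)], of l m] Cons.prems m by auto
  qed
qed simp

lemma form_at_iff_alternating: "form_at k p \<alpha> \<longleftrightarrow> alternating k (\<alpha> p)"
proof
  assume A: "alternating k (\<alpha> p)"
  show "form_at k p \<alpha>"
    unfolding form_at_def
  proof (intro conjI allI impI)
    show "length vs \<noteq> k \<Longrightarrow> \<alpha> p vs = 0" for vs
      using homogeneousD[OF alternating_homogeneous[OF A]] .
    show "length vs = k \<and> i < k \<Longrightarrow> linear (\<lambda>v. \<alpha> p (vs[i := v]))" for vs i
      using alternating_linear_slot[OF A] by blast
    show "length vs = k \<and> i < j \<and> j < k \<and> vs ! i = vs ! j \<Longrightarrow> \<alpha> p vs = 0" for vs i j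
      using alternating_equal_slots[OF A] by blast
  qed
next
  show "form_at k p \<alpha> \<Longrightarrow> alternating k (\<alpha> p)"
  proof (induction k arbitrary: \<alpha>)
    case (Suc k)
    note z = Suc.prems[unfolded form_at_def, THEN conjunct1, rule_format]
      and l = Suc.prems[unfolded form_at_def, THEN conjunct2, THEN conjunct1, rule_format]
      and e = Suc.prems[unfolded form_at_def, THEN conjunct2, THEN conjunct2, rule_format]
    have "linear (\<lambda>x. \<alpha> p (x # vs))" for vs
      using l[of "0 # vs" 0] z by (cases "length vs = k") (simp_all add: module_hom_zero)
    moreover have "\<alpha> p (x # x # vs) = 0" for x vs
      using e[of "x # x # vs" 0 1] z by (cases "Suc (length vs) = k") auto
    moreover have "form_at k p (contract x \<alpha>)" for x
      unfolding form_at_def contract_apply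
    proof (intro conjI allI impI)
      show "length vs \<noteq> k \<Longrightarrow> \<alpha> p (x # vs) = 0" for vs using z by simp
      show "length vs = k \<and> i < k \<Longrightarrow> linear (\<lambda>v. \<alpha> p (x # vs[i := v]))" for vs i
        using l[of "x # vs" "Suc i"] by simp
      show "length vs = k \<and> i < j \<and> j < k \<and> vs ! i = vs ! j \<Longrightarrow> \<alpha> p (x # vs) = 0" for vs i j
        using e[of "x # vs" "Suc i" "Suc j"] by simp
    qed
    then have "alternating k (\<lambda>vs. \<alpha> p (x # vs))" for x
      using Suc.IH[of "contract x \<alpha>"] by (simp add: contract_def)
    ultimately show ?case using z by simp
  qed (simp add: form_at_def)
qed

text \<open>
  For two equal leading arguments the antiderivation property gives the terms
  \<open>contract x \<alpha> \<and>\<^sub>f contract x \<beta>\<close> twice, with opposite signs.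
\<close>

lemma alternating_wedge:
  assumes "alternating j (\<alpha> p)" "alternating k (\<beta> p)"
  shows "alternating (j + k) ((\<alpha> \<and>\<^sub>f \<beta>) p)"
proof -
  have "alternating n ((\<alpha> \<and>\<^sub>f \<beta>) p)" if "alternating j (\<alpha> p)" "alternating k (\<beta> p)" "j + k = n" for n
    using that
  proof (induction n arbitrary: \<alpha> \<beta> j k)
    case 0
    then show ?case
      using homogeneous_wedge[of j \<alpha> p k \<beta>] by (auto simp: alternating_homogeneous homogeneous_def)
  next
    case (Suc n)
    note hom = Suc.prems(1,2)[THEN alternating_homogeneous]
    have C: "(\<alpha> \<and>\<^sub>f \<beta>) p (x # xs) = (contract x \<alpha> \<and>\<^sub>f \<beta>) p xs + (- 1) ^ j * (\<alpha> \<and>\<^sub>f contract x \<beta>) p xs" for x xs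
      using wedge_Cons[of j \<alpha>, OF hom(1)] .
    have "(\<alpha> \<and>\<^sub>f \<beta>) p [] = 0"
      using homogeneous_wedge[of j \<alpha> p k \<beta>, OF hom] Suc.prems(3) by (simp add: homogeneous_def)
    moreover have "linear (\<lambda>x. (\<alpha> \<and>\<^sub>f \<beta>) p (x # vs))" for vs
    proof -
      have "linear (\<lambda>x. c * \<alpha> p (x # us) * d)" "linear (\<lambda>x. c * d * \<beta> p (x # us))" for c d us
        using linear_compose_scale_right[OF alternating_linear[OF Suc.prems(1)], of "c * d"]
          linear_compose_scale_right[OF alternating_linear[OF Suc.prems(2)], of "c * d"]
        by (simp_all add: mult_ac)
      then have l: "linear (\<lambda>x. (contract x \<alpha> \<and>\<^sub>f \<beta>) p vs)" "linear (\<lambda>x. (\<alpha> \<and>\<^sub>f contract x \<beta>) p vs)"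
        by (simp_all add: wedge_def contract_def linear_compose_sum)
      from linear_compose_add[OF l(1) linear_compose_scale_right[OF l(2), of "(- 1) ^ j"]]
      show ?thesis unfolding C by (simp only: real_scaleR_def)
    qed
    moreover have "alternating n (\<lambda>xs. (\<alpha> \<and>\<^sub>f \<beta>) p (x # xs))" for x
    proof -
      have "alternating n ((contract x \<alpha> \<and>\<^sub>f \<beta>) p)"
      proof (cases j)
        case 0
        then have "(contract x \<alpha> \<and>\<^sub>f \<beta>) p = (\<lambda>_. 0)"
          using hom(1) contract_homogeneous_0[of \<alpha> p x] by (auto simp: wedge_zero_left)
        then show ?thesis using alternating_zero by simp
      next
        case (Suc i)
        then show ?thesis
          using Suc.IH[of i "contract x \<alpha>" k \<beta>] Suc.prems by (simp add: contract_def)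
      qed
      moreover have "alternating n ((\<alpha> \<and>\<^sub>f contract x \<beta>) p)"
      proof (cases k)
        case 0
        then have "(\<alpha> \<and>\<^sub>f contract x \<beta>) p = (\<lambda>_. 0)"
          using hom(2) contract_homogeneous_0[of \<beta> p x] by (auto simp: wedge_zero_right)
        then show ?thesis using alternating_zero by simp
      next
        case (Suc i)
        then show ?thesis
          using Suc.IH[of j \<alpha> i "contract x \<beta>"] Suc.prems by (simp add: contract_def)
      qed
      ultimately show ?thesis unfolding C by (intro alternating_add alternating_scale)
    qed
    moreover have "(\<alpha> \<and>\<^sub>f \<beta>) p (x # x # vs) = 0" for x vs
    proof -
      have z: "contract x (contract x \<alpha>) p = 0" "contract x (contract x \<beta>) p = 0"
        using Suc.prems(1,2)[THEN alternating_double] by (auto simp: contract_def)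
      have i: "(- 1) ^ (j - 1) * (contract x \<alpha> \<and>\<^sub>f contract x \<beta>) p vs =
          - ((- 1) ^ j * (contract x \<alpha> \<and>\<^sub>f contract x \<beta>) p vs)"
        using hom(1) contract_homogeneous_0[of \<alpha> p x] by (cases j) (auto simp: wedge_zero_left)
      show ?thesis
        using wedge_Cons[of "j - 1" "contract x \<alpha>" p \<beta> x vs, OF homogeneous_contract[of j \<alpha>, OF hom(1)]]
          wedge_Cons[of j \<alpha> p "contract x \<beta>" x vs, OF hom(1)] i
        by (simp add: C wedge_zero_left[of "contract x (contract x \<alpha>)", OF z(1)]
            wedge_zero_right[of "contract x (contract x \<beta>)", OF z(2)])
    qed
    ultimately show ?case by simp
  qed
  then show ?thesis using assms by blast
qed

subsection \<open>Smooth forms\<close>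

lemma smooth_formI:
  "(\<And>p. p \<in> U \<Longrightarrow> alternating k (\<alpha> p)) \<Longrightarrow> (\<And>vs. smooth_on U (\<lambda>p. \<alpha> p vs)) \<Longrightarrow> smooth_form k U \<alpha>"
  by (simp add: smooth_form_def form_at_iff_alternating)

lemma smooth_form_alternating: "smooth_form k U \<alpha> \<Longrightarrow> p \<in> U \<Longrightarrow> alternating k (\<alpha> p)"
  by (simp add: smooth_form_def form_at_iff_alternating)

lemma smooth_form_homogeneous: "smooth_form k U \<alpha> \<Longrightarrow> p \<in> U \<Longrightarrow> homogeneous k (\<alpha> p)"
  by (simp add: smooth_form_alternating alternating_homogeneous)

lemma smooth_form_coeff: "smooth_form k U \<alpha> \<Longrightarrow> smooth_on U (\<lambda>p. \<alpha> p vs)"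
  by (simp add: smooth_form_def)

lemma smooth_form_differentiable: "smooth_form k UNIV \<alpha> \<Longrightarrow> differentiable_form \<alpha>"
  using smooth_form_coeff smooth_on_differentiable unfolding differentiable_form_def by blast

lemma smooth_form_subset: "smooth_form k U \<alpha> \<Longrightarrow> V \<subseteq> U \<Longrightarrow> smooth_form k V \<alpha>"
  unfolding smooth_form_def using smooth_on_subset by blast

lemma smooth_form_on: "smooth_form k UNIV \<alpha> \<Longrightarrow> smooth_form_on k M \<alpha>"
  unfolding smooth_form_on_def using open_UNIV by blast

lemma smooth_form_wedge:
  assumes "open U" "smooth_form j U \<alpha>" "smooth_form k U \<beta>"
  shows "smooth_form (j + k) U (\<alpha> \<and>\<^sub>f \<beta>)"
proof (rule smooth_formI)
  show "alternating (j + k) ((\<alpha> \<and>\<^sub>f \<beta>) p)" if "p \<in> U" for p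
    using assms(2,3) that by (intro alternating_wedge smooth_form_alternating)
  show "smooth_on U (\<lambda>p. (\<alpha> \<and>\<^sub>f \<beta>) p vs)" for vs
    unfolding wedge_def
    by (intro smooth_on_sum smooth_on_mult smooth_on_const assms(1)
        smooth_form_coeff[OF assms(2)] smooth_form_coeff[OF assms(3)])
qed

lemma smooth_form_fscale:
  "open U \<Longrightarrow> smooth_on U f \<Longrightarrow> smooth_form k U \<alpha> \<Longrightarrow> smooth_form k U (f \<odot> \<alpha>)"
  by (simp add: smooth_form_def form_at_iff_alternating fscale_def alternating_scale smooth_on_mult)

lemma smooth_form_cscale: "open U \<Longrightarrow> smooth_form k U \<alpha> \<Longrightarrow> smooth_form k U (c \<cdot> \<alpha>)"
  by (simp add: cscale_eq_fscale smooth_form_fscale smooth_on_const)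

lemma smooth_form_add:
  "open U \<Longrightarrow> smooth_form k U \<alpha> \<Longrightarrow> smooth_form k U \<beta> \<Longrightarrow> smooth_form k U (\<alpha> + \<beta>)"
  by (simp add: smooth_form_def form_at_iff_alternating plus_fun_def alternating_add smooth_on_add)

lemma smooth_form_diff:
  assumes "open U" "smooth_form k U \<alpha>" "smooth_form k U \<beta>" shows "smooth_form k U (\<alpha> - \<beta>)"
proof -
  have "\<alpha> - \<beta> = \<alpha> + (- 1) \<cdot> \<beta>" by (simp add: fun_eq_iff cscale_def)
  then show ?thesis
    using smooth_form_add[OF assms(1,2) smooth_form_cscale[OF assms(1,3)]] by metis
qed

lemma smooth_form_zero: "smooth_form k U 0"
  by (rule smooth_formI) (simp_all add: zero_fun_def alternating_zero smooth_on_const)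

lemma smooth_form_sum:
  "open U \<Longrightarrow> (\<And>i. i \<in> A \<Longrightarrow> smooth_form k U (\<alpha> i)) \<Longrightarrow> smooth_form k U (\<Sum>i\<in>A. \<alpha> i)"
proof (induction A rule: infinite_finite_induct)
  case (insert i A)
  then show ?case unfolding sum.insert[OF insert(1,2)] by (intro smooth_form_add) auto
qed (simp_all add: smooth_form_zero)

lemmas smooth_form_intros =
  smooth_form_add smooth_form_diff smooth_form_fscale smooth_form_cscale smooth_form_sum

text \<open>A field of linear functionals as a form; its values on lists of other lengths must vanish.\<close>

definition one_form :: "('a \<Rightarrow> 'a \<Rightarrow> real) \<Rightarrow> ('a, real) form" where
  "one_form L = (\<lambda>p vs. if length vs = 1 then L p (hd vs) else 0)"

lemma one_form_single [simp]: "one_form L p [v] = L p v"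
  by (simp add: one_form_def)

lemma homogeneous_one_form: "homogeneous 1 (one_form L p)"
  by (simp add: homogeneous_def one_form_def)

lemma smooth_form_one_form:
  assumes "\<And>p. p \<in> U \<Longrightarrow> linear (L p)" "\<And>v. smooth_on U (\<lambda>p. L p v)"
  shows "smooth_form 1 U (one_form L)"
proof (rule smooth_formI)
  show "alternating 1 (one_form L p)" if "p \<in> U" for p
  proof -
    have "linear (\<lambda>x. one_form L p (x # vs))" for vs
      using assms(1)[OF that] by (cases vs) (simp_all add: one_form_def module_hom_zero)
    then show ?thesis by (simp add: one_form_def)
  qed
  show "smooth_on U (\<lambda>p. one_form L p vs)" for vs
    using assms(2) by (cases "length vs = 1") (simp_all add: one_form_def smooth_on_const)
qed

lemma one_form_eqI: "homogeneous 1 (\<alpha> p) \<Longrightarrow> (\<And>v. \<alpha> p [v] = L p v) \<Longrightarrow> \<alpha> p = one_form L p"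
  by (rule ext) (auto simp: one_form_def homogeneous_def length_Suc_conv)

subsection \<open>Low degrees and restriction to tangent spaces\<close>

lemma wedge_1_1:
  assumes "homogeneous 1 (\<alpha> p)" "homogeneous 1 (\<beta> p)"
  shows "(\<alpha> \<and>\<^sub>f \<beta>) p [u, v] = \<alpha> p [u] * \<beta> p [v] - \<alpha> p [v] * \<beta> p [u]"
proof -
  have h: "homogeneous 0 (contract u \<alpha> p)" using homogeneous_contract[of 1 \<alpha>, OF assms(1)] by simp
  show ?thesis
    using homogeneousD[OF assms(1), of "[]"] homogeneousD[OF assms(2), of "[]"] homogeneousD[OF h, of "[v]"]
      homogeneousD[OF assms(2), of "[u, v]"]
    by (simp add: wedge_Cons[of 1 \<alpha>, OF assms(1)] wedge_Cons[of 0 "contract u \<alpha>", OF h] wedge_Nil contract_apply)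
qed

lemma wedge_1_2:
  assumes "homogeneous 1 (\<alpha> p)" "homogeneous 2 (\<beta> p)"
  shows "(\<alpha> \<and>\<^sub>f \<beta>) p [u, v, w] =
    \<alpha> p [u] * \<beta> p [v, w] - \<alpha> p [v] * \<beta> p [u, w] + \<alpha> p [w] * \<beta> p [u, v]"
proof -
  have h: "homogeneous 1 (contract u \<beta> p)" using homogeneous_contract[of 2 \<beta>, OF assms(2)] by simp
  have h0: "homogeneous 0 (contract u \<alpha> p)" using homogeneous_contract[of 1 \<alpha>, OF assms(1)] by simp
  have z: "(contract w (contract u \<alpha>) \<and>\<^sub>f \<gamma>) p vs = 0" for w \<gamma> vs
    by (rule wedge_zero_left, rule contract_homogeneous_0, rule h0)
  have "(contract u \<alpha> \<and>\<^sub>f \<beta>) p [v, w] = (contract u \<alpha> \<and>\<^sub>f contract v \<beta>) p [w]"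
    using wedge_Cons[of 0 "contract u \<alpha>" p \<beta> v, OF h0] by (simp add: z)
  also have "\<dots> = \<alpha> p [u] * \<beta> p [v, w]"
    using wedge_Cons[of 0 "contract u \<alpha>" p "contract v \<beta>" w, OF h0]
    by (simp add: z wedge_Nil contract_apply)
  finally show ?thesis
    using wedge_Cons[of 1 \<alpha> p \<beta> u "[v, w]", OF assms(1)] wedge_1_1[of \<alpha> p "contract u \<beta>" v w, OF assms(1) h]
    by (simp add: contract_apply)
qed

lemma ext_d_1: "ext_d \<alpha> p [u, v] = coeff_derivative u \<alpha> p [v] - coeff_derivative v \<alpha> p [u]"
  by (simp add: ext_d_Cons ext_d_Nil coeff_derivative_contract contract_apply)

lemma ext_d_2: "ext_d \<alpha> p [u, v, w] =
    coeff_derivative u \<alpha> p [v, w] - coeff_derivative v \<alpha> p [u, w] + coeff_derivative w \<alpha> p [u, v]"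
  by (simp add: ext_d_Cons ext_d_Nil coeff_derivative_contract contract_apply)

lemma eq_atI:
  assumes "homogeneous k (\<alpha> p)" "homogeneous k (\<beta> p)"
    "\<And>vs. length vs = k \<Longrightarrow> set vs \<subseteq> tangent_space M p \<Longrightarrow> \<alpha> p vs = \<beta> p vs"
  shows "eq_at M p \<alpha> \<beta>"
  unfolding eq_at_def
proof (intro allI impI)
  show "set vs \<subseteq> tangent_space M p \<Longrightarrow> \<alpha> p vs = \<beta> p vs" for vs
    using assms(3) homogeneousD[OF assms(1)] homogeneousD[OF assms(2)] by (cases "length vs = k") auto
qed

lemma eq_atD: "eq_at M p \<alpha> \<beta> \<Longrightarrow> set vs \<subseteq> tangent_space M p \<Longrightarrow> \<alpha> p vs = \<beta> p vs"
  by (simp add: eq_at_def)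

lemma eq_at_wedge:
  assumes "eq_at M p \<alpha> \<alpha>'" "eq_at M p \<beta> \<beta>'" shows "eq_at M p (\<alpha> \<and>\<^sub>f \<beta>) (\<alpha>' \<and>\<^sub>f \<beta>')"
proof -
  have "set (nths vs S) \<subseteq> tangent_space M p" if "set vs \<subseteq> tangent_space M p" for vs S
    using that set_nths_subset by fastforce
  then show ?thesis using assms by (simp add: eq_at_def wedge_def)
qed

lemma eq_at_refl: "eq_at M p \<alpha> \<alpha>"
  by (simp add: eq_at_def)

section \<open>Products with an interval\<close>

subsection \<open>Tangent spaces and submanifolds\<close>

lemma tangent_space_Times:
  "tangent_space (M \<times> N) (p, q) = tangent_space M p \<times> tangent_space N q"
proof (intro equalityI subsetI)
  fix v assume "v \<in> tangent_space (M \<times> N) (p, q)"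
  then obtain \<gamma> where \<gamma>: "\<gamma> 0 = (p, q)" "\<forall>\<^sub>F s in at 0. \<gamma> s \<in> M \<times> N" "(\<gamma> has_vector_derivative v) (at 0)"
    unfolding tangent_space_def by blast
  have "((\<lambda>s. fst (\<gamma> s)) has_vector_derivative fst v) (at 0)"
    "((\<lambda>s. snd (\<gamma> s)) has_vector_derivative snd v) (at 0)"
    using has_derivative_fst[OF \<gamma>(3)[unfolded has_vector_derivative_def]]
      has_derivative_snd[OF \<gamma>(3)[unfolded has_vector_derivative_def]]
    by (simp_all add: has_vector_derivative_def)
  moreover have "\<forall>\<^sub>F s in at 0. fst (\<gamma> s) \<in> M" "\<forall>\<^sub>F s in at 0. snd (\<gamma> s) \<in> N"
    using \<gamma>(2) by (auto elim!: eventually_mono simp: mem_Times_iff)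
  ultimately show "v \<in> tangent_space M p \<times> tangent_space N q"
    using \<gamma>(1) unfolding tangent_space_def mem_Times_iff mem_Collect_eq
    by (intro conjI exI[of _ "\<lambda>s. fst (\<gamma> s)"] exI[of _ "\<lambda>s. snd (\<gamma> s)"]) simp_all
next
  fix v assume "v \<in> tangent_space M p \<times> tangent_space N q"
  then obtain \<gamma> \<delta> where \<gamma>: "\<gamma> 0 = p" "\<forall>\<^sub>F s in at 0. \<gamma> s \<in> M" "(\<gamma> has_vector_derivative fst v) (at 0)"
    and \<delta>: "\<delta> 0 = q" "\<forall>\<^sub>F s in at 0. \<delta> s \<in> N" "(\<delta> has_vector_derivative snd v) (at 0)"
    unfolding tangent_space_def by (auto simp: mem_Times_iff)
  have "((\<lambda>s. (\<gamma> s, \<delta> s)) has_vector_derivative v) (at 0)"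
    using has_vector_derivative_Pair[OF \<gamma>(3) \<delta>(3)] by simp
  moreover have "\<forall>\<^sub>F s in at 0. (\<gamma> s, \<delta> s) \<in> M \<times> N"
    using \<gamma>(2) \<delta>(2) by eventually_elim simp
  ultimately show "v \<in> tangent_space (M \<times> N) (p, q)"
    unfolding tangent_space_def mem_Collect_eq using \<gamma>(1) \<delta>(1)
    by (intro exI[of _ "\<lambda>s. (\<gamma> s, \<delta> s)"]) simp
qed

lemma tangent_space_open:
  assumes "open N" "q \<in> N" shows "tangent_space N q = UNIV"
proof -
  have "v \<in> tangent_space N q" for v
  proof -
    have d: "((\<lambda>s. q + s *\<^sub>R v) has_vector_derivative v) (at 0)"
      by (auto intro!: derivative_eq_intros)
    have "((\<lambda>s. q + s *\<^sub>R v) \<longlongrightarrow> q + 0 *\<^sub>R v) (at 0)"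
      by (intro tendsto_intros)
    then have "\<forall>\<^sub>F s in at 0. q + s *\<^sub>R v \<in> N"
      using topological_tendstoD[OF _ assms(1)] assms(2) by simp
    with d show ?thesis
      unfolding tangent_space_def mem_Collect_eq by (intro exI[of _ "\<lambda>s. q + s *\<^sub>R v"]) simp
  qed
  then show ?thesis by blast
qed

lemma tangent_space_Times_open:
  "open N \<Longrightarrow> q \<in> N \<Longrightarrow> tangent_space (M \<times> N) (p, q) = tangent_space M p \<times> UNIV"
  by (simp add: tangent_space_Times tangent_space_open)

lemma frechet_derivative_fst_comp:
  "f differentiable (at (fst p)) \<Longrightarrow>
    ((\<lambda>y. f (fst y)) has_derivative (\<lambda>v. frechet_derivative f (at (fst p)) (fst v))) (at p)"
  using has_derivative_compose[OF has_derivative_fst[OF has_derivative_ident]]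
  by (simp add: frechet_derivative_works)

text \<open>
  The defining functions of \<open>M\<close>, composed with the projection, define \<open>M \<times> I\<close>.
\<close>

lemma submanifold_Times_open:
  fixes I :: "real set"
  assumes "submanifold n M" "open I"
  shows "submanifold (Suc n) (M \<times> I)"
  unfolding submanifold_def
proof (intro conjI ballI, goal_cases)
  case (2 p)
  then have "fst p \<in> M" by auto
  from assms(1)[unfolded submanifold_def, THEN conjunct2, rule_format, OF this]
  obtain U f where f: "open U" "fst p \<in> U" "\<forall>i<DIM('a) - n. smooth_on U (f i)"
      "M \<inter> U = {x \<in> U. \<forall>i<DIM('a) - n. f i x = 0}"
    and ind: "\<forall>x\<in>M \<inter> U. \<forall>c.
        (\<forall>v. (\<Sum>i<DIM('a) - n. c i * frechet_derivative (f i) (at x) v) = 0) \<longrightarrow>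
        (\<forall>i<DIM('a) - n. c i = 0)"
    by (elim exE conjE)
  have d: "frechet_derivative (\<lambda>y. f i (fst y)) (at x) v = frechet_derivative (f i) (at (fst x)) (fst v)"
    if "i < DIM('a) - n" "fst x \<in> U" for i and x v :: "'a \<times> real"
    using frechet_derivative_apply[OF frechet_derivative_fst_comp]
      smooth_on_has_derivative[OF f(3)[rule_format, OF that(1)] f(1) that(2)] differentiableI by blast
  have dim: "DIM('a \<times> real) - Suc n = DIM('a) - n" by simp
  show ?case
    unfolding dim
  proof (intro exI[of _ "U \<times> I"] exI[of _ "\<lambda>i x. f i (fst x)"] conjI)
    show "open (U \<times> I)" "p \<in> U \<times> I"
      using f(1,2) assms(2) \<open>p \<in> M \<times> I\<close> by (auto intro: open_Times simp: mem_Times_iff)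
    show "\<forall>i<DIM('a) - n. smooth_on (U \<times> I) (\<lambda>x. f i (fst x))"
      using smooth_on_fst[OF f(1) assms(2)] f(3) by simp
    show "(M \<times> I) \<inter> (U \<times> I) = {x \<in> U \<times> I. \<forall>i<DIM('a) - n. f i (fst x) = 0}"
      using f(4) by (auto simp: set_eq_iff)
    show "\<forall>x\<in>(M \<times> I) \<inter> (U \<times> I). \<forall>c.
        (\<forall>v. (\<Sum>i<DIM('a) - n. c i * frechet_derivative (\<lambda>x. f i (fst x)) (at x) v) = 0) \<longrightarrow>
        (\<forall>i<DIM('a) - n. c i = 0)"
    proof (intro ballI allI impI)
      fix x c i
      assume x: "x \<in> (M \<times> I) \<inter> (U \<times> I)" and i: "i < DIM('a) - n"
        and z: "\<forall>v. (\<Sum>i<DIM('a) - n. c i * frechet_derivative (\<lambda>x. f i (fst x)) (at x) v) = 0"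
      have "(\<Sum>i<DIM('a) - n. c i * frechet_derivative (f i) (at (fst x)) v) = 0" for v
        using z[rule_format, of "(v, 0)"] x d[of _ x "(v, 0)"] by (simp add: mem_Times_iff)
      then show "c i = 0" using ind[rule_format, of "fst x" c] x i by (simp add: mem_Times_iff)
    qed
  qed
qed (use assms(1) in \<open>simp add: submanifold_def\<close>)

subsection \<open>Pullback along the projection and the form of the interval\<close>

lemma pullback_fst: "pullback fst \<alpha> p vs = \<alpha> (fst p) (map fst vs)"
proof -
  have "frechet_derivative fst (at p) = fst"
    using frechet_derivative_at[OF has_derivative_fst[OF has_derivative_ident]] by metis
  then show ?thesis by (simp add: pullback_def)
qed

lemma pullback_add: "pullback f (\<alpha> + \<beta>) = pullback f \<alpha> + pullback f \<beta>"
  and pullback_cscale: "pullback f (c \<cdot> \<alpha>) = c \<cdot> pullback f \<alpha>"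
  and pullback_zero: "pullback f 0 = 0"
  by (simp_all add: fun_eq_iff pullback_def cscale_def)

lemma pullback_wedge: "pullback f (\<alpha> \<and>\<^sub>f \<beta>) = (pullback f \<alpha> \<and>\<^sub>f pullback f \<beta>)"
  by (simp add: fun_eq_iff pullback_def wedge_def nths_map)

lemma alternating_pullback_fst:
  fixes p :: "'a::euclidean_space \<times> 'b::euclidean_space"
  shows "alternating k (\<alpha> (fst p)) \<Longrightarrow> alternating k (pullback fst \<alpha> p)"
proof -
  have "alternating k A \<Longrightarrow> alternating k (\<lambda>vs :: ('a \<times> 'b) list. A (map fst vs))" for A :: "'a list \<Rightarrow> real"
  proof (induction k arbitrary: A)
    case (Suc k)
    have "linear (\<lambda>x :: 'a \<times> 'b. A (fst x # us))" for us
      using linear_compose[OF linear_fst alternating_linear[OF Suc.prems], of us] by (simp add: o_def)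
    moreover have "alternating k (\<lambda>vs :: ('a \<times> 'b) list. A (fst x # map fst vs))" for x :: "'a \<times> 'b"
      using Suc.IH[of "\<lambda>vs. A (fst x # vs)"] Suc.prems by simp
    ultimately show ?case using Suc.prems by simp
  qed simp
  then show "alternating k (\<alpha> (fst p)) \<Longrightarrow> alternating k (pullback fst \<alpha> p)"
    by (simp add: pullback_fst[abs_def])
qed

lemma homogeneous_pullback: "homogeneous k (\<alpha> (f p)) \<Longrightarrow> homogeneous k (pullback f \<alpha> p)"
  by (simp add: homogeneous_def pullback_def)

lemma smooth_form_pullback_fst:
  fixes \<alpha> :: "('a::euclidean_space, real) form" and V :: "'b::euclidean_space set"
  assumes "open U" "open V" "smooth_form k U \<alpha>"
  shows "smooth_form k (U \<times> V) (pullback fst \<alpha>)"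
proof (rule smooth_formI)
  show "alternating k (pullback fst \<alpha> p)" if "p \<in> U \<times> V" for p
    by (rule alternating_pullback_fst, rule smooth_form_alternating[OF assms(3)]) (use that in auto)
  show "smooth_on (U \<times> V) (\<lambda>p. pullback fst \<alpha> p vs)" for vs
    using smooth_on_fst[OF assms(1,2) smooth_form_coeff[OF assms(3)]] by (simp add: pullback_fst)
qed

lemma smooth_form_pullback_fst_UNIV: "smooth_form k UNIV \<alpha> \<Longrightarrow> smooth_form k UNIV (pullback fst \<alpha>)"
  using smooth_form_pullback_fst[of UNIV UNIV k \<alpha>] by simp

lemma ext_d_pullback_fst:
  assumes "differentiable_form \<alpha>" shows "ext_d (pullback fst \<alpha>) = pullback fst (ext_d \<alpha>)"
proof -
  have "frechet_derivative (\<lambda>y. \<alpha> (fst y) vs) (at p) v = frechet_derivative (\<lambda>y. \<alpha> y vs) (at (fst p)) (fst v)"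
    for vs and p v :: "'a \<times> 'b"
    using frechet_derivative_apply[OF frechet_derivative_fst_comp] assms
    unfolding differentiable_form_def by blast
  then show ?thesis
    by (auto simp: fun_eq_iff ext_d_def pullback_fst take_map drop_map intro!: sum.cong)
qed

lemma ext_d_zero_form: "ext_d (zero_form f) p = one_form (\<lambda>p. frechet_derivative f (at p)) p"
proof (rule one_form_eqI)
  show "homogeneous 1 (ext_d (zero_form f) p)"
    using homogeneous_ext_d[of 0 "zero_form f"] by (simp add: homogeneous_def zero_form_def)
qed (simp add: ext_d_def zero_form_def)

lemma ext_d_zero_form_linear:
  assumes "bounded_linear f" shows "ext_d (zero_form f) = one_form (\<lambda>p. f)"
proof -
  have "frechet_derivative f (at p) = f" for p
    using frechet_derivative_at[OF bounded_linear_imp_has_derivative[OF assms]] by metis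
  then show ?thesis
    by (intro ext) (simp add: ext_d_zero_form one_form_def)
qed

lemma d_last_eq: "d_last = one_form (\<lambda>p. snd)"
  unfolding d_last_def by (rule ext_d_zero_form_linear) (rule bounded_linear_snd)

lemma smooth_form_d_last: "smooth_form 1 UNIV d_last"
  unfolding d_last_eq
  by (rule smooth_form_one_form) (simp_all add: smooth_on_const bounded_linear.linear bounded_linear_snd)

lemma ext_d_d_last: "ext_d d_last = 0"
  by (simp add: fun_eq_iff ext_d_def d_last_eq one_form_def)

lemma ext_d_fscale_snd:
  fixes \<alpha> :: "('a::euclidean_space \<times> real, real) form"
  assumes "\<And>t. (f has_real_derivative f' t) (at t)" "differentiable_form \<alpha>"
  shows "ext_d ((\<lambda>p. f (snd p)) \<odot> \<alpha>) p vs =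
    f' (snd p) * (d_last \<and>\<^sub>f \<alpha>) p vs + f (snd p) * ext_d \<alpha> p vs"
proof -
  have D: "((\<lambda>p. f (snd p)) has_derivative (\<lambda>v. f' (snd p) * snd v)) (at p)" for p :: "'a \<times> real"
    using has_derivative_compose[OF has_derivative_snd[OF has_derivative_ident]
        assms(1)[unfolded has_field_derivative_def], of p UNIV] by simp
  have D': "frechet_derivative (\<lambda>p. f (snd p)) (at p) v = f' (snd p) * snd v" for p v :: "'a \<times> real"
    by (rule frechet_derivative_apply[OF D])
  have "ext_d (zero_form (\<lambda>p :: 'a \<times> real. f (snd p))) = (\<lambda>p. f' (snd p)) \<odot> d_last"
    by (intro ext) (simp add: ext_d_zero_form d_last_eq one_form_def fscale_apply D')
  moreover have "(\<lambda>p::'a \<times> real. f (snd p)) differentiable (at p)" for p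
    using D differentiableI by blast
  ultimately show ?thesis
    using ext_d_fscale[OF assms(2)] by (simp add: wedge_fscale_left fscale_apply)
qed

subsection \<open>Lifting coframes\<close>

lemma eq_at_pullback_fst:
  fixes M :: "'a::euclidean_space set" and N :: "'b::euclidean_space set"
  assumes "open N" "t \<in> N" "eq_at M x \<alpha> \<beta>"
  shows "eq_at (M \<times> N) (x, t) (pullback fst \<alpha>) (pullback fst \<beta>)"
  unfolding eq_at_def tangent_space_Times_open[OF assms(1,2)] pullback_fst
proof (intro allI impI)
  fix vs :: "('a \<times> 'b) list" assume "set vs \<subseteq> tangent_space M x \<times> UNIV"
  then have "set (map fst vs) \<subseteq> tangent_space M x" by auto
  then show "\<alpha> (fst (x, t)) (map fst vs) = \<beta> (fst (x, t)) (map fst vs)"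
    using assms(3) by (simp add: eq_at_def)
qed

text \<open>
  The coframe of a sine cone over a coframe \<open>e\<close>: all elements are scaled by \<open>sin t\<close>, the form of the
  interval is appended, and \<open>e i\<close>, \<open>e k\<close> are rotated in their plane by the angle \<open>\<pi>/2 - t\<close>. The choice
  \<open>(i, k) = (2, 4)\<close> takes coframes adapted to SU(2)-structures to SU(3), and \<open>(5, 6)\<close> takes SU(3) to G2.
\<close>

definition cone_coframe ::
    "nat \<Rightarrow> nat \<Rightarrow> nat \<Rightarrow> (nat \<Rightarrow> ('a::euclidean_space, real) form) \<Rightarrow> nat \<Rightarrow> ('a \<times> real, real) form" where
  "cone_coframe n i k e = (\<lambda>j. if j = Suc n then d_last else (\<lambda>p. sin (snd p)) \<odot>
     (if j = i then (\<lambda>p. sin (snd p)) \<odot> pullback fst (e i) + (\<lambda>p. cos (snd p)) \<odot> pullback fst (e k)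
      else if j = k then (\<lambda>p. sin (snd p)) \<odot> pullback fst (e k) - (\<lambda>p. cos (snd p)) \<odot> pullback fst (e i)
      else pullback fst (e j)))"

lemma smooth_form_cone_coframe:
  assumes "open U" "\<And>j. j \<in> {1..n} \<Longrightarrow> smooth_form 1 U (e j)" "i \<in> {1..n}" "k \<in> {1..n}" "j \<in> {1..Suc n}"
  shows "smooth_form 1 (U \<times> UNIV) (cone_coframe n i k e j)"
proof -
  have o: "open (U \<times> (UNIV :: real set))" using assms(1) by (simp add: open_Times)
  have "smooth_form 1 (U \<times> UNIV) (pullback fst (e l))" if "l \<in> {1..n}" for l
    using assms(1,2) that by (intro smooth_form_pullback_fst) auto
  moreover have "smooth_form 1 (U \<times> UNIV) d_last"
    using smooth_form_subset[OF smooth_form_d_last] by blast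
  ultimately show ?thesis
    using assms(3-5) unfolding cone_coframe_def
    by (auto intro!: smooth_form_intros o smooth_on_sin_snd smooth_on_cos_snd)
qed

lemma sum_split_two:
  fixes h :: "nat \<Rightarrow> real"
  assumes "i \<in> {1..n}" "k \<in> {1..n}" "i \<noteq> k"
  shows "(\<Sum>j=1..n. h j) = h i + h k + (\<Sum>j\<in>{1..n} - {i, k}. h j)"
    and "(\<Sum>j=1..Suc n. h j) = h (Suc n) + (h i + h k + (\<Sum>j\<in>{1..n} - {i, k}. h j))"
proof -
  have "{1..n} = insert i (insert k ({1..n} - {i, k}))" using assms by auto
  then show "(\<Sum>j=1..n. h j) = h i + h k + (\<Sum>j\<in>{1..n} - {i, k}. h j)"
    by (metis (no_types, lifting) Diff_iff add.assoc assms(3) finite_Diff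
        finite_atLeastAtMost finite_insert insert_iff sum.insert)
  then show "(\<Sum>j=1..Suc n. h j) = h (Suc n) + (h i + h k + (\<Sum>j\<in>{1..n} - {i, k}. h j))"
    by simp
qed

lemma cone_coframe_value:
  "cone_coframe n i k e j (x, t) [(u, \<tau>)] =
    (if j = Suc n then \<tau> else sin t *
      (if j = i then sin t * e i x [u] + cos t * e k x [u]
       else if j = k then sin t * e k x [u] - cos t * e i x [u]
       else e j x [u]))"
  by (simp add: cone_coframe_def d_last_eq fscale_apply pullback_fst)

text \<open>
  A linear relation on the product splits into its part along the interval and a relation between the
  \<open>e j\<close> with rotated coefficients; the rotation is invertible and \<open>sin t\<close> does not vanish.
\<close>

lemma coframe_at_cone:
  assumes "open U" "x \<in> U" "\<And>j. j \<in> {1..n} \<Longrightarrow> smooth_form 1 U (e j)" "i \<in> {1..n}" "k \<in> {1..n}" "i \<noteq> k"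
    and "coframe_at n M e x" "subspace (tangent_space M x)" "t \<in> {0<..<pi}"
  shows "coframe_at (Suc n) (M \<times> {0<..<pi}) (cone_coframe n i k e) (x, t)"
  unfolding coframe_at_def
proof (intro conjI ballI allI impI)
  have T: "tangent_space (M \<times> {0<..<pi}) (x, t) = tangent_space M x \<times> UNIV"
    using assms(9) by (simp add: tangent_space_Times_open)
  show "form_at 1 (x, t) (cone_coframe n i k e j)" if "j \<in> {1..Suc n}" for j
    using smooth_form_cone_coframe[OF assms(1,3,4,5) that] assms(2) by (simp add: smooth_form_def)
  show "dim (tangent_space (M \<times> {0<..<pi}) (x, t)) = Suc n"
    using assms(7,8) by (simp add: T dim_Times coframe_at_def)
  fix c j
  assume z: "\<forall>v\<in>tangent_space (M \<times> {0<..<pi}) (x, t). (\<Sum>j=1..Suc n. c j * cone_coframe n i k e j (x, t) [v]) = 0"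
    and j: "j \<in> {1..Suc n}"
  let ?c = "\<lambda>j. if j = i then c i * sin t - c k * cos t else if j = k then c i * cos t + c k * sin t else c j"
  have s: "sin t > 0" using assms(9) by (simp add: sin_gt_zero)
  have sum: "(\<Sum>j=1..Suc n. c j * cone_coframe n i k e j (x, t) [(u, \<tau>)]) =
      c (Suc n) * \<tau> + sin t * (\<Sum>j=1..n. ?c j * e j x [u])" for u \<tau>
    using assms(4-6) unfolding cone_coframe_value sum_split_two[OF assms(4-6)]
    by (simp add: algebra_simps sum_distrib_left)
  have cn: "c (Suc n) = 0"
  proof -
    have "(0, 1) \<in> tangent_space (M \<times> {0<..<pi}) (x, t)" using assms(8) by (simp add: T subspace_0)
    moreover have "e j x [0] = 0" if "j \<in> {1..n}" for j
      using linear_0[OF alternating_linear[OF smooth_form_alternating[OF assms(3)[OF that] assms(2)]]] .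
    ultimately show ?thesis using z[rule_format, of "(0, 1)"] unfolding sum by simp
  qed
  have "(\<Sum>j=1..n. ?c j * e j x [u]) = 0" if "u \<in> tangent_space M x" for u
    using z[rule_format, of "(u, 0)"] that s unfolding sum by (simp add: T)
  then have c: "?c j = 0" if "j \<in> {1..n}" for j
    using assms(7)[unfolded coframe_at_def, THEN conjunct2, THEN conjunct2, rule_format, of ?c j] that by blast
  have "c i * sin t - c k * cos t = 0" "c i * cos t + c k * sin t = 0"
    using c[OF assms(4)] c[OF assms(5)] assms(6) by simp_all
  then have "c i = 0" "c k = 0" using sin_cos_squared_add[of t] by algebra+
  then show "c j = 0" using c[of j] cn j by (cases "j = Suc n") (auto split: if_splits)
qed

text \<open>The rotation does not change the sum of squares.\<close>

lemma orthonormal_at_cone: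
  assumes "i \<in> {1..n}" "k \<in> {1..n}" "i \<noteq> k" "orthonormal_at n M g e x" "t \<in> {0<..<pi}"
  shows "orthonormal_at (Suc n) (M \<times> {0<..<pi}) (sine_cone g) (cone_coframe n i k e) (x, t)"
proof -
  have T: "tangent_space (M \<times> {0<..<pi}) (x, t) = tangent_space M x \<times> UNIV"
    using assms(5) by (simp add: tangent_space_Times_open)
  have "(\<Sum>j=1..Suc n. cone_coframe n i k e j (x, t) [(u, \<sigma>)] * cone_coframe n i k e j (x, t) [(v, \<tau>)]) =
      \<sigma> * \<tau> + (sin t)\<^sup>2 * (\<Sum>j=1..n. e j x [u] * e j x [v])" for u v \<sigma> \<tau>
  proof -
    let ?R = "\<Sum>j\<in>{1..n} - {i, k}. e j x [u] * e j x [v]"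
    have rot: "(sin t * a + cos t * b) * (sin t * a' + cos t * b') +
        (sin t * b - cos t * a) * (sin t * b' - cos t * a') = a * a' + b * b'" for a b a' b'
      using sin_cos_squared_add[of t] by algebra
    have "(\<Sum>j=1..Suc n. cone_coframe n i k e j (x, t) [(u, \<sigma>)] * cone_coframe n i k e j (x, t) [(v, \<tau>)]) =
        \<sigma> * \<tau> + (sin t)\<^sup>2 * ((sin t * e i x [u] + cos t * e k x [u]) * (sin t * e i x [v] + cos t * e k x [v]) +
        (sin t * e k x [u] - cos t * e i x [u]) * (sin t * e k x [v] - cos t * e i x [v]) + ?R)"
      using assms(1-3) unfolding cone_coframe_value sum_split_two[OF assms(1-3)]
      by (simp add: algebra_simps sum_distrib_left power2_eq_square)
    then show ?thesis unfolding rot sum_split_two[OF assms(1-3)] by simp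
  qed
  then show ?thesis using assms(4) by (auto simp: orthonormal_at_def T sine_cone_def)
qed

lemma locally_coframe_cone:
  assumes "locally_coframe n M Q" "\<And>p. p \<in> M \<Longrightarrow> subspace (tangent_space M p)"
    and "i \<in> {1..n}" "k \<in> {1..n}" "i \<noteq> k"
    and Q: "\<And>e x t. x \<in> M \<Longrightarrow> t \<in> {0<..<pi} \<Longrightarrow> \<forall>j\<in>{1..n}. homogeneous 1 (e j x) \<Longrightarrow> Q e x \<Longrightarrow>
      Q' (cone_coframe n i k e) (x, t)"
  shows "locally_coframe (Suc n) (M \<times> {0<..<pi}) Q'"
  unfolding locally_coframe_def
proof
  fix p assume "p \<in> M \<times> {0<..<pi}"
  then obtain U e where U: "open U" "fst p \<in> U" "\<And>j. j \<in> {1..n} \<Longrightarrow> smooth_form 1 U (e j)"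
      and e: "\<And>x. x \<in> M \<inter> U \<Longrightarrow> coframe_at n M e x \<and> Q e x"
    using assms(1) unfolding locally_coframe_def by (metis mem_Times_iff)
  show "\<exists>V f. open V \<and> p \<in> V \<and> (\<forall>j\<in>{1..Suc n}. smooth_form 1 V (f j)) \<and>
      (\<forall>y\<in>(M \<times> {0<..<pi}) \<inter> V. coframe_at (Suc n) (M \<times> {0<..<pi}) f y \<and> Q' f y)"
  proof (intro exI[of _ "U \<times> UNIV"] exI[of _ "cone_coframe n i k e"] conjI ballI)
    fix y assume "y \<in> (M \<times> {0<..<pi}) \<inter> (U \<times> UNIV)"
    then obtain x t where y: "y = (x, t)" "x \<in> M" "x \<in> U" "t \<in> {0<..<pi}" by auto
    show "coframe_at (Suc n) (M \<times> {0<..<pi}) (cone_coframe n i k e) y"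
      unfolding y(1) using e[of x] y assms(2-5) U by (intro coframe_at_cone[of U]) auto
    show "Q' (cone_coframe n i k e) y"
      unfolding y(1)
    proof (rule Q[OF y(2,4)])
      show "\<forall>j\<in>{1..n}. homogeneous 1 (e j x)"
        using smooth_form_homogeneous[OF U(3) y(3)] by blast
    qed (use e[of x] y in blast)
  next
    show "smooth_form 1 (U \<times> UNIV) (cone_coframe n i k e j)" if "j \<in> {1..Suc n}" for j
      using smooth_form_cone_coframe[of U n e, OF U(1,3) assms(3,4) that] .
  qed (use U in \<open>auto simp: open_Times mem_Times_iff\<close>)
qed

section \<open>Adapted coframes on sine cones\<close>

definition real_Psi :: "(nat \<Rightarrow> ('a, real) form) \<Rightarrow> ('a, real) form" where
  "real_Psi e = (e 1 \<and>\<^sub>f (e 3 \<and>\<^sub>f e 5 - e 4 \<and>\<^sub>f e 6)) - (e 2 \<and>\<^sub>f (e 3 \<and>\<^sub>f e 6 + e 4 \<and>\<^sub>f e 5))"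

definition imag_Psi :: "(nat \<Rightarrow> ('a, real) form) \<Rightarrow> ('a, real) form" where
  "imag_Psi e = (e 1 \<and>\<^sub>f (e 3 \<and>\<^sub>f e 6 + e 4 \<and>\<^sub>f e 5)) + (e 2 \<and>\<^sub>f (e 3 \<and>\<^sub>f e 5 - e 4 \<and>\<^sub>f e 6))"

lemma complex_form_wedge:
  "(complex_form \<alpha> \<beta> \<and>\<^sub>f complex_form \<gamma> \<delta>) =
    complex_form (\<alpha> \<and>\<^sub>f \<gamma> - \<beta> \<and>\<^sub>f \<delta>) (\<alpha> \<and>\<^sub>f \<delta> + \<beta> \<and>\<^sub>f \<gamma>)"
proof -
  have s: "(shuffle_sign n S :: complex) = of_real (shuffle_sign n S)" for n S
    by (simp add: shuffle_sign_def)
  show ?thesis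
    by (simp add: fun_eq_iff complex_eq_iff complex_form_def wedge_def s Re_sum Im_sum
        sum.distrib sum_subtractf algebra_simps)
qed

lemma std_Psi_eq: "std_Psi e = complex_form (real_Psi e) (imag_Psi e)"
  by (simp add: std_Psi_def complex_form_wedge real_Psi_def imag_Psi_def)

lemma eq_at_complex_form:
  "eq_at M p (complex_form \<alpha> \<beta>) (complex_form \<gamma> \<delta>) \<longleftrightarrow> eq_at M p \<alpha> \<gamma> \<and> eq_at M p \<beta> \<delta>"
  by (auto simp: eq_at_def complex_form_def)

lemma eq_at_add: "eq_at M p \<alpha> \<alpha>' \<Longrightarrow> eq_at M p \<beta> \<beta>' \<Longrightarrow> eq_at M p (\<alpha> + \<beta>) (\<alpha>' + \<beta>')"
  and eq_at_diff: "eq_at M p \<alpha> \<alpha>' \<Longrightarrow> eq_at M p \<beta> \<beta>' \<Longrightarrow> eq_at M p (\<alpha> - \<beta>) (\<alpha>' - \<beta>')"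
  for \<alpha> \<beta> :: "('a::euclidean_space, real) form"
  by (simp_all add: eq_at_def)

lemma eq_at_fscale: "eq_at M p \<alpha> \<alpha>' \<Longrightarrow> eq_at M p (f \<odot> \<alpha>) (f \<odot> \<alpha>')"
  and eq_at_cscale: "eq_at M p \<alpha> \<alpha>' \<Longrightarrow> eq_at M p (c \<cdot> \<alpha>) (c \<cdot> \<alpha>')"
  by (simp_all add: eq_at_def fscale_def cscale_def)

lemma eq_at_trans: "eq_at M p \<alpha> \<beta> \<Longrightarrow> eq_at M p \<beta> \<gamma> \<Longrightarrow> eq_at M p \<alpha> \<gamma>"
  and eq_at_sym: "eq_at M p \<alpha> \<beta> \<Longrightarrow> eq_at M p \<beta> \<alpha>"
  by (simp_all add: eq_at_def)

lemmas eq_at_intros = eq_at_add eq_at_diff eq_at_fscale eq_at_cscale eq_at_wedge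

lemma wedge_one_forms_swap:
  fixes \<alpha> \<beta> :: "('a, real) form"
  assumes "homogeneous 1 (\<alpha> p)" "homogeneous 1 (\<beta> p)"
  shows "(\<alpha> \<and>\<^sub>f \<beta>) p vs = - (\<beta> \<and>\<^sub>f \<alpha>) p vs"
  using wedge_commute[of 1 \<alpha> p 1 \<beta>, OF assms] by simp

lemma wedge_one_form_self:
  fixes \<alpha> :: "('a, real) form"
  assumes "homogeneous 1 (\<alpha> p)" shows "(\<alpha> \<and>\<^sub>f \<alpha>) p vs = 0"
  using wedge_one_forms_swap[of \<alpha> p \<alpha> vs, OF assms assms] by simp

lemma wedge_one_forms_left_swap:
  fixes \<gamma> :: "('a, real) form"
  assumes "homogeneous 1 (\<alpha> p)" "homogeneous 1 (\<beta> p)"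
  shows "(\<alpha> \<and>\<^sub>f \<beta> \<and>\<^sub>f \<gamma>) p vs = - (\<beta> \<and>\<^sub>f \<alpha> \<and>\<^sub>f \<gamma>) p vs"
proof -
  have "(\<alpha> \<and>\<^sub>f \<beta>) p = ((- 1) \<cdot> (\<beta> \<and>\<^sub>f \<alpha>)) p"
    using wedge_one_forms_swap[of \<alpha> p \<beta>, OF assms] by (simp add: fun_eq_iff cscale_apply)
  then have "((\<alpha> \<and>\<^sub>f \<beta>) \<and>\<^sub>f \<gamma>) p = (((- 1) \<cdot> (\<beta> \<and>\<^sub>f \<alpha>)) \<and>\<^sub>f \<gamma>) p"
    by (rule wedge_cong) simp
  then show ?thesis
    using wedge_assoc[of 1 \<alpha> p 1 \<beta> \<gamma> vs, OF assms] wedge_assoc[of 1 \<beta> p 1 \<alpha> \<gamma> vs, OF assms(2,1)]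
    by (simp add: wedge_linear form_apply)
qed

lemma wedge_one_form_self_left:
  fixes \<gamma> :: "('a, real) form"
  assumes "homogeneous 1 (\<alpha> p)" shows "(\<alpha> \<and>\<^sub>f \<alpha> \<and>\<^sub>f \<gamma>) p vs = 0"
  using wedge_one_forms_left_swap[of \<alpha> p \<alpha> \<gamma> vs, OF assms assms] by simp

lemma wedge_cong_left: "(\<And>vs. \<beta> p vs = c * \<beta>' p vs) \<Longrightarrow> (\<alpha> \<and>\<^sub>f \<beta>) p vs = c * (\<alpha> \<and>\<^sub>f \<beta>') p vs"
  for \<alpha> \<beta> \<beta>' :: "('a, real) form"
  by (simp add: wedge_def sum_distrib_left mult_ac)

text \<open>
  These rules sort products of at most four elements of a coframe into increasing order, a normal form
  which decides the identities between forms at a point that follow.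
\<close>

lemma coframe_wedge_sort:
  fixes e :: "nat \<Rightarrow> ('a, real) form"
  assumes h: "\<forall>j\<in>{1..n}. homogeneous 1 (e j p)"
  shows "1 \<le> a \<Longrightarrow> a < b \<Longrightarrow> b \<le> n \<Longrightarrow> (e b \<and>\<^sub>f e a) p vs = - (e a \<and>\<^sub>f e b) p vs"
    and "1 \<le> a \<Longrightarrow> a \<le> n \<Longrightarrow> (e a \<and>\<^sub>f e a) p vs = 0"
    and "1 \<le> a \<Longrightarrow> a < b \<Longrightarrow> b \<le> n \<Longrightarrow> (e b \<and>\<^sub>f e a \<and>\<^sub>f \<gamma>) p vs = - (e a \<and>\<^sub>f e b \<and>\<^sub>f \<gamma>) p vs"
    and "1 \<le> a \<Longrightarrow> a \<le> n \<Longrightarrow> (e a \<and>\<^sub>f e a \<and>\<^sub>f \<gamma>) p vs = 0"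
    and "1 \<le> a \<Longrightarrow> a < b \<Longrightarrow> b \<le> n \<Longrightarrow> (\<alpha> \<and>\<^sub>f e b \<and>\<^sub>f e a) p vs = - (\<alpha> \<and>\<^sub>f e a \<and>\<^sub>f e b) p vs"
    and "1 \<le> a \<Longrightarrow> a \<le> n \<Longrightarrow> (\<alpha> \<and>\<^sub>f e a \<and>\<^sub>f e a) p vs = 0"
    and "1 \<le> a \<Longrightarrow> a < b \<Longrightarrow> b \<le> n \<Longrightarrow>
      (\<alpha> \<and>\<^sub>f e b \<and>\<^sub>f e a \<and>\<^sub>f \<gamma>) p vs = - (\<alpha> \<and>\<^sub>f e a \<and>\<^sub>f e b \<and>\<^sub>f \<gamma>) p vs"
    and "1 \<le> a \<Longrightarrow> a \<le> n \<Longrightarrow> (\<alpha> \<and>\<^sub>f e a \<and>\<^sub>f e a \<and>\<^sub>f \<gamma>) p vs = 0"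
    and "1 \<le> a \<Longrightarrow> a < b \<Longrightarrow> b \<le> n \<Longrightarrow>
      (\<alpha> \<and>\<^sub>f \<beta> \<and>\<^sub>f e b \<and>\<^sub>f e a) p vs = - (\<alpha> \<and>\<^sub>f \<beta> \<and>\<^sub>f e a \<and>\<^sub>f e b) p vs"
    and "1 \<le> a \<Longrightarrow> a \<le> n \<Longrightarrow> (\<alpha> \<and>\<^sub>f \<beta> \<and>\<^sub>f e a \<and>\<^sub>f e a) p vs = 0"
    and "1 \<le> a \<Longrightarrow> a \<le> n \<Longrightarrow> 1 \<le> b \<Longrightarrow> b \<le> n \<Longrightarrow>
      ((e a \<and>\<^sub>f e b) \<and>\<^sub>f \<gamma>) p vs = (e a \<and>\<^sub>f e b \<and>\<^sub>f \<gamma>) p vs"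
proof goal_cases
  have h': "1 \<le> j \<Longrightarrow> j \<le> n \<Longrightarrow> homogeneous 1 (e j p)" for j using h by simp
  have sw: "(e b \<and>\<^sub>f e a) p vs = - 1 * (e a \<and>\<^sub>f e b) p vs"
    "(e b \<and>\<^sub>f e a \<and>\<^sub>f \<gamma>) p vs = - 1 * (e a \<and>\<^sub>f e b \<and>\<^sub>f \<gamma>) p vs"
    if "1 \<le> a" "a < b" "b \<le> n" for a b vs \<gamma>
    using wedge_one_forms_swap[of "e b" p "e a"] wedge_one_forms_left_swap[of "e b" p "e a" \<gamma>] h' that
    by simp_all
  have z: "(e a \<and>\<^sub>f e a) p vs = 0 * (e a \<and>\<^sub>f e a) p vs"
    "(e a \<and>\<^sub>f e a \<and>\<^sub>f \<gamma>) p vs = 0 * (e a \<and>\<^sub>f e a \<and>\<^sub>f \<gamma>) p vs" if "1 \<le> a" "a \<le> n" for a vs \<gamma>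
    using wedge_one_form_self[of "e a" p] wedge_one_form_self_left[of "e a" p \<gamma>] h' that by simp_all
  { case 1 then show ?case using sw(1) by simp }
  { case 2 then show ?case using z(1) by simp }
  { case 3 then show ?case using sw(2) by simp }
  { case 4 then show ?case using z(2) by simp }
  { case 5 then show ?case using wedge_cong_left[of "e b \<and>\<^sub>f e a" p "- 1" "e a \<and>\<^sub>f e b" \<alpha> vs, OF sw(1)] by simp }
  { case 6 then show ?case using wedge_cong_left[of "e a \<and>\<^sub>f e a" p 0 "e a \<and>\<^sub>f e a" \<alpha> vs, OF z(1)] by simp }
  { case 7 then show ?case using wedge_cong_left[of "e b \<and>\<^sub>f e a \<and>\<^sub>f \<gamma>" p "- 1" "e a \<and>\<^sub>f e b \<and>\<^sub>f \<gamma>" \<alpha> vs, OF sw(2)] by simp }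
  { case 8 then show ?case using wedge_cong_left[of "e a \<and>\<^sub>f e a \<and>\<^sub>f \<gamma>" p 0 "e a \<and>\<^sub>f e a \<and>\<^sub>f \<gamma>" \<alpha> vs, OF z(2)] by simp }
  { case 9 then show ?case using wedge_cong_left[of "\<beta> \<and>\<^sub>f e b \<and>\<^sub>f e a" p "- 1" "\<beta> \<and>\<^sub>f e a \<and>\<^sub>f e b" \<alpha> vs,
        OF wedge_cong_left[of "e b \<and>\<^sub>f e a" p "- 1" "e a \<and>\<^sub>f e b", OF sw(1)]] by simp }
  { case 10 then show ?case using wedge_cong_left[of "\<beta> \<and>\<^sub>f e a \<and>\<^sub>f e a" p 0 "\<beta> \<and>\<^sub>f e a \<and>\<^sub>f e a" \<alpha> vs,
        OF wedge_cong_left[of "e a \<and>\<^sub>f e a" p 0 "e a \<and>\<^sub>f e a", OF z(1)]] by simp }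
  { case 11 then show ?case using wedge_assoc[of 1 "e a" p 1 "e b"] h' by simp }
qed

subsection \<open>From SU(2) to SU(3)\<close>

text \<open>
  The three two-forms span the self-dual forms of a four-dimensional Euclidean space, with equal
  squares and vanishing mixed products.
\<close>

lemma su2_adapted_products:
  assumes "su2_adapted M \<eta> \<omega>1 \<omega>2 \<omega>3 e p" "\<forall>j\<in>{1..5}. homogeneous 1 (e j p)"
  shows "eq_at M p (\<omega>1 \<and>\<^sub>f \<omega>1) (\<omega>3 \<and>\<^sub>f \<omega>3)" "eq_at M p (\<omega>1 \<and>\<^sub>f \<omega>3) 0" "eq_at M p (\<omega>3 \<and>\<^sub>f \<omega>1) 0"
    "eq_at M p (\<omega>2 \<and>\<^sub>f \<omega>3) 0" "eq_at M p (\<omega>3 \<and>\<^sub>f \<omega>2) 0"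
proof -
  let ?\<omega>1 = "e 1 \<and>\<^sub>f e 2 + e 3 \<and>\<^sub>f e 4" and ?\<omega>2 = "e 1 \<and>\<^sub>f e 3 + e 4 \<and>\<^sub>f e 2" and ?\<omega>3 = "e 1 \<and>\<^sub>f e 4 + e 2 \<and>\<^sub>f e 3"
  have w: "eq_at M p \<omega>1 ?\<omega>1" "eq_at M p \<omega>2 ?\<omega>2" "eq_at M p \<omega>3 ?\<omega>3"
    using assms(1) by (simp_all add: su2_adapted_def)
  note sort = coframe_wedge_sort[of 5 e p, OF assms(2)]
  have "(?\<omega>1 \<and>\<^sub>f ?\<omega>1) p vs = (?\<omega>3 \<and>\<^sub>f ?\<omega>3) p vs" "(?\<omega>1 \<and>\<^sub>f ?\<omega>3) p vs = 0" "(?\<omega>3 \<and>\<^sub>f ?\<omega>1) p vs = 0"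
    "(?\<omega>2 \<and>\<^sub>f ?\<omega>3) p vs = 0" "(?\<omega>3 \<and>\<^sub>f ?\<omega>2) p vs = 0" for vs
    by (simp_all add: wedge_linear form_apply sort)
  then have "eq_at M p (?\<omega>1 \<and>\<^sub>f ?\<omega>1) (?\<omega>3 \<and>\<^sub>f ?\<omega>3)" "eq_at M p (?\<omega>1 \<and>\<^sub>f ?\<omega>3) 0" "eq_at M p (?\<omega>3 \<and>\<^sub>f ?\<omega>1) 0"
    "eq_at M p (?\<omega>2 \<and>\<^sub>f ?\<omega>3) 0" "eq_at M p (?\<omega>3 \<and>\<^sub>f ?\<omega>2) 0"
    by (simp_all add: eq_at_def)
  then show "eq_at M p (\<omega>1 \<and>\<^sub>f \<omega>1) (\<omega>3 \<and>\<^sub>f \<omega>3)" "eq_at M p (\<omega>1 \<and>\<^sub>f \<omega>3) 0" "eq_at M p (\<omega>3 \<and>\<^sub>f \<omega>1) 0"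
    "eq_at M p (\<omega>2 \<and>\<^sub>f \<omega>3) 0" "eq_at M p (\<omega>3 \<and>\<^sub>f \<omega>2) 0"
    using w by (meson eq_at_trans eq_at_sym eq_at_wedge)+
qed

text \<open>
  Rotating \<open>e 2\<close>, \<open>e 4\<close> while keeping \<open>e 1\<close>, \<open>e 3\<close> turns \<open>\<omega>1\<close>, \<open>\<omega>2\<close>, \<open>\<omega>3\<close> into
  \<open>sin t \<omega>1 + cos t \<omega>3\<close>, \<open>\<omega>2\<close>, \<open>sin t \<omega>3 - cos t \<omega>1\<close>. The cone structure is the standard one built
  from this triple, \<open>sin t \<eta>\<close> and \<open>dt\<close>.
\<close>

lemma su3_adapted_cone:
  fixes M :: "'a::euclidean_space set"
  assumes "su2_adapted M \<eta> \<omega>1 \<omega>2 \<omega>3 e x" "\<forall>j\<in>{1..5}. homogeneous 1 (e j x)" "t \<in> {0<..<pi}"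
  shows "su3_adapted (M \<times> {0<..<pi}) (cyl_F \<eta> \<omega>1 \<omega>3) (cyl_Psi_plus \<eta> \<omega>1 \<omega>2 \<omega>3) (cyl_Psi_minus \<eta> \<omega>1 \<omega>2 \<omega>3)
    (cone_coframe 5 2 4 e) (x, t)"
proof -
  define E :: "nat \<Rightarrow> ('a \<times> real, real) form" where "E j = (if j = 6 then d_last else pullback fst (e j))" for j
  let ?p = "(x, t)" and ?f = "cone_coframe 5 2 4 e"
  have hE: "\<forall>j\<in>{1..6}. homogeneous 1 (E j ?p)"
    using assms(2) homogeneous_one_form[of "\<lambda>p. snd" "(x, t)"]
    by (auto simp: E_def d_last_eq intro!: homogeneous_pullback)
  note sort = coframe_wedge_sort[of 6 E ?p, OF hE]
  have pb: "eq_at (M \<times> {0<..<pi}) ?p (pullback fst \<alpha>) (pullback fst \<beta>)" if "eq_at M x \<alpha> \<beta>" for \<alpha> \<beta>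
    using eq_at_pullback_fst[OF _ assms(3) that] by simp
  have w: "eq_at (M \<times> {0<..<pi}) ?p (pullback fst \<eta>) (E 5)"
    "eq_at (M \<times> {0<..<pi}) ?p (pullback fst \<omega>1) (E 1 \<and>\<^sub>f E 2 + E 3 \<and>\<^sub>f E 4)"
    "eq_at (M \<times> {0<..<pi}) ?p (pullback fst \<omega>2) (E 1 \<and>\<^sub>f E 3 + E 4 \<and>\<^sub>f E 2)"
    "eq_at (M \<times> {0<..<pi}) ?p (pullback fst \<omega>3) (E 1 \<and>\<^sub>f E 4 + E 2 \<and>\<^sub>f E 3)"
    "eq_at (M \<times> {0<..<pi}) ?p d_last (E 6)"
    using assms(1)[unfolded su2_adapted_def] pb
    by (auto simp: E_def pullback_wedge[symmetric] pullback_add[symmetric] eq_at_refl)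
  have f: "?f 1 = (\<lambda>p. sin (snd p)) \<odot> E 1" "?f 3 = (\<lambda>p. sin (snd p)) \<odot> E 3" "?f 5 = (\<lambda>p. sin (snd p)) \<odot> E 5"
    "?f 2 = (\<lambda>p. sin (snd p)) \<odot> ((\<lambda>p. sin (snd p)) \<odot> E 2 + (\<lambda>p. cos (snd p)) \<odot> E 4)"
    "?f 4 = (\<lambda>p. sin (snd p)) \<odot> ((\<lambda>p. sin (snd p)) \<odot> E 4 - (\<lambda>p. cos (snd p)) \<odot> E 2)" "?f 6 = E 6"
    by (simp_all add: cone_coframe_def E_def)
  have sc: "(sin t)\<^sup>2 + (cos t)\<^sup>2 = 1" by simp
  show ?thesis
    unfolding su3_adapted_def std_Psi_eq eq_at_complex_form cyl_F_def cyl_Psi_plus_def cyl_Psi_minus_def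
  proof (intro conjI, goal_cases)
    case 1 show ?case
    proof (rule eq_at_trans)
      show "eq_at (M \<times> {0<..<pi}) ?p ((\<lambda>(x, t). (sin t)\<^sup>2) \<odot>
          ((\<lambda>(x, t). sin t) \<odot> (E 1 \<and>\<^sub>f E 2 + E 3 \<and>\<^sub>f E 4) + (\<lambda>(x, t). cos t) \<odot> (E 1 \<and>\<^sub>f E 4 + E 2 \<and>\<^sub>f E 3))
          + (\<lambda>(x, t). sin t) \<odot> (E 5 \<and>\<^sub>f E 6)) (std_F ?f)"
        unfolding eq_at_def std_F_def f
        by (intro allI impI) (simp add: wedge_linear form_apply sort algebra_simps power2_eq_square)
    qed (intro eq_at_intros w)
    case 2 show ?case
    proof (rule eq_at_trans)
      show "eq_at (M \<times> {0<..<pi}) ?p ((\<lambda>(x, t). (sin t)^3) \<odot> (E 5 \<and>\<^sub>f (E 1 \<and>\<^sub>f E 3 + E 4 \<and>\<^sub>f E 2))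
          - (\<lambda>(x, t). (sin t)\<^sup>2) \<odot> (((\<lambda>(x, t). - cos t) \<odot> (E 1 \<and>\<^sub>f E 2 + E 3 \<and>\<^sub>f E 4) +
          (\<lambda>(x, t). sin t) \<odot> (E 1 \<and>\<^sub>f E 4 + E 2 \<and>\<^sub>f E 3)) \<and>\<^sub>f E 6)) (real_Psi ?f)"
        unfolding eq_at_def real_Psi_def f
        by (intro allI impI) (simp add: wedge_linear form_apply sort del: mult_cancel_left mult_cancel_right; use sc in algebra)
    qed (intro eq_at_intros w)
    case 3 show ?case
    proof (rule eq_at_trans)
      show "eq_at (M \<times> {0<..<pi}) ?p ((\<lambda>(x, t). (sin t)^3) \<odot> (((\<lambda>(x, t). - cos t) \<odot> (E 1 \<and>\<^sub>f E 2 + E 3 \<and>\<^sub>f E 4) +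
          (\<lambda>(x, t). sin t) \<odot> (E 1 \<and>\<^sub>f E 4 + E 2 \<and>\<^sub>f E 3)) \<and>\<^sub>f E 5) +
          (\<lambda>(x, t). (sin t)\<^sup>2) \<odot> ((E 1 \<and>\<^sub>f E 3 + E 4 \<and>\<^sub>f E 2) \<and>\<^sub>f E 6)) (imag_Psi ?f)"
        unfolding eq_at_def imag_Psi_def f
        by (intro allI impI) (simp add: wedge_linear form_apply sort del: mult_cancel_left mult_cancel_right; use sc in algebra)
    qed (intro eq_at_intros w)
  qed
qed

subsection \<open>From SU(3) to G2\<close>

text \<open>
  The rotation of \<open>e 5\<close>, \<open>e 6\<close> multiplies \<open>e 5 + i e 6\<close>, and hence \<open>\<Psi>p + i \<Psi>m\<close>, by the unit complex
  number \<open>sin t - i cos t\<close> and leaves \<open>F\<close> unchanged; the common factor \<open>sin t\<close> enters squared in a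
  two-form and cubed in a three-form.
\<close>

lemma su3_adapted_cone_rotated:
  fixes M :: "'a::euclidean_space set"
  assumes "su3_adapted M F \<Psi>p \<Psi>m e x" "\<forall>j\<in>{1..6}. homogeneous 1 (e j x)" "t \<in> {0<..<pi}"
  shows "eq_at (M \<times> {0<..<pi}) (x, t) (std_F (cone_coframe 6 5 6 e)) ((\<lambda>p. (sin (snd p))\<^sup>2) \<odot> pullback fst F)"
    and "eq_at (M \<times> {0<..<pi}) (x, t) (real_Psi (cone_coframe 6 5 6 e)) ((\<lambda>p. sin (snd p) ^ 3) \<odot>
      ((\<lambda>p. sin (snd p)) \<odot> pullback fst \<Psi>p + (\<lambda>p. cos (snd p)) \<odot> pullback fst \<Psi>m))"
    and "eq_at (M \<times> {0<..<pi}) (x, t) (imag_Psi (cone_coframe 6 5 6 e)) ((\<lambda>p. sin (snd p) ^ 3) \<odot>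
      ((\<lambda>p. sin (snd p)) \<odot> pullback fst \<Psi>m - (\<lambda>p. cos (snd p)) \<odot> pullback fst \<Psi>p))"
proof goal_cases
  define E :: "nat \<Rightarrow> ('a \<times> real, real) form" where "E j = pullback fst (e j)" for j
  let ?p = "(x, t)" and ?f = "cone_coframe 6 5 6 e"
  have hE: "\<forall>j\<in>{1..6}. homogeneous 1 (E j ?p)"
    using assms(2) by (auto simp: E_def intro!: homogeneous_pullback)
  note sort = coframe_wedge_sort[of 6 E ?p, OF hE]
  have f: "?f 1 = (\<lambda>p. sin (snd p)) \<odot> E 1" "?f 2 = (\<lambda>p. sin (snd p)) \<odot> E 2"
    "?f 3 = (\<lambda>p. sin (snd p)) \<odot> E 3" "?f 4 = (\<lambda>p. sin (snd p)) \<odot> E 4"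
    "?f 5 = (\<lambda>p. sin (snd p)) \<odot> ((\<lambda>p. sin (snd p)) \<odot> E 5 + (\<lambda>p. cos (snd p)) \<odot> E 6)"
    "?f 6 = (\<lambda>p. sin (snd p)) \<odot> ((\<lambda>p. sin (snd p)) \<odot> E 6 - (\<lambda>p. cos (snd p)) \<odot> E 5)"
    by (simp_all add: cone_coframe_def E_def)
  have pb: "eq_at (M \<times> {0<..<pi}) ?p (pullback fst \<beta>) (pullback fst \<alpha>)" if "eq_at M x \<alpha> \<beta>" for \<alpha> \<beta>
    using eq_at_sym[OF eq_at_pullback_fst[OF _ assms(3) that]] by simp
  have pd: "pullback fst (\<alpha> - \<beta>) = pullback fst \<alpha> - pullback fst \<beta>" for \<alpha> \<beta> :: "('a, real) form"
    by (simp add: fun_eq_iff pullback_def)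
  have w: "eq_at (M \<times> {0<..<pi}) ?p (std_F E) (pullback fst F)"
    "eq_at (M \<times> {0<..<pi}) ?p (real_Psi E) (pullback fst \<Psi>p)"
    "eq_at (M \<times> {0<..<pi}) ?p (imag_Psi E) (pullback fst \<Psi>m)"
    using assms(1)[unfolded su3_adapted_def std_Psi_eq eq_at_complex_form] pb
    unfolding std_F_def real_Psi_def imag_Psi_def E_def pullback_wedge[symmetric] pullback_add[symmetric] pd[symmetric]
    by blast+
  have sc: "(sin t)\<^sup>2 + (cos t)\<^sup>2 = 1" by simp
  case 1 show ?case
  proof (rule eq_at_trans)
    show "eq_at (M \<times> {0<..<pi}) ?p (std_F ?f) ((\<lambda>p. (sin (snd p))\<^sup>2) \<odot> std_F E)"
      unfolding eq_at_def std_F_def f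
      by (intro allI impI) (simp add: wedge_linear form_apply sort del: mult_cancel_left mult_cancel_right; use sc in algebra)
  qed (intro eq_at_intros w)
  case 2 show ?case
  proof (rule eq_at_trans)
    show "eq_at (M \<times> {0<..<pi}) ?p (real_Psi ?f) ((\<lambda>p. sin (snd p) ^ 3) \<odot>
        ((\<lambda>p. sin (snd p)) \<odot> real_Psi E + (\<lambda>p. cos (snd p)) \<odot> imag_Psi E))"
      unfolding eq_at_def real_Psi_def imag_Psi_def f
      by (intro allI impI) (simp add: wedge_linear form_apply sort algebra_simps power2_eq_square power3_eq_cube)
  qed (intro eq_at_intros w)
  case 3 show ?case
  proof (rule eq_at_trans)
    show "eq_at (M \<times> {0<..<pi}) ?p (imag_Psi ?f) ((\<lambda>p. sin (snd p) ^ 3) \<odot>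
        ((\<lambda>p. sin (snd p)) \<odot> imag_Psi E - (\<lambda>p. cos (snd p)) \<odot> real_Psi E))"
      unfolding eq_at_def real_Psi_def imag_Psi_def f
      by (intro allI impI) (simp add: wedge_linear form_apply sort algebra_simps power2_eq_square power3_eq_cube)
  qed (intro eq_at_intros w)
qed

section \<open>The sine cone of a Sasaki-Einstein structure is nearly Kaehler\<close>

lemma
  fixes \<alpha> :: "('a, real) form"
  assumes D: "homogeneous 1 (D p)"
  shows wedge_D_2: "homogeneous 2 (\<alpha> p) \<Longrightarrow> (D \<and>\<^sub>f \<alpha>) p vs = (\<alpha> \<and>\<^sub>f D) p vs"
    and wedge_D_3: "homogeneous 3 (\<alpha> p) \<Longrightarrow> (D \<and>\<^sub>f \<alpha>) p vs = - (\<alpha> \<and>\<^sub>f D) p vs"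
    and wedge_D_D: "homogeneous k (\<alpha> p) \<Longrightarrow> (D \<and>\<^sub>f \<alpha> \<and>\<^sub>f D) p vs = 0"
proof -
  show "homogeneous 2 (\<alpha> p) \<Longrightarrow> (D \<and>\<^sub>f \<alpha>) p vs = (\<alpha> \<and>\<^sub>f D) p vs"
    using wedge_commute[of 1 D p 2 \<alpha>, OF D] by simp
  show "homogeneous 3 (\<alpha> p) \<Longrightarrow> (D \<and>\<^sub>f \<alpha>) p vs = - (\<alpha> \<and>\<^sub>f D) p vs"
    using wedge_commute[of 1 D p 3 \<alpha>, OF D] by simp
  assume a: "homogeneous k (\<alpha> p)"
  have "(D \<and>\<^sub>f \<alpha> \<and>\<^sub>f D) p vs = (- 1) ^ k * (D \<and>\<^sub>f D \<and>\<^sub>f \<alpha>) p vs"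
    by (rule wedge_cong_left) (use wedge_commute[of k \<alpha> p 1 D, OF a D] in simp)
  then show "(D \<and>\<^sub>f \<alpha> \<and>\<^sub>f D) p vs = 0"
    using wedge_one_form_self_left[of D p \<alpha>, OF D] by simp
qed

lemma
  fixes \<omega> :: "('a, real) form"
  assumes h: "homogeneous 1 (\<eta> p)" and w: "homogeneous 2 (\<omega> p)"
  shows wedge_eta_omega_eta: "((\<eta> \<and>\<^sub>f \<omega>) \<and>\<^sub>f \<eta>) p vs = 0"
    and wedge_eta_eta_omega: "(\<eta> \<and>\<^sub>f \<eta> \<and>\<^sub>f \<omega>) p vs = 0"
proof -
  show "(\<eta> \<and>\<^sub>f \<eta> \<and>\<^sub>f \<omega>) p vs = 0" using wedge_one_form_self_left[of \<eta> p \<omega>, OF h] .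
  show "((\<eta> \<and>\<^sub>f \<omega>) \<and>\<^sub>f \<eta>) p vs = 0"
    using wedge_assoc[of 1 \<eta> p 2 \<omega> \<eta> vs, OF h w] wedge_D_D[of \<eta> p 2 \<omega> vs, OF h w] by simp
qed

text \<open>
  The four-forms occurring in the structure equations of the cone are multiples of
  \<open>\<eta> \<and>\<^sub>f \<omega> \<and>\<^sub>f D\<close>, where \<open>D\<close> is the form of the interval; the signs come from the degrees alone.
\<close>

lemma
  fixes \<omega> :: "('a, real) form"
  assumes h: "homogeneous 1 (\<eta> p)" and w: "homogeneous 2 (\<omega> p)" and D: "homogeneous 1 (D p)"
  shows sort_eta_omega_D: "((\<eta> \<and>\<^sub>f \<omega>) \<and>\<^sub>f D) p vs = (\<eta> \<and>\<^sub>f \<omega> \<and>\<^sub>f D) p vs"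
    and sort_omega_eta_D: "(\<omega> \<and>\<^sub>f \<eta> \<and>\<^sub>f D) p vs = (\<eta> \<and>\<^sub>f \<omega> \<and>\<^sub>f D) p vs"
    and sort_eta_D_omega: "((\<eta> \<and>\<^sub>f D) \<and>\<^sub>f \<omega>) p vs = (\<eta> \<and>\<^sub>f \<omega> \<and>\<^sub>f D) p vs"
    and sort_D_omega_eta: "(D \<and>\<^sub>f \<omega> \<and>\<^sub>f \<eta>) p vs = - (\<eta> \<and>\<^sub>f \<omega> \<and>\<^sub>f D) p vs"
    and sort_D_eta_omega: "(D \<and>\<^sub>f \<eta> \<and>\<^sub>f \<omega>) p vs = - (\<eta> \<and>\<^sub>f \<omega> \<and>\<^sub>f D) p vs"
proof -
  have hD: "homogeneous 2 ((\<eta> \<and>\<^sub>f D) p)" using homogeneous_wedge[of 1 \<eta> p 1 D, OF h D] by (simp add: numeral_2_eq_2)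
  have c: "(D \<and>\<^sub>f \<omega>) p vs = 1 * (\<omega> \<and>\<^sub>f D) p vs" "(\<omega> \<and>\<^sub>f \<eta>) p vs = 1 * (\<eta> \<and>\<^sub>f \<omega>) p vs" for vs
    using wedge_D_2[of D p \<omega>, OF D w] wedge_D_2[of \<eta> p \<omega>, OF h w] by simp_all
  show "((\<eta> \<and>\<^sub>f \<omega>) \<and>\<^sub>f D) p vs = (\<eta> \<and>\<^sub>f \<omega> \<and>\<^sub>f D) p vs"
    using wedge_assoc[of 1 \<eta> p 2 \<omega> D vs, OF h w] .
  show ed: "((\<eta> \<and>\<^sub>f D) \<and>\<^sub>f \<omega>) p vs = (\<eta> \<and>\<^sub>f \<omega> \<and>\<^sub>f D) p vs"
    using wedge_assoc[of 1 \<eta> p 1 D \<omega> vs, OF h D] wedge_cong_left[of "D \<and>\<^sub>f \<omega>" p 1 "\<omega> \<and>\<^sub>f D" \<eta> vs, OF c(1)]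
    by simp
  show "(\<omega> \<and>\<^sub>f \<eta> \<and>\<^sub>f D) p vs = (\<eta> \<and>\<^sub>f \<omega> \<and>\<^sub>f D) p vs"
    using wedge_commute[of 2 \<omega> p 2 "\<eta> \<and>\<^sub>f D" vs, OF w hD] ed by simp
  show de: "(D \<and>\<^sub>f \<eta> \<and>\<^sub>f \<omega>) p vs = - (\<eta> \<and>\<^sub>f \<omega> \<and>\<^sub>f D) p vs"
    using wedge_one_forms_left_swap[of D p \<eta> \<omega> vs, OF D h]
      wedge_cong_left[of "D \<and>\<^sub>f \<omega>" p 1 "\<omega> \<and>\<^sub>f D" \<eta> vs, OF c(1)] by simp
  show "(D \<and>\<^sub>f \<omega> \<and>\<^sub>f \<eta>) p vs = - (\<eta> \<and>\<^sub>f \<omega> \<and>\<^sub>f D) p vs"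
    using de wedge_cong_left[of "\<omega> \<and>\<^sub>f \<eta>" p 1 "\<eta> \<and>\<^sub>f \<omega>" D vs, OF c(2)] by simp
qed

abbreviation "sn \<equiv> \<lambda>p::'a::euclidean_space \<times> real. sin (snd p)"
abbreviation "cs \<equiv> \<lambda>p::'a::euclidean_space \<times> real. cos (snd p)"

lemma cyl_F_expand: "cyl_F \<eta> \<omega>1 \<omega>3 =
    (\<lambda>p. sn p ^ 3) \<odot> pullback fst \<omega>1 + (\<lambda>p. (sn p)\<^sup>2 * cs p) \<odot> pullback fst \<omega>3 +
    (\<lambda>p. sn p) \<odot> (pullback fst \<eta> \<and>\<^sub>f d_last)"
  by (simp add: cyl_F_def fun_eq_iff fscale_apply case_prod_beta algebra_simps power2_eq_square power3_eq_cube)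

lemma cyl_Psi_plus_expand: "cyl_Psi_plus \<eta> \<omega>1 \<omega>2 \<omega>3 =
    (\<lambda>p. sn p ^ 3) \<odot> (pullback fst \<eta> \<and>\<^sub>f pullback fst \<omega>2) +
    (\<lambda>p. (sn p)\<^sup>2 * cs p) \<odot> (pullback fst \<omega>1 \<and>\<^sub>f d_last) - (\<lambda>p. sn p ^ 3) \<odot> (pullback fst \<omega>3 \<and>\<^sub>f d_last)"
  by (simp add: cyl_Psi_plus_def fun_eq_iff wedge_linear fscale_apply case_prod_beta algebra_simps
      power2_eq_square power3_eq_cube)

lemma cyl_Psi_minus_expand: "cyl_Psi_minus \<eta> \<omega>1 \<omega>2 \<omega>3 =
    (\<lambda>p. sn p ^ 4) \<odot> (pullback fst \<omega>3 \<and>\<^sub>f pullback fst \<eta>) -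
    (\<lambda>p. sn p ^ 3 * cs p) \<odot> (pullback fst \<omega>1 \<and>\<^sub>f pullback fst \<eta>) +
    (\<lambda>p. (sn p)\<^sup>2) \<odot> (pullback fst \<omega>2 \<and>\<^sub>f d_last)"
  by (simp add: cyl_Psi_minus_def fun_eq_iff wedge_linear fscale_apply case_prod_beta algebra_simps
      power2_eq_square power3_eq_cube power4_eq_xxxx)

lemma cyl_phi_expand: "cyl_phi F \<Psi>p \<Psi>m =
    (\<lambda>p. (sn p)\<^sup>2) \<odot> (pullback fst F \<and>\<^sub>f d_last) + (\<lambda>p. sn p ^ 3 * cs p) \<odot> pullback fst \<Psi>p -
    (\<lambda>p. sn p ^ 4) \<odot> pullback fst \<Psi>m"
  by (simp add: cyl_phi_def fun_eq_iff wedge_linear fscale_apply case_prod_beta algebra_simps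
      power2_eq_square power3_eq_cube power4_eq_xxxx)

lemma smooth_form_wedge_UNIV:
  "smooth_form j UNIV \<alpha> \<Longrightarrow> smooth_form k UNIV \<beta> \<Longrightarrow> j + k = n \<Longrightarrow> smooth_form n UNIV (\<alpha> \<and>\<^sub>f \<beta>)"
  using smooth_form_wedge[OF open_UNIV] by blast

lemma
  assumes "smooth_form 1 UNIV \<eta>" "smooth_form 2 UNIV \<omega>1" "smooth_form 2 UNIV \<omega>2" "smooth_form 2 UNIV \<omega>3"
  shows smooth_form_cyl_F: "smooth_form 2 UNIV (cyl_F \<eta> \<omega>1 \<omega>3)"
    and smooth_form_cyl_Psi_plus: "smooth_form 3 UNIV (cyl_Psi_plus \<eta> \<omega>1 \<omega>2 \<omega>3)"
    and smooth_form_cyl_Psi_minus: "smooth_form 3 UNIV (cyl_Psi_minus \<eta> \<omega>1 \<omega>2 \<omega>3)"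
proof -
  note pb = assms[THEN smooth_form_pullback_fst_UNIV] smooth_form_d_last
  show "smooth_form 2 UNIV (cyl_F \<eta> \<omega>1 \<omega>3)" "smooth_form 3 UNIV (cyl_Psi_plus \<eta> \<omega>1 \<omega>2 \<omega>3)"
    "smooth_form 3 UNIV (cyl_Psi_minus \<eta> \<omega>1 \<omega>2 \<omega>3)"
    unfolding cyl_F_expand cyl_Psi_plus_expand cyl_Psi_minus_expand
    by (intro smooth_form_intros smooth_intros open_UNIV pb smooth_form_wedge_UNIV[OF pb(1) pb(5)]
        smooth_form_wedge_UNIV[OF pb(1) pb(3)] smooth_form_wedge_UNIV[OF pb(2) pb(5)]
        smooth_form_wedge_UNIV[OF pb(3) pb(5)] smooth_form_wedge_UNIV[OF pb(4) pb(5)]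
        smooth_form_wedge_UNIV[OF pb(4) pb(1)] smooth_form_wedge_UNIV[OF pb(2) pb(1)]; simp)+
qed

lemma smooth_form_cyl_phi:
  assumes "smooth_form 2 UNIV F" "smooth_form 3 UNIV \<Psi>p" "smooth_form 3 UNIV \<Psi>m"
  shows "smooth_form 3 UNIV (cyl_phi F \<Psi>p \<Psi>m)"
proof -
  note pb = assms[THEN smooth_form_pullback_fst_UNIV] smooth_form_d_last
  show ?thesis
    unfolding cyl_phi_expand
    by (intro smooth_form_intros smooth_intros open_UNIV pb smooth_form_wedge_UNIV[OF pb(1) pb(4)]; simp)
qed

lemma has_real_derivative_sin_cos_products:
  fixes t :: real
  shows "((\<lambda>t. sin t ^ 3) has_real_derivative 3 * (sin t)\<^sup>2 * cos t) (at t)"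
    and "((\<lambda>t. (sin t)\<^sup>2 * cos t) has_real_derivative 2 * sin t * (cos t)\<^sup>2 - sin t ^ 3) (at t)"
    and "(sin has_real_derivative cos t) (at t)"
    and "((\<lambda>t. sin t ^ 4) has_real_derivative 4 * sin t ^ 3 * cos t) (at t)"
    and "((\<lambda>t. sin t ^ 3 * cos t) has_real_derivative 3 * (sin t)\<^sup>2 * (cos t)\<^sup>2 - sin t ^ 4) (at t)"
    and "((\<lambda>t. (sin t)\<^sup>2) has_real_derivative 2 * sin t * cos t) (at t)"
  by (auto intro!: derivative_eq_intros simp: power2_eq_square power3_eq_cube power4_eq_xxxx eval_nat_numeral)

lemmas ext_d_radial = has_real_derivative_sin_cos_products[THEN ext_d_fscale_snd]

lemma differentiable_form_radial:
  fixes \<alpha> :: "('a::euclidean_space \<times> real, real) form"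
  assumes "differentiable_form \<alpha>"
  shows "differentiable_form ((\<lambda>p. sin (snd p) ^ m * cos (snd p) ^ k) \<odot> \<alpha>)"
proof -
  have "smooth_on UNIV (\<lambda>p :: 'a \<times> real. sin (snd p) ^ m * cos (snd p) ^ k)"
    by (intro smooth_intros open_UNIV)
  then show ?thesis using differentiable_form_fscale[OF smooth_on_differentiable assms] by blast
qed

lemmas differentiable_form_radials = differentiable_form_radial[of _ 3 0, simplified]
  differentiable_form_radial[of _ 2 1, simplified] differentiable_form_radial[of _ 1 0, simplified]
  differentiable_form_radial[of _ 4 0, simplified] differentiable_form_radial[of _ 3 1, simplified]
  differentiable_form_radial[of _ 2 0, simplified]

lemma ext_d_wedge_d_last:
  assumes "differentiable_form \<alpha>" "\<And>y. homogeneous k (\<alpha> y)"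
  shows "ext_d (\<alpha> \<and>\<^sub>f d_last) p vs = (ext_d \<alpha> \<and>\<^sub>f d_last) p vs"
  using ext_d_wedge[OF assms(1) smooth_form_differentiable[OF smooth_form_d_last] assms(2), of p vs]
    wedge_zero_right[of "ext_d d_last" p \<alpha> vs]
  by (simp add: ext_d_d_last)

text \<open>
  The Leibniz rule separates the derivatives of the radial coefficients, which carry the form of the
  interval, from the exterior derivatives on the base.
\<close>

lemma ext_d_cyl:
  fixes \<eta> :: "('a::euclidean_space, real) form"
  assumes s: "smooth_form 1 UNIV \<eta>" "smooth_form 2 UNIV \<omega>1" "smooth_form 2 UNIV \<omega>2" "smooth_form 2 UNIV \<omega>3"
  defines "H \<equiv> pullback fst \<eta> :: ('a \<times> real, real) form"
    and "W1 \<equiv> pullback fst \<omega>1" and "W2 \<equiv> pullback fst \<omega>2" and "W3 \<equiv> pullback fst \<omega>3"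
  shows "ext_d (cyl_F \<eta> \<omega>1 \<omega>3) p vs =
      3 * (sn p)\<^sup>2 * cs p * (d_last \<and>\<^sub>f W1) p vs + sn p ^ 3 * pullback fst (ext_d \<omega>1) p vs +
      (2 * sn p * (cs p)\<^sup>2 - sn p ^ 3) * (d_last \<and>\<^sub>f W3) p vs + (sn p)\<^sup>2 * cs p * pullback fst (ext_d \<omega>3) p vs +
      cs p * (d_last \<and>\<^sub>f H \<and>\<^sub>f d_last) p vs + sn p * (pullback fst (ext_d \<eta>) \<and>\<^sub>f d_last) p vs"
    and "ext_d (cyl_Psi_plus \<eta> \<omega>1 \<omega>2 \<omega>3) p vs =
      3 * (sn p)\<^sup>2 * cs p * (d_last \<and>\<^sub>f H \<and>\<^sub>f W2) p vs +
      sn p ^ 3 * ((pullback fst (ext_d \<eta>) \<and>\<^sub>f W2) p vs - (H \<and>\<^sub>f pullback fst (ext_d \<omega>2)) p vs) +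
      (2 * sn p * (cs p)\<^sup>2 - sn p ^ 3) * (d_last \<and>\<^sub>f W1 \<and>\<^sub>f d_last) p vs +
      (sn p)\<^sup>2 * cs p * (pullback fst (ext_d \<omega>1) \<and>\<^sub>f d_last) p vs -
      (3 * (sn p)\<^sup>2 * cs p * (d_last \<and>\<^sub>f W3 \<and>\<^sub>f d_last) p vs +
       sn p ^ 3 * (pullback fst (ext_d \<omega>3) \<and>\<^sub>f d_last) p vs)"
    and "ext_d (cyl_Psi_minus \<eta> \<omega>1 \<omega>2 \<omega>3) p vs =
      4 * sn p ^ 3 * cs p * (d_last \<and>\<^sub>f W3 \<and>\<^sub>f H) p vs +
      sn p ^ 4 * ((pullback fst (ext_d \<omega>3) \<and>\<^sub>f H) p vs + (W3 \<and>\<^sub>f pullback fst (ext_d \<eta>)) p vs) -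
      ((3 * (sn p)\<^sup>2 * (cs p)\<^sup>2 - sn p ^ 4) * (d_last \<and>\<^sub>f W1 \<and>\<^sub>f H) p vs +
       sn p ^ 3 * cs p * ((pullback fst (ext_d \<omega>1) \<and>\<^sub>f H) p vs + (W1 \<and>\<^sub>f pullback fst (ext_d \<eta>)) p vs)) +
      (2 * sn p * cs p * (d_last \<and>\<^sub>f W2 \<and>\<^sub>f d_last) p vs + (sn p)\<^sup>2 * (pullback fst (ext_d \<omega>2) \<and>\<^sub>f d_last) p vs)"
proof goal_cases
  note pb = s[THEN smooth_form_pullback_fst_UNIV[where ?'b = real], folded H_def W1_def W2_def W3_def]
  note hom = pb[THEN smooth_form_homogeneous[OF _ UNIV_I]]
  note d0 = s[THEN smooth_form_differentiable]
  note d = pb[THEN smooth_form_differentiable]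
  note dD = smooth_form_differentiable[OF smooth_form_d_last[where ?'a = 'a]]
  have e: "ext_d H = pullback fst (ext_d \<eta>)" "ext_d W1 = pullback fst (ext_d \<omega>1)"
    "ext_d W2 = pullback fst (ext_d \<omega>2)" "ext_d W3 = pullback fst (ext_d \<omega>3)"
    unfolding H_def W1_def W2_def W3_def by (simp_all add: ext_d_pullback_fst d0)
  note dw = differentiable_form_wedge[OF d(1) dD] differentiable_form_wedge[OF d(2) dD]
    differentiable_form_wedge[OF d(3) dD] differentiable_form_wedge[OF d(4) dD]
    differentiable_form_wedge[OF d(1) d(3)] differentiable_form_wedge[OF d(2) d(1)] differentiable_form_wedge[OF d(4) d(1)]
  note eD = ext_d_wedge_d_last[OF d(1) hom(1)] ext_d_wedge_d_last[OF d(2) hom(2)]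
    ext_d_wedge_d_last[OF d(3) hom(3)] ext_d_wedge_d_last[OF d(4) hom(4)]
  note ew = ext_d_wedge[OF d(1) d(3) hom(1)] ext_d_wedge[OF d(2) d(1) hom(2)] ext_d_wedge[OF d(4) d(1) hom(4)]
  note A = ext_d_add ext_d_diff differentiable_form_add differentiable_form_diff differentiable_form_radials
    ext_d_radial eD ew e d dw
  case 1 show ?case
    unfolding cyl_F_expand H_def[symmetric] W1_def[symmetric] W3_def[symmetric] by (simp add: A)
  case 2 show ?case
    unfolding cyl_Psi_plus_expand H_def[symmetric] W1_def[symmetric] W2_def[symmetric] W3_def[symmetric]
    by (simp add: A)
  case 3 show ?case
    unfolding cyl_Psi_minus_expand H_def[symmetric] W1_def[symmetric] W2_def[symmetric] W3_def[symmetric]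
    by (simp add: A)
qed

lemma locally_coframe_mono:
  "locally_coframe n M Q \<Longrightarrow> (\<And>e x. x \<in> M \<Longrightarrow> Q e x \<Longrightarrow> Q' e x) \<Longrightarrow> locally_coframe n M Q'"
  unfolding locally_coframe_def by (meson IntD1)

lemma locally_coframe_obtain:
  assumes "locally_coframe n M Q" "x \<in> M"
  obtains e where "\<forall>j\<in>{1..n}. homogeneous 1 (e j x)" "coframe_at n M e x" "Q e x"
proof -
  obtain U e where "x \<in> U" "\<forall>y\<in>M \<inter> U. coframe_at n M e y \<and> Q e y"
    using assms unfolding locally_coframe_def by blast
  then have "coframe_at n M e x" "Q e x" using assms(2) by blast+
  moreover from this(1) have "\<forall>j\<in>{1..n}. homogeneous 1 (e j x)"
    by (auto simp: coframe_at_def form_at_iff_alternating intro: alternating_homogeneous)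
  ultimately show thesis using that by blast
qed

lemma su3_metric_cone:
  assumes "su2_metric M \<eta> \<omega>1 \<omega>2 \<omega>3 g" "\<And>p. p \<in> M \<Longrightarrow> subspace (tangent_space M p)"
  shows "su3_metric (M \<times> {0<..<pi}) (cyl_F \<eta> \<omega>1 \<omega>3) (cyl_Psi_plus \<eta> \<omega>1 \<omega>2 \<omega>3)
    (cyl_Psi_minus \<eta> \<omega>1 \<omega>2 \<omega>3) (sine_cone g)"
proof -
  have "locally_coframe (Suc 5) (M \<times> {0<..<pi}) (\<lambda>e p. su3_adapted (M \<times> {0<..<pi}) (cyl_F \<eta> \<omega>1 \<omega>3)
      (cyl_Psi_plus \<eta> \<omega>1 \<omega>2 \<omega>3) (cyl_Psi_minus \<eta> \<omega>1 \<omega>2 \<omega>3) e p \<and>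
      orthonormal_at (Suc 5) (M \<times> {0<..<pi}) (sine_cone g) e p)"
    by (rule locally_coframe_cone[where i = 2 and k = 4, OF assms(1)[unfolded su2_metric_def] assms(2)])
      (auto intro!: su3_adapted_cone orthonormal_at_cone[of 2 5 4, simplified])
  then show ?thesis by (simp add: su3_metric_def)
qed

text \<open>
  After insertion of the Sasaki-Einstein equations into \<open>ext_d_cyl\<close>, the terms without \<open>dt\<close> agree
  because \<open>\<omega>1 \<and> \<omega>3 = \<omega>2 \<and> \<omega>3 = 0\<close> and \<open>\<omega>1 \<and> \<omega>1 = \<omega>3 \<and> \<omega>3\<close>, and the coefficients of the terms with
  \<open>dt\<close> agree because \<open>sin\<^sup>2 t + cos\<^sup>2 t = 1\<close>. On the manifold the hypothesis on \<open>\<omega>3\<close> is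
  \<open>d (d \<eta>) = 0\<close>; it is stated because \<open>\<omega>3\<close> is an ambient representative of \<open>- d \<eta> / 2\<close>. The second
  conclusion is the corresponding hypothesis for the next cone.
\<close>

theorem nearly_kaehler_cone:
  fixes \<eta> :: "('a::euclidean_space, real) form"
  assumes s: "smooth_form 1 UNIV \<eta>" "smooth_form 2 UNIV \<omega>1" "smooth_form 2 UNIV \<omega>2" "smooth_form 2 UNIV \<omega>3"
    and se: "sasaki_einstein M \<eta> \<omega>1 \<omega>2 \<omega>3" and d3: "eq_on M (ext_d \<omega>3) 0"
    and sub: "\<And>p. p \<in> M \<Longrightarrow> subspace (tangent_space M p)"
  shows "nearly_kaehler (M \<times> {0<..<pi}) (cyl_F \<eta> \<omega>1 \<omega>3) (cyl_Psi_plus \<eta> \<omega>1 \<omega>2 \<omega>3) (cyl_Psi_minus \<eta> \<omega>1 \<omega>2 \<omega>3)"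
    and "eq_on (M \<times> {0<..<pi}) (ext_d (cyl_Psi_plus \<eta> \<omega>1 \<omega>2 \<omega>3)) 0"
proof -
  let ?F = "cyl_F \<eta> \<omega>1 \<omega>3" and ?P = "cyl_Psi_plus \<eta> \<omega>1 \<omega>2 \<omega>3" and ?Q = "cyl_Psi_minus \<eta> \<omega>1 \<omega>2 \<omega>3"
  let ?N = "M \<times> {0<..<pi}"
  have su2: "locally_coframe 5 M (su2_adapted M \<eta> \<omega>1 \<omega>2 \<omega>3)" and M: "submanifold 5 M"
    and de: "eq_on M (ext_d \<eta>) ((- 2) \<cdot> \<omega>3)" and d1: "eq_on M (ext_d \<omega>1) (3 \<cdot> (\<eta> \<and>\<^sub>f \<omega>2))"
    and d2: "eq_on M (ext_d \<omega>2) ((- 3) \<cdot> (\<eta> \<and>\<^sub>f \<omega>1))"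
    using se by (simp_all add: sasaki_einstein_def su2_structure_def)
  have eqs: "ext_d ?F p vs = (3 \<cdot> ?P) p vs \<and> ext_d ?Q p vs = ((- 2) \<cdot> (?F \<and>\<^sub>f ?F)) p vs \<and> ext_d ?P p vs = 0"
    if p: "p \<in> ?N" and vs: "set vs \<subseteq> tangent_space ?N p" for p vs
  proof -
    obtain x t where xt: "p = (x, t)" "x \<in> M" "t \<in> {0<..<pi}" using p by auto
    define H W1 W2 W3 where "H = (pullback fst \<eta> :: ('a \<times> real, real) form)"
      and "W1 = (pullback fst \<omega>1 :: ('a \<times> real, real) form)"
      and "W2 = (pullback fst \<omega>2 :: ('a \<times> real, real) form)"
      and "W3 = (pullback fst \<omega>3 :: ('a \<times> real, real) form)"
    let ?D = "d_last :: ('a \<times> real, real) form"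
    note fold = H_def[symmetric] W1_def[symmetric] W2_def[symmetric] W3_def[symmetric]
    note hom = s[THEN smooth_form_pullback_fst_UNIV[where ?'b = real],
        THEN smooth_form_homogeneous[OF _ UNIV_I[of p]], unfolded fold]
    have hD: "homogeneous 1 (?D p)" using smooth_form_homogeneous[OF smooth_form_d_last] by simp
    note sorts = sort_eta_omega_D[of H p _ ?D, OF hom(1) _ hD] sort_omega_eta_D[of H p _ ?D, OF hom(1) _ hD]
      sort_eta_D_omega[of H p _ ?D, OF hom(1) _ hD] sort_D_omega_eta[of H p _ ?D, OF hom(1) _ hD]
      sort_D_eta_omega[of H p _ ?D, OF hom(1) _ hD] wedge_D_2[of ?D p, OF hD] wedge_D_D[of ?D p 1 H, OF hD hom(1)]
      wedge_D_D[of ?D p 2 W1, OF hD hom(2)] wedge_D_D[of ?D p 2 W2, OF hD hom(3)]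
      wedge_D_D[of ?D p 2 W3, OF hD hom(4)] wedge_eta_omega_eta[of H p, OF hom(1)] wedge_eta_eta_omega[of H p, OF hom(1)]
    have HDHD: "((H \<and>\<^sub>f ?D) \<and>\<^sub>f H \<and>\<^sub>f ?D) p vs = 0"
      using wedge_assoc[of 1 H p 1 ?D "H \<and>\<^sub>f ?D" vs, OF hom(1) hD]
        wedge_cong_left[of "?D \<and>\<^sub>f H \<and>\<^sub>f ?D" p 0 "?D \<and>\<^sub>f H \<and>\<^sub>f ?D" H vs]
        wedge_D_D[of ?D p 1 H, OF hD hom(1)] by simp
    have pb: "eq_at ?N p (pullback fst \<alpha>) (pullback fst \<beta>)" if "eq_at M x \<alpha> \<beta>" for \<alpha> \<beta>
      unfolding xt(1) using eq_at_pullback_fst[OF _ xt(3) that] by simp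
    note pbs = pullback_cscale pullback_wedge pullback_zero fold
    have a: "eq_at ?N p (pullback fst (ext_d \<eta>)) ((- 2) \<cdot> W3)"
      "eq_at ?N p (pullback fst (ext_d \<omega>1)) (3 \<cdot> (H \<and>\<^sub>f W2))"
      "eq_at ?N p (pullback fst (ext_d \<omega>2)) ((- 3) \<cdot> (H \<and>\<^sub>f W1))"
      "eq_at ?N p (pullback fst (ext_d \<omega>3)) 0"
      using pb[of "ext_d \<eta>" "(- 2) \<cdot> \<omega>3"] pb[of "ext_d \<omega>1" "3 \<cdot> (\<eta> \<and>\<^sub>f \<omega>2)"]
        pb[of "ext_d \<omega>2" "(- 3) \<cdot> (\<eta> \<and>\<^sub>f \<omega>1)"] pb[of "ext_d \<omega>3" 0] de d1 d2 d3 xt(2)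
      by (simp_all add: eq_on_def pbs)
    obtain e where "\<forall>j\<in>{1..5}. homogeneous 1 (e j x)" "su2_adapted M \<eta> \<omega>1 \<omega>2 \<omega>3 e x"
      using locally_coframe_obtain[OF su2 xt(2)] by blast
    note prod = su2_adapted_products[OF this(2,1), THEN pb, unfolded pbs, THEN eq_atD, OF vs]
    note A = a[THEN eq_atD, OF vs] a[THEN eq_at_wedge[OF _ eq_at_refl], THEN eq_atD, OF vs, of ?D]
      a[THEN eq_at_wedge[OF _ eq_at_refl], THEN eq_atD, OF vs, of H]
      a(1)[THEN eq_at_wedge[OF _ eq_at_refl], THEN eq_atD, OF vs, of W2]
      a(1)[THEN eq_at_wedge[OF eq_at_refl], THEN eq_atD, OF vs, of W1]
      a(1)[THEN eq_at_wedge[OF eq_at_refl], THEN eq_atD, OF vs, of W3]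
      a(3)[THEN eq_at_wedge[OF eq_at_refl], THEN eq_atD, OF vs, of H]
    have z: "(0 \<and>\<^sub>f \<alpha>) p vs = 0" for \<alpha> :: "('a \<times> real, real) form"
      by (rule wedge_zero_left) simp
    have sc: "(sn p)\<^sup>2 + (cs p)\<^sup>2 = 1" by simp
    note E = ext_d_cyl[OF s, of p vs, unfolded fold]
    note S = A prod sorts hom HDHD z wedge_linear form_apply
    have "ext_d ?F p vs = (3 \<cdot> ?P) p vs"
      unfolding cyl_Psi_plus_expand E(1) fold
      by (simp add: S del: mult_cancel_left mult_cancel_right) (use sc in algebra)
    moreover have "ext_d ?P p vs = 0"
      unfolding E(2) by (simp add: S del: mult_cancel_left mult_cancel_right)
    moreover have "ext_d ?Q p vs = ((- 2) \<cdot> (?F \<and>\<^sub>f ?F)) p vs"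
      unfolding cyl_F_expand E(3) fold
      by (simp add: S del: mult_cancel_left mult_cancel_right) (use sc in algebra)
    ultimately show ?thesis by blast
  qed
  have "locally_coframe (Suc 5) ?N (su3_adapted ?N ?F ?P ?Q)"
    by (rule locally_coframe_cone[where i = 2 and k = 4, OF su2 sub]) (auto intro!: su3_adapted_cone)
  moreover have "submanifold 6 ?N" using submanifold_Times_open[OF M, of "{0<..<pi}"] by simp
  ultimately have "su3_structure ?N ?F ?P ?Q"
    by (simp add: su3_structure_def smooth_form_on smooth_form_cyl_F[OF s] smooth_form_cyl_Psi_plus[OF s]
        smooth_form_cyl_Psi_minus[OF s])
  then show "nearly_kaehler ?N ?F ?P ?Q"
    using eqs by (simp add: nearly_kaehler_def eq_on_def eq_at_def)
  show "eq_on ?N (ext_d ?P) 0"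
    using eqs by (simp add: eq_on_def eq_at_def)
qed

section \<open>The sine cone of a nearly Kaehler structure is nearly parallel\<close>

lemma std_phi_eq: "std_phi e = (std_F e \<and>\<^sub>f e 7) - imag_Psi e"
  and std_star_phi_eq: "std_star_phi e = (1 / 2) \<cdot> (std_F e \<and>\<^sub>f std_F e) + (real_Psi e \<and>\<^sub>f e 7)"
  by (simp_all add: std_phi_def std_star_phi_def std_Psi_eq complex_form_def)

lemma cone_coframe_last: "cone_coframe 6 i k e 7 = d_last"
  by (simp add: cone_coframe_def)

lemma g2_adapted_cone:
  assumes "su3_adapted M F \<Psi>p \<Psi>m e x" "\<forall>j\<in>{1..6}. homogeneous 1 (e j x)" "t \<in> {0<..<pi}"
  shows "g2_adapted (M \<times> {0<..<pi}) (cyl_phi F \<Psi>p \<Psi>m) (cone_coframe 6 5 6 e) (x, t)"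
    and "eq_at (M \<times> {0<..<pi}) (x, t) (std_star_phi (cone_coframe 6 5 6 e))
      ((1 / 2) \<cdot> (((\<lambda>p. (sn p)\<^sup>2) \<odot> pullback fst F) \<and>\<^sub>f ((\<lambda>p. (sn p)\<^sup>2) \<odot> pullback fst F)) +
       (((\<lambda>p. sn p ^ 3) \<odot> (sn \<odot> pullback fst \<Psi>p + cs \<odot> pullback fst \<Psi>m)) \<and>\<^sub>f d_last))"
proof -
  note r = su3_adapted_cone_rotated[OF assms]
  show "eq_at (M \<times> {0<..<pi}) (x, t) (std_star_phi (cone_coframe 6 5 6 e))
      ((1 / 2) \<cdot> (((\<lambda>p. (sn p)\<^sup>2) \<odot> pullback fst F) \<and>\<^sub>f ((\<lambda>p. (sn p)\<^sup>2) \<odot> pullback fst F)) +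
       (((\<lambda>p. sn p ^ 3) \<odot> (sn \<odot> pullback fst \<Psi>p + cs \<odot> pullback fst \<Psi>m)) \<and>\<^sub>f d_last))"
    unfolding std_star_phi_eq cone_coframe_last by (intro eq_at_intros r eq_at_refl)
  have "eq_at (M \<times> {0<..<pi}) (x, t) (std_phi (cone_coframe 6 5 6 e))
      ((((\<lambda>p. (sn p)\<^sup>2) \<odot> pullback fst F) \<and>\<^sub>f d_last) -
       ((\<lambda>p. sn p ^ 3) \<odot> (sn \<odot> pullback fst \<Psi>m - cs \<odot> pullback fst \<Psi>p)))"
    unfolding std_phi_eq cone_coframe_last by (intro eq_at_intros r eq_at_refl)
  moreover have "cyl_phi F \<Psi>p \<Psi>m = (((\<lambda>p. (sn p)\<^sup>2) \<odot> pullback fst F) \<and>\<^sub>f d_last) -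
       ((\<lambda>p. sn p ^ 3) \<odot> (sn \<odot> pullback fst \<Psi>m - cs \<odot> pullback fst \<Psi>p))"
    by (simp add: cyl_phi_def fun_eq_iff wedge_linear fscale_apply case_prod_beta)
  ultimately show "g2_adapted (M \<times> {0<..<pi}) (cyl_phi F \<Psi>p \<Psi>m) (cone_coframe 6 5 6 e) (x, t)"
    using eq_at_sym unfolding g2_adapted_def by metis
qed

lemma g2_metric_cone:
  assumes "su3_metric M F \<Psi>p \<Psi>m g" "\<And>p. p \<in> M \<Longrightarrow> subspace (tangent_space M p)"
  shows "g2_metric (M \<times> {0<..<pi}) (cyl_phi F \<Psi>p \<Psi>m) (sine_cone g)"
proof -
  have "locally_coframe (Suc 6) (M \<times> {0<..<pi}) (\<lambda>e p. g2_adapted (M \<times> {0<..<pi}) (cyl_phi F \<Psi>p \<Psi>m) e p \<and>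
      orthonormal_at (Suc 6) (M \<times> {0<..<pi}) (sine_cone g) e p)"
    by (rule locally_coframe_cone[where i = 5 and k = 6, OF assms(1)[unfolded su3_metric_def] assms(2)])
      (auto intro!: g2_adapted_cone(1) orthonormal_at_cone[of 5 6 6, simplified])
  then show ?thesis by (simp add: g2_metric_def)
qed

text \<open>
  The terms with \<open>dq\<close> in \<open>d \<phi>\<close> are
  \<open>(3 sin\<^sup>2 q + sin\<^sup>4 q - 3 sin\<^sup>2 q cos\<^sup>2 q) \<Psi>p + 4 sin\<^sup>3 q cos q \<Psi>m\<close>, and the first coefficient is
  \<open>4 sin\<^sup>4 q\<close>; the remaining term is \<open>2 sin\<^sup>4 q F \<and> F\<close>. By \<open>su3_adapted_cone_rotated\<close> this is four
  times the dual of \<open>\<phi>\<close>.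
\<close>

theorem nearly_parallel_cone:
  fixes F :: "('a::euclidean_space, real) form"
  assumes s: "smooth_form 2 UNIV F" "smooth_form 3 UNIV \<Psi>p" "smooth_form 3 UNIV \<Psi>m"
    and nk: "nearly_kaehler M F \<Psi>p \<Psi>m" and dp: "eq_on M (ext_d \<Psi>p) 0"
    and sub: "\<And>p. p \<in> M \<Longrightarrow> subspace (tangent_space M p)"
  shows "nearly_parallel (M \<times> {0<..<pi}) (cyl_phi F \<Psi>p \<Psi>m)"
proof -
  let ?N = "M \<times> {0<..<pi}" and ?\<phi> = "cyl_phi F \<Psi>p \<Psi>m"
  let ?D = "d_last :: ('a \<times> real, real) form"
  have su3: "locally_coframe 6 M (su3_adapted M F \<Psi>p \<Psi>m)" and M: "submanifold 6 M"
    and dF: "eq_on M (ext_d F) (3 \<cdot> \<Psi>p)" and dm: "eq_on M (ext_d \<Psi>m) ((- 2) \<cdot> (F \<and>\<^sub>f F))"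
    using nk by (simp_all add: nearly_kaehler_def su3_structure_def)
  note pb = s[THEN smooth_form_pullback_fst_UNIV[where ?'b = real]]
  note hom = pb[THEN smooth_form_homogeneous[OF _ UNIV_I]]
  note d = pb[THEN smooth_form_differentiable]
  have e: "ext_d (pullback fst F :: ('a \<times> real, real) form) = pullback fst (ext_d F)"
    "ext_d (pullback fst \<Psi>p :: ('a \<times> real, real) form) = pullback fst (ext_d \<Psi>p)"
    "ext_d (pullback fst \<Psi>m :: ('a \<times> real, real) form) = pullback fst (ext_d \<Psi>m)"
    using s[THEN smooth_form_differentiable] by (simp_all add: ext_d_pullback_fst)
  note dw = differentiable_form_wedge[OF d(1) smooth_form_differentiable[OF smooth_form_d_last]]
  have E: "ext_d ?\<phi> p vs = 2 * sn p * cs p * (?D \<and>\<^sub>f pullback fst F \<and>\<^sub>f ?D) p vs +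
      (sn p)\<^sup>2 * (pullback fst (ext_d F) \<and>\<^sub>f ?D) p vs +
      ((3 * (sn p)\<^sup>2 * (cs p)\<^sup>2 - sn p ^ 4) * (?D \<and>\<^sub>f pullback fst \<Psi>p) p vs +
       sn p ^ 3 * cs p * pullback fst (ext_d \<Psi>p) p vs) -
      (4 * sn p ^ 3 * cs p * (?D \<and>\<^sub>f pullback fst \<Psi>m) p vs + sn p ^ 4 * pullback fst (ext_d \<Psi>m) p vs)" for p vs
    unfolding cyl_phi_expand
    by (simp add: ext_d_add ext_d_diff differentiable_form_add differentiable_form_radials
        ext_d_radial ext_d_wedge_d_last[OF d(1) hom(1)] e d dw)
  have star: "eq_at ?N (x, t) (ext_d ?\<phi>) (4 \<cdot> std_star_phi (cone_coframe 6 5 6 e))"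
    if x: "x \<in> M" "t \<in> {0<..<pi}" "\<forall>j\<in>{1..6}. homogeneous 1 (e j x)" "su3_adapted M F \<Psi>p \<Psi>m e x" for e x t
    unfolding eq_at_def
  proof (intro allI impI)
    fix vs assume vs: "set vs \<subseteq> tangent_space ?N (x, t)"
    let ?p = "(x, t)"
    have hD: "homogeneous 1 (?D ?p)" using smooth_form_homogeneous[OF smooth_form_d_last] by simp
    have pb: "eq_at ?N ?p (pullback fst \<alpha>) (pullback fst \<beta>)" if "eq_at M x \<alpha> \<beta>" for \<alpha> \<beta>
      using eq_at_pullback_fst[OF _ x(2) that] by simp
    note pbs = pullback_cscale pullback_wedge pullback_zero
    have a: "eq_at ?N ?p (pullback fst (ext_d F)) (3 \<cdot> pullback fst \<Psi>p)"
      "eq_at ?N ?p (pullback fst (ext_d \<Psi>m)) ((- 2) \<cdot> (pullback fst F \<and>\<^sub>f pullback fst F))"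
      "eq_at ?N ?p (pullback fst (ext_d \<Psi>p)) 0"
      using pb[of "ext_d F" "3 \<cdot> \<Psi>p"] pb[of "ext_d \<Psi>m" "(- 2) \<cdot> (F \<and>\<^sub>f F)"] pb[of "ext_d \<Psi>p" 0]
        dF dm dp x(1) by (simp_all add: eq_on_def pbs)
    note A = a[THEN eq_atD, OF vs] a(1)[THEN eq_at_wedge[OF _ eq_at_refl], THEN eq_atD, OF vs, of ?D]
      eq_atD[OF g2_adapted_cone(2)[OF x(4,3,2)] vs]
      wedge_D_D[of ?D ?p 2 "pullback fst F", OF hD hom(1)]
      wedge_D_3[of ?D ?p "pullback fst \<Psi>p", OF hD hom(2)] wedge_D_3[of ?D ?p "pullback fst \<Psi>m", OF hD hom(3)]
    have sc: "(sin t)\<^sup>2 + (cos t)\<^sup>2 = 1" by simp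
    show "ext_d ?\<phi> ?p vs = (4 \<cdot> std_star_phi (cone_coframe 6 5 6 e)) ?p vs"
      unfolding E by (simp add: A wedge_linear form_apply del: mult_cancel_left mult_cancel_right)
        (use sc in algebra)
  qed
  have "locally_coframe (Suc 6) ?N (\<lambda>e p. g2_adapted ?N ?\<phi> e p \<and> eq_at ?N p (ext_d ?\<phi>) (4 \<cdot> std_star_phi e))"
    by (rule locally_coframe_cone[where i = 5 and k = 6, OF su3 sub]) (auto intro!: star g2_adapted_cone(1))
  then have c: "locally_coframe 7 ?N (\<lambda>e p. g2_adapted ?N ?\<phi> e p \<and> eq_at ?N p (ext_d ?\<phi>) (4 \<cdot> std_star_phi e))"
    by simp
  moreover have "locally_coframe 7 ?N (g2_adapted ?N ?\<phi>)"
    using c by (rule locally_coframe_mono) simp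
  moreover have "submanifold 7 ?N" using submanifold_Times_open[OF M, of "{0<..<pi}"] by simp
  ultimately show ?thesis
    by (simp add: nearly_parallel_def g2_structure_def smooth_form_on smooth_form_cyl_phi[OF s])
qed

section \<open>The product of spheres as a manifold\<close>

lemma tangent_space_sphere:
  fixes p :: "'a::euclidean_space"
  assumes "p \<bullet> p = 1"
  shows "tangent_space {x. x \<bullet> x = 1} p = {v. p \<bullet> v = 0}"
proof (intro equalityI subsetI)
  fix v assume "v \<in> tangent_space {x. x \<bullet> x = 1} p"
  then obtain \<gamma> where \<gamma>: "\<gamma> 0 = p" "\<forall>\<^sub>F s in at 0. \<gamma> s \<bullet> \<gamma> s = 1" "(\<gamma> has_derivative (\<lambda>s. s *\<^sub>R v)) (at 0)"
    unfolding tangent_space_def has_vector_derivative_def by auto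
  have "((\<lambda>s. \<gamma> s \<bullet> \<gamma> s) has_derivative (\<lambda>s. p \<bullet> (s *\<^sub>R v) + (s *\<^sub>R v) \<bullet> p)) (at 0)"
    using has_derivative_inner[OF \<gamma>(3) \<gamma>(3)] \<gamma>(1) by simp
  moreover have "((\<lambda>s. \<gamma> s \<bullet> \<gamma> s) has_derivative (\<lambda>s. 0)) (at 0)"
    by (rule has_derivative_transform_eventually[OF has_derivative_const[of 1]])
      (use \<gamma>(1,2) assms in \<open>auto elim!: eventually_mono\<close>)
  ultimately have "(\<lambda>s. p \<bullet> (s *\<^sub>R v) + (s *\<^sub>R v) \<bullet> p) = (\<lambda>s::real. 0)"
    by (rule has_derivative_unique)
  from fun_cong[OF this, of 1] show "v \<in> {v. p \<bullet> v = 0}" by (simp add: inner_commute)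
next
  fix v assume v: "v \<in> {v. p \<bullet> v = 0}"
  \<comment> \<open>The curve is the straight line through \<open>p\<close> projected radially to the sphere.\<close>
  define \<gamma> where "\<gamma> s = inverse (sqrt (1 + s\<^sup>2 * (v \<bullet> v))) *\<^sub>R (p + s *\<^sub>R v)" for s
  have pos: "1 + s\<^sup>2 * (v \<bullet> v) > 0" for s by (simp add: add_pos_nonneg)
  have "(\<gamma> has_vector_derivative v) (at 0)"
    unfolding \<gamma>_def by (auto intro!: derivative_eq_intros simp: has_vector_derivative_def)
  moreover have "\<gamma> s \<bullet> \<gamma> s = 1" for s
  proof -
    have "(p + s *\<^sub>R v) \<bullet> (p + s *\<^sub>R v) = 1 + s\<^sup>2 * (v \<bullet> v)"
      using v assms by (simp add: inner_add inner_commute power2_eq_square)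
    moreover have "inverse (sqrt X) * (inverse (sqrt X) * X) = 1" if "X > 0" for X :: real
      using that by (simp add: divide_simps flip: mult.assoc)
    ultimately show ?thesis using pos[of s] by (simp add: \<gamma>_def)
  qed
  ultimately show "v \<in> tangent_space {x. x \<bullet> x = 1} p"
    unfolding tangent_space_def mem_Collect_eq by (intro exI[of _ \<gamma>]) (simp add: \<gamma>_def)
qed

lemma xc_simps:
  "xc 1 p = fst p $ 1" "xc (Suc 0) p = fst p $ 1" "xc 2 p = fst p $ 2" "xc 3 p = fst p $ 3"
  "xc 5 p = snd p $ 1" "xc 6 p = snd p $ 2" "xc 7 p = snd p $ 3" "xc 8 p = snd p $ 4"
  by (simp_all add: xc_def)

lemma S2xS3_eq: "S2xS3 = {x. x \<bullet> x = 1} \<times> {y. y \<bullet> y = 1}"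
  by (auto simp: S2xS3_def xc_simps inner_vec_def sum_3 sum_4 power2_eq_square)

lemma S2xS3_iff: "p \<in> S2xS3 \<longleftrightarrow> fst p \<bullet> fst p = 1 \<and> snd p \<bullet> snd p = 1"
  by (simp add: S2xS3_eq mem_Times_iff)

lemma tangent_space_S2xS3:
  assumes "p \<in> S2xS3"
  shows "tangent_space S2xS3 p = {v. fst p \<bullet> v = 0} \<times> {v. snd p \<bullet> v = 0}"
  using tangent_space_Times[of "{x. x \<bullet> x = 1}" "{y. y \<bullet> y = 1}" "fst p" "snd p"]
    tangent_space_sphere[of "fst p"] tangent_space_sphere[of "snd p"] assms
  by (simp add: S2xS3_eq mem_Times_iff)

lemma tangent_space_S2xS3_iff:
  "p \<in> S2xS3 \<Longrightarrow> v \<in> tangent_space S2xS3 p \<longleftrightarrow> fst p \<bullet> fst v = 0 \<and> snd p \<bullet> snd v = 0"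
  by (simp add: tangent_space_S2xS3 mem_Times_iff)

lemma subspace_tangent_space_S2xS3: "p \<in> S2xS3 \<Longrightarrow> subspace (tangent_space S2xS3 p)"
  by (simp add: tangent_space_S2xS3 subspace_Times subspace_hyperplane)

lemma dim_tangent_space_S2xS3: "p \<in> S2xS3 \<Longrightarrow> dim (tangent_space S2xS3 p) = 5"
proof -
  assume p: "p \<in> S2xS3"
  then have "fst p \<noteq> 0" "snd p \<noteq> 0" by (auto simp: S2xS3_iff)
  then show ?thesis
    by (simp add: tangent_space_S2xS3[OF p] dim_Times subspace_hyperplane dim_hyperplane)
qed

lemma bounded_linear_xc: "bounded_linear (xc i)"
proof (cases "i \<le> 3")
  case True
  then have "xc i = (\<lambda>p. fst p $ of_nat i)" by (simp add: fun_eq_iff xc_def)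
  then show ?thesis
    using bounded_linear_compose[OF bounded_linear_vec_nth bounded_linear_fst] by metis
next
  case False
  then have "xc i = (\<lambda>p. snd p $ of_nat (i - 4))" by (simp add: fun_eq_iff xc_def)
  then show ?thesis
    using bounded_linear_compose[OF bounded_linear_vec_nth bounded_linear_snd] by metis
qed

lemma smooth_on_xc: "open U \<Longrightarrow> smooth_on U (\<lambda>p. xc i p)"
  using smooth_on_linear[OF bounded_linear_xc] by simp

lemma submanifold_S2xS3: "submanifold 5 S2xS3"
  unfolding submanifold_def
proof (intro conjI ballI, goal_cases)
  have dim: "DIM(R3R4) - 5 = 2" by simp
  let ?f = "\<lambda>i::nat. \<lambda>p::R3R4. if i = 0 then fst p \<bullet> fst p - 1 else snd p \<bullet> snd p - 1"
  have d0: "frechet_derivative (?f 0) (at x) v = 2 * (fst x \<bullet> fst v)"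
    and d1: "frechet_derivative (?f 1) (at x) v = 2 * (snd x \<bullet> snd v)" for x v
    by (rule frechet_derivative_apply, auto intro!: derivative_eq_intros simp: inner_commute)+
  case (2 p) show ?case
    unfolding dim
  proof (intro exI[of _ UNIV] exI[of _ ?f] conjI allI impI ballI)
    have "?f 0 = (\<lambda>p. xc 1 p * xc 1 p + xc 2 p * xc 2 p + xc 3 p * xc 3 p - 1)"
      "?f 1 = (\<lambda>p. xc 5 p * xc 5 p + xc 6 p * xc 6 p + xc 7 p * xc 7 p + xc 8 p * xc 8 p - 1)"
      by (simp_all add: fun_eq_iff xc_simps inner_vec_def sum_3 sum_4)
    moreover have "smooth_on UNIV (\<lambda>p. xc 1 p * xc 1 p + xc 2 p * xc 2 p + xc 3 p * xc 3 p - 1)"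
      "smooth_on UNIV (\<lambda>p. xc 5 p * xc 5 p + xc 6 p * xc 6 p + xc 7 p * xc 7 p + xc 8 p * xc 8 p - 1)"
      by (intro smooth_intros smooth_on_xc open_UNIV)+
    ultimately have "smooth_on UNIV (?f 0)" "smooth_on UNIV (?f 1)" by (simp_all only:)
    moreover fix i :: nat assume "i < 2"
    then have "i = 0 \<or> i = 1" by auto
    ultimately show "smooth_on UNIV (?f i)" by blast
  next
    have "(\<forall>i<2. ?f i x = 0) \<longleftrightarrow> ?f 0 x = 0 \<and> ?f 1 x = 0" for x
      by (auto simp: less_2_cases_iff)
    then show "S2xS3 \<inter> UNIV = {x \<in> UNIV. \<forall>i<2. ?f i x = 0}"
      by (auto simp: S2xS3_iff)
  next
    fix x c and i :: nat
    assume x: "x \<in> S2xS3 \<inter> UNIV" and z: "\<forall>v. (\<Sum>i<2. c i * frechet_derivative (?f i) (at x) v) = 0" and i: "i < 2"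
    have "c 0 * (2 * (fst x \<bullet> fst v)) + c 1 * (2 * (snd x \<bullet> snd v)) = 0" for v
      using z[rule_format, of v] unfolding numeral_2_eq_2 sum.lessThan_Suc using d0[of x v] d1[of x v] by simp
    from this[of "(fst x, 0)"] this[of "(0, snd x)"] have "c 0 = 0" "c 1 = 0"
      using x by (auto simp: S2xS3_iff)
    then show "c i = 0" using i by (auto simp: less_2_cases_iff)
  qed simp_all
qed simp

section \<open>The Sasaki-Einstein structure on the product of spheres\<close>

unbundle cross3_syntax

subsection \<open>The forms in vector notation\<close>

text \<open>
  The three forms \<open>beta\<close> as one bilinear antisymmetric map with values in \<open>\<real>\<^sup>3\<close>. In terms of the
  position \<open>x\<close> on the two-sphere all forms of the structure are then scalar and triple products:
  \<open>alpha\<close> is \<open>- 2 x \<times> dx\<close>, \<open>eta\<close> is \<open>x \<bullet> beta / 3\<close>, and so on.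
\<close>

definition beta_vec :: "R3R4 \<Rightarrow> R3R4 \<Rightarrow> real^3" where
  "beta_vec p v = vector
    [2 * (xc 8 p * xc 5 v + xc 7 p * xc 6 v - xc 6 p * xc 7 v - xc 5 p * xc 8 v),
     2 * (xc 8 p * xc 6 v - xc 7 p * xc 5 v + xc 5 p * xc 7 v - xc 6 p * xc 8 v),
     2 * (xc 6 p * xc 5 v - xc 5 p * xc 6 v + xc 8 p * xc 7 v - xc 7 p * xc 8 v)]"

lemma bounded_bilinear_beta_vec: "bounded_bilinear beta_vec"
  unfolding bilinear_conv_bounded_bilinear[symmetric] bilinear_def
  by (auto intro!: linearI simp: beta_vec_def vec_eq_iff forall_3 xc_simps algebra_simps)

lemma beta_vec_antisym: "beta_vec v u = - beta_vec u v"
  by (simp add: beta_vec_def vec_eq_iff forall_3 algebra_simps)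

lemma beta_vec_self: "beta_vec v v = 0"
  by (simp add: beta_vec_def vec_eq_iff forall_3)

lemma bounded_bilinear_cross: "bounded_bilinear (\<lambda>u v :: real^3. u \<times> v)"
  using bilinear_cross bilinear_conv_bounded_bilinear by blast

lemmas cross_derivative = bounded_bilinear.FDERIV[OF bounded_bilinear_cross]
lemmas beta_vec_derivative = bounded_bilinear.FDERIV[OF bounded_bilinear_beta_vec]

lemma dx_eq: "dx i = one_form (\<lambda>p. xc i)"
  unfolding dx_def by (rule ext_d_zero_form_linear[OF bounded_linear_xc])

lemma smooth_form_dx: "smooth_form 1 UNIV (dx i)"
  unfolding dx_eq
  by (rule smooth_form_one_form) (simp_all add: smooth_on_const bounded_linear.linear[OF bounded_linear_xc])

lemma smooth_form_alpha: "smooth_form 1 UNIV (alpha j)"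
  and smooth_form_beta: "smooth_form 1 UNIV (beta j)"
  unfolding alpha_def beta_def
  by (auto simp del: One_nat_def
      intro!: smooth_form_intros open_UNIV smooth_on_xc[OF open_UNIV] smooth_form_dx)

lemma sum_1_3: "(\<Sum>j=1..3. h j) = h 1 + h 2 + h (3 :: nat)" for h :: "nat \<Rightarrow> 'b::comm_monoid_add"
  by (simp add: eval_nat_numeral)

lemma alpha_value:
  "alpha 1 p [v] = - 2 * (fst p \<times> fst v) $ 1" "alpha 2 p [v] = - 2 * (fst p \<times> fst v) $ 2"
  "alpha 3 p [v] = - 2 * (fst p \<times> fst v) $ 3"
  by (simp_all add: alpha_def dx_eq form_apply xc_simps cross_components algebra_simps)

lemma beta_value:
  "beta 1 p [v] = beta_vec p v $ 1" "beta 2 p [v] = beta_vec p v $ 2" "beta 3 p [v] = beta_vec p v $ 3"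
  by (simp_all add: beta_def dx_eq form_apply beta_vec_def algebra_simps)

lemma dx_value: "dx 1 p [v] = fst v $ 1" "dx 2 p [v] = fst v $ 2" "dx 3 p [v] = fst v $ 3"
  by (simp_all add: dx_eq xc_simps)

lemma smooth_form_eta: "smooth_form 1 UNIV eta"
  unfolding eta_def by (intro smooth_form_intros smooth_form_beta smooth_on_xc open_UNIV)

lemma eta_value: "eta p [v] = (1 / 3) * (fst p \<bullet> beta_vec p v)"
  unfolding eta_def sum_1_3
  by (simp add: form_apply beta_value xc_simps inner_vec_def sum_3 del: One_nat_def)

lemma wedge_1_1_smooth:
  "smooth_form 1 UNIV \<alpha> \<Longrightarrow> smooth_form 1 UNIV \<beta> \<Longrightarrow>
    (\<alpha> \<and>\<^sub>f \<beta>) p [u, v] = \<alpha> p [u] * \<beta> p [v] - \<alpha> p [v] * \<beta> p [u]"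
  by (rule wedge_1_1) (auto intro: smooth_form_homogeneous)

lemma smooth_form_omega1: "smooth_form 2 UNIV omega1"
  unfolding omega1_def
  by (intro smooth_form_intros smooth_form_wedge_UNIV[OF smooth_form_alpha smooth_form_beta] open_UNIV) simp

lemma smooth_form_omega2: "smooth_form 2 UNIV omega2"
  unfolding omega2_def vol_S2_def
  by (intro smooth_form_intros smooth_form_wedge_UNIV[OF smooth_form_dx smooth_form_beta]
      smooth_form_wedge_UNIV[OF smooth_form_dx smooth_form_dx] smooth_on_xc open_UNIV) simp_all

lemma omega1_value: "omega1 p [u, v] =
    - (1 / 6) * ((fst p \<times> fst u) \<bullet> beta_vec p v - (fst p \<times> fst v) \<bullet> beta_vec p u)"
proof -
  have "sqrt 3 / 2 * (sqrt 3 / 18) = 1 / 12" by simp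
  then show ?thesis
    unfolding omega1_def sum_1_3
    by (simp add: form_apply wedge_1_1_smooth[OF smooth_form_alpha smooth_form_beta] alpha_value beta_value
        inner_vec_def sum_3 algebra_simps del: One_nat_def)
qed

lemma omega2_value: "omega2 p [u, v] =
    - (1 / 3) * (fst p \<bullet> (fst u \<times> fst v)) + (1 / 6) * (fst u \<bullet> beta_vec p v - fst v \<bullet> beta_vec p u)"
proof -
  have s3: "sqrt 3 * (sqrt 3 * a) = 3 * a" for a :: real
    by (simp flip: mult.assoc)
  show ?thesis
    unfolding omega2_def vol_S2_def sum_1_3
    by (simp add: form_apply wedge_1_1_smooth[OF smooth_form_dx smooth_form_beta]
        wedge_1_1_smooth[OF smooth_form_dx smooth_form_dx] dx_value beta_value xc_simps
        inner_vec_def sum_3 cross_components s3 algebra_simps del: One_nat_def)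
qed

lemma coeff_derivative_eta:
  "coeff_derivative w eta p [v] = (1 / 3) * (fst w \<bullet> beta_vec p v + fst p \<bullet> beta_vec w v)"
  by (rule coeff_derivative_eqI, unfold eta_value)
    (auto intro!: derivative_eq_intros beta_vec_derivative
      simp: bounded_bilinear.zero_right[OF bounded_bilinear_beta_vec] fun_eq_iff)

lemma omega3_value: "omega3 p [u, v] =
    - (1 / 6) * (fst u \<bullet> beta_vec p v - fst v \<bullet> beta_vec p u + 2 * (fst p \<bullet> beta_vec u v))"
  by (simp add: omega3_def form_apply ext_d_1 coeff_derivative_eta beta_vec_antisym[of v u] algebra_simps)

lemma smooth_on_beta_vec: "smooth_on UNIV (\<lambda>p. beta_vec p v $ 1)" "smooth_on UNIV (\<lambda>p. beta_vec p v $ 2)"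
  "smooth_on UNIV (\<lambda>p. beta_vec p v $ 3)"
  by (simp_all add: beta_vec_def) (intro smooth_intros smooth_on_xc open_UNIV)+

lemma smooth_form_omega3: "smooth_form 2 UNIV omega3"
proof (rule smooth_formI)
  have hom: "homogeneous 2 (omega3 p)" for p
    using homogeneous_ext_d[of 1 eta p] smooth_form_homogeneous[OF smooth_form_eta]
    by (simp add: omega3_def homogeneous_def cscale_apply numeral_2_eq_2)
  have lin: "linear (\<lambda>u. omega3 p [u, v])" "linear (\<lambda>v. omega3 p [u, v])" for p u v
    unfolding omega3_value
    by (rule linearI; simp add: bounded_bilinear.add_left[OF bounded_bilinear_beta_vec]
        bounded_bilinear.add_right[OF bounded_bilinear_beta_vec]
        bounded_bilinear.scaleR_left[OF bounded_bilinear_beta_vec]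
        bounded_bilinear.scaleR_right[OF bounded_bilinear_beta_vec] inner_add algebra_simps)+
  show "alternating 2 (omega3 p)" for p
  proof -
    have z: "omega3 p vs = 0" if "length vs \<noteq> 2" for vs using homogeneousD[OF hom that] .
    have "linear (\<lambda>x. omega3 p (x # vs))" for vs
      using lin(1)[of p "hd vs"] z by (cases "length vs = 1") (auto simp: length_Suc_conv module_hom_zero)
    moreover have "linear (\<lambda>y. omega3 p (x # y # vs))" for x vs
      using lin(2)[of p x] z by (cases vs) (simp_all add: module_hom_zero)
    moreover have "omega3 p (x # x # vs) = 0" for x vs
      using z by (cases vs) (simp_all add: omega3_value beta_vec_self)
    ultimately show ?thesis using z by (simp add: numeral_2_eq_2)
  qed
  show "smooth_on UNIV (\<lambda>p. omega3 p vs)" for vs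
  proof (cases "length vs = 2")
    case True
    then obtain u v where vs: "vs = [u, v]" by (auto simp: numeral_2_eq_2 length_Suc_conv)
    have "(\<lambda>p. omega3 p vs) = (\<lambda>p. - (1 / 6) * (fst u $ 1 * beta_vec p v $ 1 + fst u $ 2 * beta_vec p v $ 2 +
        fst u $ 3 * beta_vec p v $ 3 - (fst v $ 1 * beta_vec p u $ 1 + fst v $ 2 * beta_vec p u $ 2 +
        fst v $ 3 * beta_vec p u $ 3) +
        2 * (xc 1 p * beta_vec u v $ 1 + xc 2 p * beta_vec u v $ 2 + xc 3 p * beta_vec u v $ 3)))"
      by (simp add: vs omega3_value inner_vec_def sum_3 xc_simps)
    moreover have "smooth_on UNIV \<dots>"
      by (intro smooth_intros smooth_on_xc smooth_on_beta_vec open_UNIV)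
    ultimately show ?thesis by simp
  next
    case False
    then have "(\<lambda>p. omega3 p vs) = (\<lambda>p. 0)" using homogeneousD[OF hom] by blast
    then show ?thesis by (simp add: smooth_on_const)
  qed
qed

subsection \<open>The structure equations\<close>

lemma coeff_derivative_omega1: "coeff_derivative w omega1 p [u, v] =
    - (1 / 6) * ((fst w \<times> fst u) \<bullet> beta_vec p v + (fst p \<times> fst u) \<bullet> beta_vec w v -
      ((fst w \<times> fst v) \<bullet> beta_vec p u + (fst p \<times> fst v) \<bullet> beta_vec w u))"
  by (rule coeff_derivative_eqI, unfold omega1_value)
    (auto intro!: derivative_eq_intros cross_derivative beta_vec_derivative
      simp: bounded_bilinear.zero_right[OF bounded_bilinear_beta_vec] fun_eq_iff)

lemma coeff_derivative_omega2: "coeff_derivative w omega2 p [u, v] =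
    - (1 / 3) * (fst w \<bullet> (fst u \<times> fst v)) + (1 / 6) * (fst u \<bullet> beta_vec w v - fst v \<bullet> beta_vec w u)"
  by (rule coeff_derivative_eqI, unfold omega2_value)
    (auto intro!: derivative_eq_intros beta_vec_derivative
      simp: bounded_bilinear.zero_right[OF bounded_bilinear_beta_vec] fun_eq_iff)

lemma coeff_derivative_omega3: "coeff_derivative w omega3 p [u, v] =
    - (1 / 6) * (fst u \<bullet> beta_vec w v - fst v \<bullet> beta_vec w u + 2 * (fst w \<bullet> beta_vec u v))"
  by (rule coeff_derivative_eqI, unfold omega3_value)
    (auto intro!: derivative_eq_intros beta_vec_derivative
      simp: bounded_bilinear.zero_right[OF bounded_bilinear_beta_vec] fun_eq_iff)

text \<open>
  This is the Maurer-Cartan equation \<open>d \<beta>\<^sub>i = - \<beta>\<^sub>j \<and> \<beta>\<^sub>k\<close> (\<open>i, j, k\<close> cyclic) of the three-sphere: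
  \<open>beta_vec\<close> being bilinear and antisymmetric, the value of \<open>d \<beta>\<close> on \<open>(u, v)\<close> is \<open>2 *\<^sub>R beta_vec u v\<close>.
\<close>

lemma beta_vec_cross:
  assumes "snd p \<bullet> snd p = 1" "snd p \<bullet> snd u = 0" "snd p \<bullet> snd v = 0"
  shows "2 *\<^sub>R beta_vec u v = - (beta_vec p u \<times> beta_vec p v)"
proof -
  have "beta_vec p u \<times> beta_vec p v + (2 * (snd p \<bullet> snd p)) *\<^sub>R beta_vec u v =
      (2 * (snd p \<bullet> snd u)) *\<^sub>R beta_vec p v - (2 * (snd p \<bullet> snd v)) *\<^sub>R beta_vec p u"
    by (simp add: vec_eq_iff forall_3 cross_components beta_vec_def xc_simps inner_vec_def sum_4 algebra_simps)
  then show ?thesis using assms by (simp add: eq_neg_iff_add_eq_0 add.commute)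
qed

text \<open>The plane tangent to the unit sphere has the position vector as its normal.\<close>

lemma cross_tangent:
  fixes x u v :: "real^3"
  assumes "x \<bullet> x = 1" "x \<bullet> u = 0" "x \<bullet> v = 0"
  shows "u \<times> v = (x \<bullet> (u \<times> v)) *\<^sub>R x"
proof -
  have "x \<times> (u \<times> v) = 0" using assms(2,3) by (simp add: Lagrange inner_commute)
  with Lagrange[of x x "u \<times> v"] show ?thesis using assms(1) by simp
qed

text \<open>
  On the tangent plane \<open>v\<close> is recovered from \<open>x \<times> v\<close> as \<open>(x \<times> v) \<times> x\<close>, which turns the triple
  product into a product of scalar products.
\<close>

lemma tangent_dot_cross:
  fixes x v a b :: "real^3"
  assumes "x \<bullet> x = 1" "x \<bullet> v = 0"
  shows "v \<bullet> (a \<times> b) = ((x \<times> v) \<bullet> a) * (x \<bullet> b) - ((x \<times> v) \<bullet> b) * (x \<bullet> a)"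
proof -
  have "(x \<times> v) \<times> x = v"
    using cross_skew[of "x \<times> v" x] assms by (simp add: Lagrange)
  then show ?thesis using dot_cross[of "x \<times> v" x a b] by simp
qed

text \<open>
  On tangent vectors the derivatives \<open>beta_vec u v\<close> become cross products by \<open>beta_vec_cross\<close>, and cross
  products of tangent vectors of the two-sphere become multiples of \<open>x\<close>. For \<open>omega1\<close> both sides are
  then equal by the expansion of a scalar product of two cross products; for \<open>omega2\<close> the volume term
  vanishes, as three tangent vectors of a surface are dependent, and \<open>tangent_dot_cross\<close> does the rest.
\<close>

theorem structure_equations:
  shows "eq_on S2xS3 (ext_d eta) ((- 2) \<cdot> omega3)"
    and "eq_on S2xS3 (ext_d omega1) (3 \<cdot> (eta \<and>\<^sub>f omega2))"
    and "eq_on S2xS3 (ext_d omega2) ((- 3) \<cdot> (eta \<and>\<^sub>f omega1))"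
    and "eq_on S2xS3 (ext_d omega3) 0"
proof -
  have h: "homogeneous 1 (eta p)" "homogeneous 2 (omega1 p)" "homogeneous 2 (omega2 p)" "homogeneous 2 (omega3 p)" for p
    using smooth_form_eta smooth_form_omega1 smooth_form_omega2 smooth_form_omega3
    by (auto intro: smooth_form_homogeneous)
  have hd: "homogeneous 3 (ext_d \<omega> p)" if "\<And>p. homogeneous 2 (\<omega> p)" for \<omega> :: "(R3R4, real) form" and p
    using homogeneous_ext_d[of 2 \<omega> p] that by simp
  have hw: "homogeneous 3 ((c \<cdot> (eta \<and>\<^sub>f \<omega>)) p)" if "\<And>p. homogeneous 2 (\<omega> p)" for \<omega> c p
    using homogeneous_wedge[of 1 eta p 2 \<omega>, OF h(1) that] by (simp add: homogeneous_def cscale_apply)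
  show "eq_on S2xS3 (ext_d eta) ((- 2) \<cdot> omega3)"
    by (simp add: eq_on_def eq_at_def omega3_def cscale_apply)
  have dim3: "\<exists>u v w. vs = [u, v, w] \<and> u \<in> tangent_space S2xS3 p \<and> v \<in> tangent_space S2xS3 p \<and> w \<in> tangent_space S2xS3 p"
    if "length vs = 3" "set vs \<subseteq> tangent_space S2xS3 p" for vs p
    using that by (auto simp: numeral_3_eq_3 length_Suc_conv)
  have D: "ext_d omega1 p [u, v, w] = (3 \<cdot> (eta \<and>\<^sub>f omega2)) p [u, v, w] \<and>
      ext_d omega2 p [u, v, w] = ((- 3) \<cdot> (eta \<and>\<^sub>f omega1)) p [u, v, w]"
    if p: "p \<in> S2xS3" and t: "u \<in> tangent_space S2xS3 p" "v \<in> tangent_space S2xS3 p" "w \<in> tangent_space S2xS3 p"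
    for p u v w
  proof -
    let ?X = "fst p" and ?B = "beta_vec p"
    have X: "?X \<bullet> ?X = 1" "snd p \<bullet> snd p = 1" using p by (simp_all add: S2xS3_iff)
    have T: "?X \<bullet> fst u = 0" "?X \<bullet> fst v = 0" "?X \<bullet> fst w = 0"
      "snd p \<bullet> snd u = 0" "snd p \<bullet> snd v = 0" "snd p \<bullet> snd w = 0"
      using t by (simp_all add: tangent_space_S2xS3_iff[OF p])
    have b: "z \<bullet> beta_vec a c = - (1 / 2) * (z \<bullet> (?B a \<times> ?B c))"
      if "snd p \<bullet> snd a = 0" "snd p \<bullet> snd c = 0" for z a c
      using arg_cong[OF beta_vec_cross[OF X(2) that], of "\<lambda>y. z \<bullet> y"] by simp
    have x: "(fst a \<times> fst c) \<bullet> z = (?X \<bullet> (fst a \<times> fst c)) * (?X \<bullet> z)"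
      if "?X \<bullet> fst a = 0" "?X \<bullet> fst c = 0" for z a c
      using arg_cong[OF cross_tangent[OF X(1) that], of "\<lambda>y. y \<bullet> z"] by simp
    have det: "fst w \<bullet> (fst u \<times> fst v) = 0" "fst v \<bullet> (fst u \<times> fst w) = 0" "fst u \<bullet> (fst v \<times> fst w) = 0"
      using x[OF T(1,2), of "fst w"] x[OF T(1,3), of "fst v"] x[OF T(2,3), of "fst u"] T
      by (simp_all add: inner_commute)
    have skew: "beta_vec v u = - beta_vec u v" "beta_vec w u = - beta_vec u w" "beta_vec w v = - beta_vec v w"
      "fst v \<times> fst u = - (fst u \<times> fst v)" "fst w \<times> fst u = - (fst u \<times> fst w)" "fst w \<times> fst v = - (fst v \<times> fst w)"
      using beta_vec_antisym cross_skew by blast+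
    have 1: "ext_d omega1 p [u, v, w] = (3 \<cdot> (eta \<and>\<^sub>f omega2)) p [u, v, w]"
      by (simp add: ext_d_2 coeff_derivative_omega1 cscale_apply wedge_1_2[of eta, OF h(1,3)] eta_value omega2_value
          skew b[OF T(4,5)] b[OF T(4,6)] b[OF T(5,6)] x[OF T(1,2)] x[OF T(1,3)] x[OF T(2,3)]
          dot_cross algebra_simps)
    have 2: "ext_d omega2 p [u, v, w] = ((- 3) \<cdot> (eta \<and>\<^sub>f omega1)) p [u, v, w]"
      by (simp add: ext_d_2 coeff_derivative_omega2 cscale_apply wedge_1_2[of eta, OF h(1,2)] eta_value omega1_value
          skew b[OF T(4,5)] b[OF T(4,6)] b[OF T(5,6)] det
          tangent_dot_cross[OF X(1) T(1)] tangent_dot_cross[OF X(1) T(2)] tangent_dot_cross[OF X(1) T(3)] T algebra_simps)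
    show ?thesis using 1 2 by blast
  qed
  show "eq_on S2xS3 (ext_d omega1) (3 \<cdot> (eta \<and>\<^sub>f omega2))"
    unfolding eq_on_def by (intro ballI eq_atI[OF hd[OF h(2)] hw[OF h(3)]]) (use D dim3 in blast)
  show "eq_on S2xS3 (ext_d omega2) ((- 3) \<cdot> (eta \<and>\<^sub>f omega1))"
    unfolding eq_on_def by (intro ballI eq_atI[OF hd[OF h(3)] hw[OF h(2)]]) (use D dim3 in blast)
  have d3: "ext_d omega3 p [u, v, w] = 0" for p u v w
    by (simp add: ext_d_2 coeff_derivative_omega3 beta_vec_antisym[of v u] beta_vec_antisym[of w u]
        beta_vec_antisym[of w v] algebra_simps)
  have "ext_d omega3 p vs = 0" if len: "length vs = 3" for p vs
  proof -
    obtain u v w where "vs = [u, v, w]" using len unfolding numeral_3_eq_3 length_Suc_conv length_0_conv by blast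
    then show ?thesis by (simp only: d3)
  qed
  moreover have "ext_d omega3 p vs = 0" if "length vs \<noteq> 3" for p vs
    using homogeneousD[OF hd[of omega3, OF h(4)] that] .
  ultimately have "ext_d omega3 p vs = 0" for p vs by blast
  then show "eq_on S2xS3 (ext_d omega3) 0" by (simp add: eq_on_def eq_at_def)
qed

subsection \<open>Local orthonormal frames of the two-sphere\<close>

text \<open>
  For \<open>\<epsilon> = 1\<close> and \<open>\<epsilon> = - 1\<close> the rotation taking the pole \<open>(0, 0, \<epsilon>)\<close> to \<open>x\<close> along a great circle is
  applied to the first axis and to \<open>\<epsilon>\<close> times the second one. The coefficients are rational in \<open>x\<close>, and
  the two choices cover the sphere; no frame exists on all of it.
\<close>

definition sphere_frame1 :: "real \<Rightarrow> real^3 \<Rightarrow> real^3" where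
  "sphere_frame1 \<epsilon> x = vector [1 - x$1 * x$1 / (1 + \<epsilon> * x$3), - (x$1 * x$2 / (1 + \<epsilon> * x$3)), - \<epsilon> * x$1]"

definition sphere_frame2 :: "real \<Rightarrow> real^3 \<Rightarrow> real^3" where
  "sphere_frame2 \<epsilon> x =
    vector [- \<epsilon> * (x$1 * x$2 / (1 + \<epsilon> * x$3)), \<epsilon> * (1 - x$2 * x$2 / (1 + \<epsilon> * x$3)), - x$2]"

lemma sphere_frame:
  assumes "x \<bullet> x = 1" "1 + \<epsilon> * x$3 \<noteq> 0" "\<epsilon> * \<epsilon> = 1"
  shows "sphere_frame1 \<epsilon> x \<bullet> sphere_frame1 \<epsilon> x = 1" "sphere_frame2 \<epsilon> x \<bullet> sphere_frame2 \<epsilon> x = 1"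
    "sphere_frame1 \<epsilon> x \<bullet> sphere_frame2 \<epsilon> x = 0" "sphere_frame1 \<epsilon> x \<times> sphere_frame2 \<epsilon> x = x"
proof -
  define r where "r = inverse (1 + \<epsilon> * x$3)"
  have r: "r * (1 + \<epsilon> * x$3) = 1" using assms(2) by (simp add: r_def)
  have x: "x$1 * x$1 + x$2 * x$2 + x$3 * x$3 = 1" using assms(1) by (simp add: inner_vec_def sum_3)
  note f = sphere_frame1_def sphere_frame2_def divide_inverse r_def[symmetric] inner_vec_def sum_3
    vec_eq_iff forall_3 cross_components
  show "sphere_frame1 \<epsilon> x \<bullet> sphere_frame1 \<epsilon> x = 1" "sphere_frame2 \<epsilon> x \<bullet> sphere_frame2 \<epsilon> x = 1"
    "sphere_frame1 \<epsilon> x \<bullet> sphere_frame2 \<epsilon> x = 0" "sphere_frame1 \<epsilon> x \<times> sphere_frame2 \<epsilon> x = x"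
    using r x assms(3) by (simp_all add: f) ((intro conjI)?; algebra)+
qed

text \<open>
  Components with respect to an oriented orthonormal basis. In these components the forms of the
  structure are polynomials in the values of one-forms.
\<close>

lemma orthonormal_expansion:
  fixes a b x :: "real^3"
  assumes "a \<bullet> a = 1" "b \<bullet> b = 1" "a \<bullet> b = 0" "a \<times> b = x"
  shows "x \<bullet> x = 1" "a \<bullet> x = 0" "b \<bullet> x = 0" "x \<times> a = b" "x \<times> b = - a"
    and "z \<bullet> z' = (a \<bullet> z) * (a \<bullet> z') + (b \<bullet> z) * (b \<bullet> z') + (x \<bullet> z) * (x \<bullet> z')"
    and "x \<bullet> (z \<times> z') = (a \<bullet> z) * (b \<bullet> z') - (a \<bullet> z') * (b \<bullet> z)"
proof -
  show x: "x \<bullet> x = 1" and ax: "a \<bullet> x = 0" and bx: "b \<bullet> x = 0"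
    using assms dot_cross[of a b a b] by (auto simp: dot_cross_self inner_commute)
  have xz: "x \<times> z = (a \<bullet> z) *\<^sub>R b - (b \<bullet> z) *\<^sub>R a" for z
    using Lagrange[of z a b] cross_skew[of x z] assms(4) by (simp add: inner_commute)
  show "x \<times> a = b" "x \<times> b = - a"
    using xz[of a] xz[of b] assms by (simp_all add: inner_commute)
  have "(x \<times> z) \<bullet> (x \<times> z') = z \<bullet> z' - (x \<bullet> z) * (x \<bullet> z')"
    using dot_cross[of x z x z'] x by (simp add: inner_commute)
  moreover have "(x \<times> z) \<bullet> (x \<times> z') = (a \<bullet> z) * (a \<bullet> z') + (b \<bullet> z) * (b \<bullet> z')"
    using assms(1-3) by (simp add: xz inner_diff inner_commute algebra_simps)
  ultimately show "z \<bullet> z' = (a \<bullet> z) * (a \<bullet> z') + (b \<bullet> z) * (b \<bullet> z') + (x \<bullet> z) * (x \<bullet> z')" by simp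
  show "x \<bullet> (z \<times> z') = (a \<bullet> z) * (b \<bullet> z') - (a \<bullet> z') * (b \<bullet> z)"
    using dot_cross[of a b z z'] assms(4) by (simp add: inner_commute)
qed

subsection \<open>The adapted coframe and the metric\<close>

text \<open>
  Write \<open>\<theta>\<^sub>a\<close>, \<open>\<theta>\<^sub>b\<close> and \<open>\<beta>\<^sub>a\<close>, \<open>\<beta>\<^sub>b\<close> for the components of \<open>dx\<close> and \<open>beta\<close>. The shifted forms
  \<open>A = \<beta>\<^sub>a - \<theta>\<^sub>b\<close> and \<open>B = \<beta>\<^sub>b + \<theta>\<^sub>a\<close> remove the terms that occur in only one of the two-forms:
  \<open>6 \<omega>\<^sub>1 = \<theta>\<^sub>b \<and> A - \<theta>\<^sub>a \<and> B\<close>, \<open>6 \<omega>\<^sub>2 = \<theta>\<^sub>a \<and> A + \<theta>\<^sub>b \<and> B\<close>, \<open>6 \<omega>\<^sub>3 = A \<and> B - \<theta>\<^sub>a \<and> \<theta>\<^sub>b\<close>.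
  So \<open>\<theta>\<^sub>a, - B, A, - \<theta>\<^sub>b\<close>, divided by \<open>\<surd>6\<close>, is adapted.
\<close>

definition se_coframe :: "real \<Rightarrow> nat \<Rightarrow> (R3R4, real) form" where
  "se_coframe \<epsilon> j = one_form (\<lambda>p v. let a = sphere_frame1 \<epsilon> (fst p); b = sphere_frame2 \<epsilon> (fst p) in
     if j = 1 then (a \<bullet> fst v) / sqrt 6
     else if j = 2 then - (b \<bullet> beta_vec p v + a \<bullet> fst v) / sqrt 6
     else if j = 3 then (a \<bullet> beta_vec p v - b \<bullet> fst v) / sqrt 6
     else if j = 4 then - (b \<bullet> fst v) / sqrt 6
     else (fst p \<bullet> beta_vec p v) / 3)"

text \<open>
  The sum of the squares of \<open>se_coframe\<close>, written without reference to the frame of the two-sphere: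
  the components of \<open>\<theta>\<close> are \<open>A\<close> and \<open>B\<close>.
\<close>

definition se_metric :: "R3R4 riem_metric" where
  "se_metric p u v = (let \<theta> = \<lambda>w. beta_vec p w - (fst p \<bullet> beta_vec p w) *\<^sub>R fst p + fst p \<times> fst w in
     (fst u \<bullet> fst v + \<theta> u \<bullet> \<theta> v) / 6 + (fst p \<bullet> beta_vec p u) * (fst p \<bullet> beta_vec p v) / 9)"

lemma smooth_form_se_coframe:
  assumes "open U" "\<And>p. p \<in> U \<Longrightarrow> 1 + \<epsilon> * xc 3 p \<noteq> 0"
  shows "smooth_form 1 U (se_coframe \<epsilon> j)"
  unfolding se_coframe_def
proof (rule smooth_form_one_form, goal_cases)
  note lin = bounded_bilinear.add_right[OF bounded_bilinear_beta_vec]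
    bounded_bilinear.scaleR_right[OF bounded_bilinear_beta_vec]
  { case 1 show ?case
    by (rule linearI) (simp_all add: Let_def lin inner_add inner_diff algebra_simps add_divide_distrib diff_divide_distrib) }
  have x: "smooth_on U (\<lambda>p. fst p $ 1)" "smooth_on U (\<lambda>p. fst p $ 2)" "smooth_on U (\<lambda>p. fst p $ 3)"
    using smooth_on_xc[OF assms(1), of 1] smooth_on_xc[OF assms(1), of 2] smooth_on_xc[OF assms(1), of 3]
    by (simp_all add: xc_simps)
  have nz: "1 + \<epsilon> * fst p $ 3 \<noteq> 0" if "p \<in> U" for p using assms(2)[OF that] by (simp add: xc_simps)
  have if_const: "smooth_on U f \<Longrightarrow> smooth_on U h \<Longrightarrow> smooth_on U (\<lambda>p. if c then f p else h p)"
    for f h :: "R3R4 \<Rightarrow> real" and c by (cases c) simp_all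
  note beta = smooth_on_beta_vec[THEN smooth_on_subset, OF subset_UNIV]
  have a: "smooth_on U (\<lambda>p. sphere_frame1 \<epsilon> (fst p) $ 1)" "smooth_on U (\<lambda>p. sphere_frame1 \<epsilon> (fst p) $ 2)"
    "smooth_on U (\<lambda>p. sphere_frame1 \<epsilon> (fst p) $ 3)" "smooth_on U (\<lambda>p. sphere_frame2 \<epsilon> (fst p) $ 1)"
    "smooth_on U (\<lambda>p. sphere_frame2 \<epsilon> (fst p) $ 2)" "smooth_on U (\<lambda>p. sphere_frame2 \<epsilon> (fst p) $ 3)"
    unfolding sphere_frame1_def sphere_frame2_def vector_3
    by (intro smooth_intros smooth_on_divide assms(1) x nz; assumption)+
  case 2 show ?case
    unfolding Let_def inner_vec_def sum_3 inner_real_def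
    by (intro if_const smooth_intros smooth_on_divide assms(1) x a beta; simp)
qed

lemma vector_4: "(vector [a, b, c, d] :: real^4) $ 1 = a" "(vector [a, b, c, d] :: real^4) $ 2 = b"
  "(vector [a, b, c, d] :: real^4) $ 3 = c" "(vector [a, b, c, d] :: real^4) $ 4 = d"
  unfolding vector_def by simp_all

text \<open>A vector tangent to the three-sphere on which the three forms \<open>beta\<close> take prescribed values.\<close>

definition dual_vec :: "R3R4 \<Rightarrow> real^3 \<Rightarrow> real^4" where
  "dual_vec p y = (1 / 2) *\<^sub>R vector
    [xc 8 p * y$1 - xc 7 p * y$2 + xc 6 p * y$3, xc 7 p * y$1 + xc 8 p * y$2 - xc 5 p * y$3,
     - xc 6 p * y$1 + xc 5 p * y$2 + xc 8 p * y$3, - xc 5 p * y$1 - xc 6 p * y$2 - xc 7 p * y$3]"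

lemma beta_vec_dual_vec: "beta_vec p (0, dual_vec p y) = (snd p \<bullet> snd p) *\<^sub>R y"
  by (simp add: beta_vec_def vec_eq_iff forall_3 dual_vec_def xc_simps vector_4 inner_vec_def sum_4 algebra_simps)

lemma inner_dual_vec: "snd p \<bullet> dual_vec p y = 0"
  by (simp add: dual_vec_def inner_vec_def sum_4 vector_4 xc_simps algebra_simps add_divide_distrib diff_divide_distrib)

lemma open_sphere_chart: "open {q. 1 + \<epsilon> * xc 3 q \<noteq> 0}"
  by (rule open_Collect_neq[OF continuous_on_add[OF continuous_on_const
      continuous_on_mult[OF continuous_on_const linear_continuous_on[OF bounded_linear_xc]]] continuous_on_const])

lemma eq_at_two:
  assumes "homogeneous 2 (\<alpha> p)" "homogeneous 2 (\<beta> p)"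
    and "\<And>u v. u \<in> tangent_space M p \<Longrightarrow> v \<in> tangent_space M p \<Longrightarrow> \<alpha> p [u, v] = \<beta> p [u, v]"
  shows "eq_at M p \<alpha> \<beta>"
proof (rule eq_atI, rule assms(1), rule assms(2))
  fix vs assume vs: "length vs = 2" "set vs \<subseteq> tangent_space M p"
  then obtain u v where "vs = [u, v]" by (metis numeral_2_eq_2 length_0_conv length_Suc_conv)
  then show "\<alpha> p vs = \<beta> p vs" using assms(3) vs(2) by simp
qed

lemma se_coframe_at:
  assumes p: "p \<in> S2xS3" and nz: "1 + \<epsilon> * xc 3 p \<noteq> 0" "\<epsilon> * \<epsilon> = 1"
  shows "coframe_at 5 S2xS3 (se_coframe \<epsilon>) p"
    and "su2_adapted S2xS3 eta omega1 omega2 omega3 (se_coframe \<epsilon>) p"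
    and "orthonormal_at 5 S2xS3 se_metric (se_coframe \<epsilon>) p"
proof -
  let ?e = "se_coframe \<epsilon>" and ?B = "beta_vec p"
  define a b x where "a = sphere_frame1 \<epsilon> (fst p)" and "b = sphere_frame2 \<epsilon> (fst p)" and "x = fst p"
  have X: "x \<bullet> x = 1" "snd p \<bullet> snd p = 1" using p by (simp_all add: S2xS3_iff x_def)
  have ab: "a \<bullet> a = 1" "b \<bullet> b = 1" "a \<bullet> b = 0" "a \<times> b = x"
    using sphere_frame[of x \<epsilon>] X(1) nz by (simp_all add: a_def b_def x_def xc_simps)
  note ex = orthonormal_expansion[OF ab]
  have e: "?e 1 p [v] = (a \<bullet> fst v) / sqrt 6" "?e 2 p [v] = - (b \<bullet> ?B v + a \<bullet> fst v) / sqrt 6"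
    "?e 3 p [v] = (a \<bullet> ?B v - b \<bullet> fst v) / sqrt 6" "?e 4 p [v] = - (b \<bullet> fst v) / sqrt 6"
    "?e 5 p [v] = (x \<bullet> ?B v) / 3" for v
    by (simp_all add: se_coframe_def Let_def a_def b_def x_def)
  have he: "homogeneous 1 (?e j p)" for j unfolding se_coframe_def by (rule homogeneous_one_form)
  have T: "v \<in> tangent_space S2xS3 p \<longleftrightarrow> x \<bullet> fst v = 0 \<and> snd p \<bullet> snd v = 0" for v
    using tangent_space_S2xS3_iff[OF p] by (simp add: x_def)
  have s6: "y / sqrt 6 * (z / sqrt 6) = y * z / 6" for y z by simp
  have hw: "homogeneous 2 ((?e i \<and>\<^sub>f ?e j + ?e k \<and>\<^sub>f ?e l) p)" for i j k l
    using homogeneous_wedge[of 1 "?e i" p 1 "?e j", OF he he] homogeneous_wedge[of 1 "?e k" p 1 "?e l", OF he he]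
    by (simp add: homogeneous_def numeral_2_eq_2)
  note w = wedge_1_1[of "?e i" p "?e j" for i j, OF he he]
  have vals: "omega1 p [u, v] = (?e 1 \<and>\<^sub>f ?e 2 + ?e 3 \<and>\<^sub>f ?e 4) p [u, v] \<and>
      omega2 p [u, v] = (?e 1 \<and>\<^sub>f ?e 3 + ?e 4 \<and>\<^sub>f ?e 2) p [u, v] \<and>
      omega3 p [u, v] = (?e 1 \<and>\<^sub>f ?e 4 + ?e 2 \<and>\<^sub>f ?e 3) p [u, v]"
    if "u \<in> tangent_space S2xS3 p" "v \<in> tangent_space S2xS3 p" for u v
  proof -
    have t: "x \<bullet> fst u = 0" "x \<bullet> fst v = 0" "snd p \<bullet> snd u = 0" "snd p \<bullet> snd v = 0" using that T by auto
    have b3: "2 * (x \<bullet> beta_vec u v) = - (x \<bullet> (?B u \<times> ?B v))"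
      using arg_cong[OF beta_vec_cross[OF X(2) t(3,4)], of "\<lambda>y. x \<bullet> y"] by simp
    have tr: "(x \<times> y) \<bullet> z = (a \<bullet> y) * (b \<bullet> z) - (a \<bullet> z) * (b \<bullet> y)" for y z
      using ex(7)[of y z] cross_triple[of x y z] by (simp add: inner_commute)
    have "omega1 p [u, v] = (?e 1 \<and>\<^sub>f ?e 2 + ?e 3 \<and>\<^sub>f ?e 4) p [u, v]"
      by (simp add: omega1_value x_def[symmetric] form_apply w e s6 tr field_simps del: One_nat_def)
    moreover have "omega2 p [u, v] = (?e 1 \<and>\<^sub>f ?e 3 + ?e 4 \<and>\<^sub>f ?e 2) p [u, v]"
      using ex(6)[of "fst u" "?B v"] ex(6)[of "fst v" "?B u"] ex(7)[of "fst u" "fst v"] t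
      by (simp add: omega2_value x_def[symmetric] form_apply w e s6 field_simps del: One_nat_def)
    moreover have "omega3 p [u, v] = (?e 1 \<and>\<^sub>f ?e 4 + ?e 2 \<and>\<^sub>f ?e 3) p [u, v]"
      using ex(6)[of "fst u" "?B v"] ex(6)[of "fst v" "?B u"] ex(7)[of "?B u" "?B v"] t b3
      by (simp add: omega3_value x_def[symmetric] form_apply w e s6 field_simps del: One_nat_def)
    ultimately show ?thesis by blast
  qed
  have h: "homogeneous 1 (eta p)" "homogeneous 2 (omega1 p)" "homogeneous 2 (omega2 p)" "homogeneous 2 (omega3 p)"
    using smooth_form_eta smooth_form_omega1 smooth_form_omega2 smooth_form_omega3
    by (auto intro: smooth_form_homogeneous)
  show "su2_adapted S2xS3 eta omega1 omega2 omega3 ?e p"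
    unfolding su2_adapted_def
  proof (intro conjI)
    show "eq_at S2xS3 p eta (?e 5)"
    proof (rule eq_atI, rule h(1), rule he)
      fix vs :: "R3R4 list" assume "length vs = 1"
      then obtain v where "vs = [v]" by (metis One_nat_def length_0_conv length_Suc_conv)
      then show "eta p vs = ?e 5 p vs" by (simp add: eta_value e x_def)
    qed
    show "eq_at S2xS3 p omega1 (?e 1 \<and>\<^sub>f ?e 2 + ?e 3 \<and>\<^sub>f ?e 4)"
      by (rule eq_at_two, rule h(2), rule hw) (use vals in simp)
    show "eq_at S2xS3 p omega2 (?e 1 \<and>\<^sub>f ?e 3 + ?e 4 \<and>\<^sub>f ?e 2)"
      by (rule eq_at_two, rule h(3), rule hw) (use vals in simp)
    show "eq_at S2xS3 p omega3 (?e 1 \<and>\<^sub>f ?e 4 + ?e 2 \<and>\<^sub>f ?e 3)"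
      by (rule eq_at_two, rule h(4), rule hw) (use vals in simp)
  qed
  have sum5: "(\<Sum>j=1..5. f j) = f 1 + f 2 + f 3 + f 4 + f 5" for f :: "nat \<Rightarrow> real"
    by (simp add: eval_nat_numeral)
  show "orthonormal_at 5 S2xS3 se_metric ?e p"
    unfolding orthonormal_at_def
  proof (intro ballI)
    fix u v assume "u \<in> tangent_space S2xS3 p" "v \<in> tangent_space S2xS3 p"
    then have t: "x \<bullet> fst u = 0" "x \<bullet> fst v = 0" using T by auto
    have "a \<bullet> (x \<times> y) = - (b \<bullet> y)" "b \<bullet> (x \<times> y) = a \<bullet> y" "x \<bullet> (x \<times> y) = 0" for y
    proof -
      have "a \<bullet> (x \<times> y) = (x \<times> y) \<bullet> a" "b \<bullet> (x \<times> y) = (x \<times> y) \<bullet> b" by (simp_all add: inner_commute)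
      then show "a \<bullet> (x \<times> y) = - (b \<bullet> y)" "b \<bullet> (x \<times> y) = a \<bullet> y"
        using cross_triple[of a x y] cross_triple[of b x y] cross_triple[of x y a] cross_triple[of x y b]
          cross_skew[of a x] cross_skew[of b x] ex(4,5) by (simp_all add: inner_commute)
      show "x \<bullet> (x \<times> y) = 0" by (rule dot_cross_self)
    qed
    note c = this
    show "se_metric p u v = (\<Sum>i=1..5. ?e i p [u] * ?e i p [v])"
      unfolding sum5 e s6 se_metric_def Let_def x_def[symmetric] ex(6)[of "fst u" "fst v"]
        ex(6)[of "?B u - (x \<bullet> ?B u) *\<^sub>R x + x \<times> fst u"]
      using ex(1-3) t by (simp add: inner_add inner_diff c inner_commute[of x a] inner_commute[of x b] field_simps)
  qed
  show "coframe_at 5 S2xS3 ?e p"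
    unfolding coframe_at_def
  proof (intro conjI ballI allI impI)
    show "form_at 1 p (?e j)" for j
      using smooth_form_se_coframe[OF open_sphere_chart, of \<epsilon> \<epsilon> j] nz(1)
      unfolding smooth_form_def by blast
    show "dim (tangent_space S2xS3 p) = 5" using dim_tangent_space_S2xS3[OF p] .
    fix c j assume z: "\<forall>v\<in>tangent_space S2xS3 p. (\<Sum>i=1..5. c i * ?e i p [v]) = 0" and j: "j \<in> {1..5::nat}"
    have Bw: "?B (0, dual_vec p y) = y" for y
      using beta_vec_dual_vec[of p y] X(2) by simp
    have B0: "?B (y, 0) = 0" for y
      by (simp add: beta_vec_def vec_eq_iff forall_3 xc_simps)
    have Tw: "(0, dual_vec p y) \<in> tangent_space S2xS3 p" for y by (simp add: T inner_dual_vec)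
    have Ta: "(a, 0) \<in> tangent_space S2xS3 p" "(b, 0) \<in> tangent_space S2xS3 p"
      using ex(2,3) by (simp_all add: T inner_commute)
    have "c 5 = 0" "c 3 = 0" "c 2 = 0"
      using z[rule_format, OF Tw[of x]] z[rule_format, OF Tw[of a]] z[rule_format, OF Tw[of b]] ab ex(1-3)
      unfolding sum5 e by (simp_all add: Bw inner_commute)
    moreover have "c 1 = 0" "c 4 = 0"
      using z[rule_format, OF Ta(1)] z[rule_format, OF Ta(2)] ab calculation
      unfolding sum5 e by (simp_all add: B0 inner_commute)
    moreover have "j = 1 \<or> j = 2 \<or> j = 3 \<or> j = 4 \<or> j = 5" using j by auto
    ultimately show "c j = 0" by blast
  qed
qed

theorem su2_metric_S2xS3: "su2_metric S2xS3 eta omega1 omega2 omega3 se_metric"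
  unfolding su2_metric_def locally_coframe_def
proof
  fix p assume p: "p \<in> S2xS3"
  have "\<exists>\<epsilon>. \<epsilon> * \<epsilon> = 1 \<and> 1 + \<epsilon> * xc 3 p \<noteq> 0"
    by (cases "1 + xc 3 p = 0") (auto intro: exI[of _ "-1"] exI[of _ 1])
  then obtain \<epsilon> where \<epsilon>: "\<epsilon> * \<epsilon> = 1" "1 + \<epsilon> * xc 3 p \<noteq> 0" by blast
  have o: "open {q. 1 + \<epsilon> * xc 3 q \<noteq> 0}" by (rule open_sphere_chart)
  show "\<exists>U e. open U \<and> p \<in> U \<and> (\<forall>i\<in>{1..5}. smooth_form 1 U (e i)) \<and>
      (\<forall>x\<in>S2xS3 \<inter> U. coframe_at 5 S2xS3 e x \<and>
        su2_adapted S2xS3 eta omega1 omega2 omega3 e x \<and> orthonormal_at 5 S2xS3 se_metric e x)"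
  proof (intro exI[of _ "{q. 1 + \<epsilon> * xc 3 q \<noteq> 0}"] exI[of _ "se_coframe \<epsilon>"] conjI)
    show "\<forall>i\<in>{1..5}. smooth_form 1 {q. 1 + \<epsilon> * xc 3 q \<noteq> 0} (se_coframe \<epsilon> i)"
      using smooth_form_se_coframe[OF o] by blast
    show "\<forall>x\<in>S2xS3 \<inter> {q. 1 + \<epsilon> * xc 3 q \<noteq> 0}. coframe_at 5 S2xS3 (se_coframe \<epsilon>) x \<and>
        su2_adapted S2xS3 eta omega1 omega2 omega3 (se_coframe \<epsilon>) x \<and> orthonormal_at 5 S2xS3 se_metric (se_coframe \<epsilon>) x"
      using se_coframe_at[OF _ _ \<epsilon>(1)] by blast
  qed (use o \<epsilon>(2) in auto)
qed

theorem sasaki_einstein_S2xS3: "sasaki_einstein S2xS3 eta omega1 omega2 omega3"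
proof -
  have "locally_coframe 5 S2xS3 (su2_adapted S2xS3 eta omega1 omega2 omega3)"
    by (rule locally_coframe_mono[OF su2_metric_S2xS3[unfolded su2_metric_def]]) simp
  then show ?thesis
    by (simp add: sasaki_einstein_def su2_structure_def submanifold_S2xS3 structure_equations smooth_form_on
        smooth_form_eta smooth_form_omega1 smooth_form_omega2 smooth_form_omega3 del: One_nat_def)
qed

unbundle no cross3_syntax

section \<open>The ends\<close>

subsection \<open>Degeneration\<close>

lemma std_F_value:
  assumes "\<forall>j\<in>{1..6}. homogeneous 1 (e j p)"
  shows "std_F e p [u, v] = e 1 p [u] * e 2 p [v] - e 1 p [v] * e 2 p [u] +
    (e 3 p [u] * e 4 p [v] - e 3 p [v] * e 4 p [u]) + (e 5 p [u] * e 6 p [v] - e 5 p [v] * e 6 p [u])"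
  using assms by (simp add: std_F_def wedge_1_1 del: One_nat_def)

lemma coframe_at_homogeneous: "coframe_at n M e p \<Longrightarrow> \<forall>j\<in>{1..n}. homogeneous 1 (e j p)"
  by (auto simp: coframe_at_def form_at_iff_alternating intro: alternating_homogeneous)

lemma coframe_at_independent:
  "coframe_at n M e p \<Longrightarrow> (\<And>v. v \<in> tangent_space M p \<Longrightarrow> (\<Sum>i=1..n. c i * e i p [v]) = 0) \<Longrightarrow>
    i \<in> {1..n} \<Longrightarrow> c i = 0"
  by (simp add: coframe_at_def)

lemma sum_1_6: "(\<Sum>j=1..6. h j) = h 1 + h 2 + h 3 + h 4 + h 5 + h (6 :: nat)"
  and sum_1_7: "(\<Sum>j=1..7. h j) = h 1 + h 2 + h 3 + h 4 + h 5 + h 6 + h (7 :: nat)"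
  for h :: "nat \<Rightarrow> 'b::comm_monoid_add"
  by (simp_all add: eval_nat_numeral)

text \<open>
  For a fixed \<open>u\<close> the linear form \<open>std_F e p [u, v]\<close> in \<open>v\<close> has the coefficients \<open>\<plusminus> e j p [u]\<close> with
  respect to the coframe. If it vanishes, all \<open>e j p [u]\<close> do, for every \<open>u\<close>, against independence.
\<close>

lemma std_F_nonzero:
  assumes e: "coframe_at n M e p" and n: "n = 6 \<or> n = 7"
    and z: "\<And>u v. u \<in> tangent_space M p \<Longrightarrow> v \<in> tangent_space M p \<Longrightarrow> std_F e p [u, v] = 0"
  shows False
proof -
  have h: "\<forall>j\<in>{1..6}. homogeneous 1 (e j p)" using coframe_at_homogeneous[OF e] n by auto
  have "e 1 p [u] = 0" if u: "u \<in> tangent_space M p" for u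
  proof -
    let ?c = "\<lambda>j::nat. if j = 1 then - e 2 p [u] else if j = 2 then e 1 p [u] else if j = 3 then - e 4 p [u]
      else if j = 4 then e 3 p [u] else if j = 5 then - e 6 p [u] else if j = 6 then e 5 p [u] else 0"
    have "(\<Sum>i=1..n. ?c i * e i p [v]) = std_F e p [u, v]" for v
      using n unfolding std_F_value[of e p, OF h] by (elim disjE) (simp_all only: sum_1_6 sum_1_7, simp_all)
    then have "?c 2 = 0" using z[OF u] n by (intro coframe_at_independent[OF e, of ?c 2]) auto
    then show ?thesis by simp
  qed
  then have "(\<Sum>i=1..n. (if i = 1 then 1 else 0) * e i p [v]) = 0" if "v \<in> tangent_space M p" for v
    using that n by (elim disjE) (simp_all only: sum_1_6 sum_1_7, simp_all)
  then have "(if (1::nat) = 1 then 1 else 0) = (0 :: real)"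
    using n by (intro coframe_at_independent[OF e, of "\<lambda>i. if i = 1 then 1 else 0" 1]) auto
  then show False by simp
qed

lemma std_phi_nonzero:
  assumes e: "coframe_at 7 M e p"
    and z: "\<And>u v w. u \<in> tangent_space M p \<Longrightarrow> v \<in> tangent_space M p \<Longrightarrow> w \<in> tangent_space M p \<Longrightarrow>
      std_phi e p [u, v, w] = 0"
  shows False
proof -
  have h7: "homogeneous 1 (e j p)" if "j \<in> {1..7}" for j using coframe_at_homogeneous[OF e] that by auto
  then have h: "\<forall>j\<in>{1..6}. homogeneous 1 (e j p)" by auto
  note H = h7[of 1] h7[of 2] h7[of 3] h7[of 4] h7[of 5] h7[of 6] h7[of 7]
  have h2: "homogeneous 2 ((e i \<and>\<^sub>f e j) p)" if "i \<in> {1..7}" "j \<in> {1..7}" for i j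
    using homogeneous_wedge[of 1 "e i" p 1 "e j", OF h7 h7] that by (simp add: numeral_2_eq_2)
  have hF: "homogeneous 2 (std_F e p)"
    using h2[of 1 2] h2[of 3 4] h2[of 5 6] by (simp add: std_F_def homogeneous_def)
  have hG: "homogeneous 2 ((e 3 \<and>\<^sub>f e 6 + e 4 \<and>\<^sub>f e 5) p)" "homogeneous 2 ((e 3 \<and>\<^sub>f e 5 - e 4 \<and>\<^sub>f e 6) p)"
    using h2[of 3 6] h2[of 4 5] h2[of 3 5] h2[of 4 6] by (simp_all add: homogeneous_def)
  have phi: "std_phi e p [u, v, w] =
      e 7 p [u] * std_F e p [v, w] - e 7 p [v] * std_F e p [u, w] + e 7 p [w] * std_F e p [u, v] -
      (e 1 p [u] * (e 3 \<and>\<^sub>f e 6 + e 4 \<and>\<^sub>f e 5) p [v, w] - e 1 p [v] * (e 3 \<and>\<^sub>f e 6 + e 4 \<and>\<^sub>f e 5) p [u, w] +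
       e 1 p [w] * (e 3 \<and>\<^sub>f e 6 + e 4 \<and>\<^sub>f e 5) p [u, v] +
       (e 2 p [u] * (e 3 \<and>\<^sub>f e 5 - e 4 \<and>\<^sub>f e 6) p [v, w] - e 2 p [v] * (e 3 \<and>\<^sub>f e 5 - e 4 \<and>\<^sub>f e 6) p [u, w] +
        e 2 p [w] * (e 3 \<and>\<^sub>f e 5 - e 4 \<and>\<^sub>f e 6) p [u, v]))" for u v w
    using wedge_D_2[of "e 7" p "std_F e" "[u, v, w]", OF H(7) hF] wedge_1_2[of "e 7" p "std_F e" u v w, OF H(7) hF]
      wedge_1_2[of "e 1" p "e 3 \<and>\<^sub>f e 6 + e 4 \<and>\<^sub>f e 5" u v w, OF H(1) hG(1)]
      wedge_1_2[of "e 2" p "e 3 \<and>\<^sub>f e 5 - e 4 \<and>\<^sub>f e 6" u v w, OF H(2) hG(2)]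
    unfolding std_phi_eq imag_Psi_def minus_apply plus_fun_apply by simp
  show False
  proof (rule std_F_nonzero[OF e])
    fix u v assume u: "u \<in> tangent_space M p" and v: "v \<in> tangent_space M p"
    let ?E = "\<lambda>j u. e j p [u]"
    \<comment> \<open>The coefficients of \<open>std_phi e p [u, v, w]\<close>, as a linear form in \<open>w\<close>, with respect to the coframe; the last one is \<open>std_F e p [u, v]\<close>.\<close>
    define f where "f j u = (if j = 1 then - ?E 2 u else if j = 2 then ?E 1 u else if j = 3 then - ?E 4 u
      else if j = 4 then ?E 3 u else if j = 5 then - ?E 6 u else if j = 6 then ?E 5 u else 0)" for j :: nat and u
    define g where "g j u = (if j = 3 then - ?E 6 u else if j = 6 then ?E 3 u else if j = 4 then - ?E 5 u
      else if j = 5 then ?E 4 u else 0)" for j :: nat and u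
    define k where "k j u = (if j = 3 then - ?E 5 u else if j = 5 then ?E 3 u else if j = 4 then ?E 6 u
      else if j = 6 then - ?E 4 u else 0)" for j :: nat and u
    define c where "c j = ?E 7 u * f j v - ?E 7 v * f j u - (?E 1 u * g j v - ?E 1 v * g j u + (?E 2 u * k j v - ?E 2 v * k j u))
      - (if j = 1 then (e 3 \<and>\<^sub>f e 6 + e 4 \<and>\<^sub>f e 5) p [u, v] else 0)
      - (if j = 2 then (e 3 \<and>\<^sub>f e 5 - e 4 \<and>\<^sub>f e 6) p [u, v] else 0)
      + (if j = 7 then std_F e p [u, v] else 0)" for j :: nat
    have "(\<Sum>i=1..7. c i * e i p [w]) = std_phi e p [u, v, w]" for w
      unfolding phi sum_1_7 by (simp add: c_def f_def g_def k_def std_F_value[of e p, OF h] wedge_1_1 H algebra_simps del: One_nat_def)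
    then have "c 7 = 0" using z[OF u v] by (intro coframe_at_independent[OF e, of c 7]) auto
    then show "std_F e p [u, v] = 0" by (simp add: c_def f_def g_def k_def)
  qed simp
qed

lemma cyl_forms_zero:
  assumes "sin t = 0"
  shows "cyl_F \<eta> \<omega>1 \<omega>3 (x, t) = 0" "cyl_Psi_plus \<eta> \<omega>1 \<omega>2 \<omega>3 (x, t) = 0" "cyl_Psi_minus \<eta> \<omega>1 \<omega>2 \<omega>3 (x, t) = 0"
    "cyl_phi F \<Psi>p \<Psi>m (y, t) = 0"
  by (simp_all add: cyl_F_expand cyl_Psi_plus_expand cyl_Psi_minus_expand cyl_phi_expand fun_eq_iff form_apply assms)

lemma cyl_phi_zero:
  assumes "F y = 0" "\<Psi>p y = 0" "\<Psi>m y = 0" shows "cyl_phi F \<Psi>p \<Psi>m (y, q) = 0"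
proof -
  have "pullback fst F (y, q) = 0" "pullback fst \<Psi>p (y, q) = 0" "pullback fst \<Psi>m (y, q) = 0"
    using assms by (simp_all add: fun_eq_iff pullback_fst)
  then show ?thesis
    by (simp add: cyl_phi_expand fun_eq_iff form_apply wedge_zero_left[of "pullback fst F"])
qed

lemma su3_degenerate_zero: "F p = 0 \<Longrightarrow> su3_degenerate_at M F \<Psi>p \<Psi>m p"
  unfolding su3_degenerate_at_def su3_adapted_def
  by (auto simp: eq_at_def dest!: std_F_nonzero[of 6 M _ p])

lemma g2_degenerate_zero: "\<phi> p = 0 \<Longrightarrow> g2_degenerate_at M \<phi> p"
  unfolding g2_degenerate_at_def g2_adapted_def
  by (auto simp: eq_at_def dest!: std_phi_nonzero[of M _ p])

subsection \<open>Leading order of the metrics\<close>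

lemma orthonormal_at_nonneg:
  "orthonormal_at n M g e p \<Longrightarrow> v \<in> tangent_space M p \<Longrightarrow> g p v v \<ge> 0"
  by (simp add: orthonormal_at_def sum_nonneg)

lemma su2_metric_nonneg:
  "su2_metric M \<eta> \<omega>1 \<omega>2 \<omega>3 g \<Longrightarrow> p \<in> M \<Longrightarrow> v \<in> tangent_space M p \<Longrightarrow> g p v v \<ge> 0"
  unfolding su2_metric_def by (erule locally_coframe_obtain) (auto intro: orthonormal_at_nonneg)

lemma sine_cone_nonneg:
  assumes "\<And>p v. p \<in> M \<Longrightarrow> v \<in> tangent_space M p \<Longrightarrow> g p v v \<ge> 0"
    and "p \<in> M \<times> {0<..<pi}" "v \<in> tangent_space (M \<times> {0<..<pi}) p"
  shows "sine_cone g p v v \<ge> 0"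
proof -
  obtain x t u \<tau> where p: "p = (x, t)" "v = (u, \<tau>)" by (cases p, cases v) auto
  then have "g x u u \<ge> 0" using assms by (simp add: tangent_space_Times_open)
  then show ?thesis by (simp add: p sine_cone_def)
qed

lemma sin_squared_near_0:
  fixes \<epsilon> :: real
  assumes "\<epsilon> > 0"
  obtains \<delta> where "\<delta> > 0" "\<And>r. 0 < r \<Longrightarrow> r < \<delta> \<Longrightarrow> \<bar>(sin r)\<^sup>2 - r\<^sup>2\<bar> \<le> \<epsilon> * r\<^sup>2"
proof -
  have "((\<lambda>r::real. sin r / r) \<longlongrightarrow> 1) (at 0)"
    using DERIV_sin[of 0] by (simp add: has_field_derivative_iff)
  then have "((\<lambda>r::real. (sin r / r)\<^sup>2) \<longlongrightarrow> 1\<^sup>2) (at 0)" by (rule tendsto_power)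
  then have "\<forall>\<^sub>F r::real in at 0. dist ((sin r / r)\<^sup>2) (1\<^sup>2) < \<epsilon>"
    using assms by (rule tendstoD)
  then obtain \<delta> where \<delta>: "\<delta> > 0" "\<And>r::real. r \<noteq> 0 \<Longrightarrow> \<bar>r\<bar> < \<delta> \<Longrightarrow> \<bar>(sin r / r)\<^sup>2 - 1\<bar> < \<epsilon>"
    unfolding eventually_at by (auto simp: dist_real_def)
  have "\<bar>(sin r)\<^sup>2 - r\<^sup>2\<bar> \<le> \<epsilon> * r\<^sup>2" if "0 < r" "r < \<delta>" for r
  proof -
    have "(sin r)\<^sup>2 - r\<^sup>2 = ((sin r / r)\<^sup>2 - 1) * r\<^sup>2" using that by (simp add: field_simps)
    then show ?thesis using \<delta>(2)[of r] that by (simp add: abs_mult)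
  qed
  then show thesis using that \<delta>(1) by blast
qed

text \<open>The distance to either end is an affine function of \<open>t\<close> on the interval, and the sine is the same at both.\<close>

lemma end_parameter:
  assumes "t0 \<in> {0, pi}"
  obtains \<sigma> :: real where "\<sigma> * \<sigma> = 1" "\<And>t. t \<in> {0<..<pi} \<Longrightarrow> \<bar>t - t0\<bar> = \<sigma> * (t - t0)"
    "\<And>t. t \<in> {0<..<pi} \<Longrightarrow> sin t = sin \<bar>t - t0\<bar>" "\<And>t. t \<in> {0<..<pi} \<Longrightarrow> \<bar>t - t0\<bar> > 0" "sin t0 = 0"
  using assms that[of 1] that[of "-1"] by auto

text \<open>
  The two metrics differ only in the coefficients \<open>sin\<^sup>2 t\<close> and \<open>r\<^sup>2\<close> of \<open>g\<close>, where \<open>r\<close> is the distance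
  of \<open>t\<close> to the end and \<open>sin t = sin r\<close>.
\<close>

lemma leading_order_sine_cone:
  fixes N :: "'a::euclidean_space set"
  assumes g: "\<And>p v. p \<in> N \<Longrightarrow> v \<in> tangent_space N p \<Longrightarrow> g p v v \<ge> 0" and t0: "t0 \<in> {0, pi}"
  shows "leading_order (N \<times> {0<..<pi}) (\<lambda>(x, t). \<bar>t - t0\<bar>) (sine_cone g) (cone_form (\<lambda>(x, t). \<bar>t - t0\<bar>) fst g)"
  unfolding leading_order_def
proof (intro allI impI, goal_cases)
  case (1 \<epsilon>)
  then obtain \<delta> where \<delta>: "\<delta> > 0" "\<And>r. 0 < r \<Longrightarrow> r < \<delta> \<Longrightarrow> \<bar>(sin r)\<^sup>2 - r\<^sup>2\<bar> \<le> \<epsilon> * r\<^sup>2"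
    using sin_squared_near_0 by blast
  obtain \<sigma> :: real where \<sigma>: "\<sigma> * \<sigma> = 1" "\<And>t. t \<in> {0<..<pi} \<Longrightarrow> \<bar>t - t0\<bar> = \<sigma> * (t - t0)"
    "\<And>t. t \<in> {0<..<pi} \<Longrightarrow> sin t = sin \<bar>t - t0\<bar>" "\<And>t. t \<in> {0<..<pi} \<Longrightarrow> \<bar>t - t0\<bar> > 0"
    using end_parameter[OF t0] by metis
  show ?case
  proof (intro exI[of _ \<delta>] conjI \<delta>(1) ballI impI)
    fix p v assume p: "p \<in> N \<times> {0<..<pi}" and r: "(case p of (x, t) \<Rightarrow> \<bar>t - t0\<bar>) < \<delta>"
      and v: "v \<in> tangent_space (N \<times> {0<..<pi}) p"
    obtain x t u \<tau> where xt: "p = (x, t)" "v = (u, \<tau>)" by (cases p, cases v) auto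
    have xN: "x \<in> N" and t: "t \<in> {0<..<pi}" and u: "u \<in> tangent_space N x"
      using p v by (simp_all add: xt tangent_space_Times_open)
    have "((\<lambda>(x::'a, t). \<bar>t - t0\<bar>) has_derivative (\<lambda>w. \<sigma> * snd w)) (at (x, t))"
    proof (rule has_derivative_transform_within_open[where s = "UNIV \<times> {0<..<pi}"])
      show "((\<lambda>p. \<sigma> * (snd p - t0)) has_derivative (\<lambda>w. \<sigma> * snd w)) (at (x, t))"
        by (auto intro!: derivative_eq_intros)
    qed (use t \<sigma>(2) in \<open>auto simp: open_Times\<close>)
    then have "frechet_derivative (\<lambda>(x::'a, t). \<bar>t - t0\<bar>) (at (x, t)) (u, \<tau>) = \<sigma> * \<tau>"
      by (simp add: frechet_derivative_apply)
    moreover have "\<sigma> * \<tau> * (\<sigma> * \<tau>) = \<tau> * \<tau>" using \<sigma>(1) by algebra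
    ultimately have h0: "cone_form (\<lambda>(x, t). \<bar>t - t0\<bar>) fst g p v v = \<tau> * \<tau> + \<bar>t - t0\<bar>\<^sup>2 * g x u u"
      by (simp add: cone_form_def xt)
    have h: "sine_cone g p v v = \<tau> * \<tau> + (sin \<bar>t - t0\<bar>)\<^sup>2 * g x u u"
      using \<sigma>(3)[OF t] by (simp add: sine_cone_def xt)
    have gn: "g x u u \<ge> 0" using g[OF xN u] .
    have "\<bar>(sin \<bar>t - t0\<bar>)\<^sup>2 - \<bar>t - t0\<bar>\<^sup>2\<bar> * g x u u \<le> \<epsilon> * \<bar>t - t0\<bar>\<^sup>2 * g x u u"
      using \<delta>(2)[OF \<sigma>(4)[OF t]] r gn by (intro mult_right_mono) (simp_all add: xt)
    moreover have "\<epsilon> * (\<tau> * \<tau>) \<ge> 0" using 1 by simp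
    moreover have "\<bar>(sin \<bar>t - t0\<bar>)\<^sup>2 * g x u u - \<bar>t - t0\<bar>\<^sup>2 * g x u u\<bar> = \<bar>(sin \<bar>t - t0\<bar>)\<^sup>2 - \<bar>t - t0\<bar>\<^sup>2\<bar> * g x u u"
      using gn by (simp add: abs_mult flip: left_diff_distrib)
    ultimately show "\<bar>sine_cone g p v v - cone_form (\<lambda>(x, t). \<bar>t - t0\<bar>) fst g p v v\<bar>
        \<le> \<epsilon> * cone_form (\<lambda>(x, t). \<bar>t - t0\<bar>) fst g p v v"
      unfolding h h0 by (simp add: algebra_simps)
  qed
qed

text \<open>
  Let \<open>r\<close> be the distance of \<open>t\<close> to the end. As \<open>ds = cos q r dq \<plusminus> sin q dt\<close>, the metric has
  \<open>(ds - cos q r dq)\<^sup>2\<close> where the cone form has \<open>ds\<^sup>2\<close>; the difference is bounded by \<open>2 r (dq\<^sup>2 + ds\<^sup>2)\<close>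
  for \<open>r \<le> 1\<close>, hence small uniformly in \<open>q\<close>.
\<close>

lemma leading_order_double_sine_cone:
  fixes M :: "'a::euclidean_space set"
  assumes g: "\<And>p v. p \<in> M \<Longrightarrow> v \<in> tangent_space M p \<Longrightarrow> g p v v \<ge> 0" and t0: "t0 \<in> {0, pi}"
  defines "s \<equiv> \<lambda>((x::'a, t), q). sin q * \<bar>t - t0\<bar>"
  shows "leading_order ((M \<times> {0<..<pi}) \<times> {0<..<pi}) (\<lambda>((x, t), q). \<bar>t - t0\<bar>) (sine_cone (sine_cone g))
    (\<lambda>p u v. snd u * snd v + cone_form s (fst \<circ> fst) g p u v)"
  unfolding leading_order_def
proof (intro allI impI, goal_cases)
  case (1 \<epsilon>)
  then obtain \<delta> where \<delta>: "\<delta> > 0" "\<And>r. 0 < r \<Longrightarrow> r < \<delta> \<Longrightarrow> \<bar>(sin r)\<^sup>2 - r\<^sup>2\<bar> \<le> \<epsilon> * r\<^sup>2"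
    using sin_squared_near_0 by blast
  obtain \<sigma> :: real where \<sigma>: "\<sigma> * \<sigma> = 1" "\<And>t. t \<in> {0<..<pi} \<Longrightarrow> \<bar>t - t0\<bar> = \<sigma> * (t - t0)"
    "\<And>t. t \<in> {0<..<pi} \<Longrightarrow> sin t = sin \<bar>t - t0\<bar>" "\<And>t. t \<in> {0<..<pi} \<Longrightarrow> \<bar>t - t0\<bar> > 0"
    using end_parameter[OF t0] by metis
  let ?h0 = "\<lambda>p v. snd v * snd v + cone_form s (fst \<circ> fst) g p v v"
  show ?case
  proof (intro exI[of _ "min \<delta> (min (\<epsilon> / 2) 1)"] conjI ballI impI)
    show "min \<delta> (min (\<epsilon> / 2) 1) > 0" using \<delta>(1) 1 by simp
    fix p v assume p: "p \<in> (M \<times> {0<..<pi}) \<times> {0<..<pi}"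
      and r: "(case p of (xa, q) \<Rightarrow> (case xa of (x, t) \<Rightarrow> \<lambda>q. \<bar>t - t0\<bar>) q) < min \<delta> (min (\<epsilon> / 2) 1)"
      and v: "v \<in> tangent_space ((M \<times> {0<..<pi}) \<times> {0<..<pi}) p"
    obtain x t q u \<tau> \<kappa> where xt: "p = ((x, t), q)" "v = ((u, \<tau>), \<kappa>)" by (metis surj_pair)
    have xM: "x \<in> M" and t: "t \<in> {0<..<pi}" and u: "u \<in> tangent_space M x"
      using p v by (simp_all add: xt tangent_space_Times_open)
    \<comment> \<open>The distance to the end and the value of \<open>ds\<close> on \<open>v\<close>.\<close>
    define \<rho> where "\<rho> = \<bar>t - t0\<bar>"
    define A where "A = cos q * \<kappa> * \<rho> + sin q * (\<sigma> * \<tau>)"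
    have \<rho>: "\<rho> > 0" "\<rho> < \<delta>" "2 * \<rho> \<le> \<epsilon>" "\<rho> \<le> 1" using \<sigma>(4)[OF t] r by (simp_all add: xt \<rho>_def)
    have "(s has_derivative (\<lambda>w. cos q * snd w * \<rho> + sin q * (\<sigma> * snd (fst w)))) (at ((x, t), q))"
    proof (rule has_derivative_transform_within_open[where s = "(UNIV \<times> {0<..<pi}) \<times> UNIV"])
      show "((\<lambda>p. sin (snd p) * (\<sigma> * (snd (fst p) - t0))) has_derivative
          (\<lambda>w. cos q * snd w * \<rho> + sin q * (\<sigma> * snd (fst w)))) (at ((x, t), q))"
        using \<sigma>(2)[OF t] by (auto intro!: derivative_eq_intros simp: \<rho>_def fun_eq_iff algebra_simps) algebra
    qed (use t \<sigma>(2) in \<open>auto simp: open_Times s_def\<close>)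
    then have "frechet_derivative s (at ((x, t), q)) ((u, \<tau>), \<kappa>) = A"
      by (simp add: frechet_derivative_apply A_def)
    then have h0: "?h0 p v = \<kappa> * \<kappa> + A * A + (sin q)\<^sup>2 * (\<rho>\<^sup>2 * g x u u)"
      by (simp add: cone_form_def xt s_def \<rho>_def power_mult_distrib)
    have "(sin q * (\<sigma> * \<tau>))\<^sup>2 = (sin q)\<^sup>2 * (\<tau> * \<tau>)" using \<sigma>(1) by algebra
    then have "(sin q)\<^sup>2 * (\<tau> * \<tau>) = (A - cos q * \<kappa> * \<rho>)\<^sup>2" by (simp add: A_def)
    then have h: "sine_cone (sine_cone g) p v v =
        \<kappa> * \<kappa> + (A - cos q * \<kappa> * \<rho>)\<^sup>2 + (sin q)\<^sup>2 * ((sin \<rho>)\<^sup>2 * g x u u)"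
      using \<sigma>(3)[OF t] by (simp add: sine_cone_def xt \<rho>_def distrib_left)
    define G where "G = g x u u"
    have gn: "G \<ge> 0" using g[OF xM u] by (simp add: G_def)
    have d1: "\<bar>(sin q)\<^sup>2 * ((sin \<rho>)\<^sup>2 * G) - (sin q)\<^sup>2 * (\<rho>\<^sup>2 * G)\<bar> \<le> \<epsilon> * ((sin q)\<^sup>2 * (\<rho>\<^sup>2 * G))"
    proof -
      have "(sin q)\<^sup>2 * ((sin \<rho>)\<^sup>2 * G) - (sin q)\<^sup>2 * (\<rho>\<^sup>2 * G) = ((sin \<rho>)\<^sup>2 - \<rho>\<^sup>2) * ((sin q)\<^sup>2 * G)"
        by (simp add: algebra_simps)
      then have "\<bar>(sin q)\<^sup>2 * ((sin \<rho>)\<^sup>2 * G) - (sin q)\<^sup>2 * (\<rho>\<^sup>2 * G)\<bar> = \<bar>(sin \<rho>)\<^sup>2 - \<rho>\<^sup>2\<bar> * ((sin q)\<^sup>2 * G)"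
        using gn by (simp add: abs_mult)
      also have "\<dots> \<le> (\<epsilon> * \<rho>\<^sup>2) * ((sin q)\<^sup>2 * G)"
        using \<delta>(2)[OF \<rho>(1,2)] gn by (intro mult_right_mono) simp_all
      finally show ?thesis by (simp add: mult_ac)
    qed
    have d2: "\<bar>(A - cos q * \<kappa> * \<rho>)\<^sup>2 - A * A\<bar> \<le> \<epsilon> * (\<kappa> * \<kappa> + A * A)"
    proof -
      define c where "c = cos q * \<kappa>"
      have c: "c\<^sup>2 \<le> \<kappa>\<^sup>2" by (simp add: c_def power_mult_distrib abs_square_le_1 mult_left_le_one_le)
      have "(A - cos q * \<kappa> * \<rho>)\<^sup>2 - A * A = \<rho> * (\<rho> * c\<^sup>2 - 2 * (A * c))"
        by (simp add: c_def power2_eq_square algebra_simps)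
      then have "\<bar>(A - cos q * \<kappa> * \<rho>)\<^sup>2 - A * A\<bar> = \<rho> * \<bar>\<rho> * c\<^sup>2 - 2 * (A * c)\<bar>"
        using \<rho>(1) by (simp add: abs_mult)
      also have "\<dots> \<le> \<rho> * (2 * (\<kappa>\<^sup>2 + A\<^sup>2))"
      proof (rule mult_left_mono)
        have mean: "y \<le> 2 * k + 2 * e" if "y \<le> a + b" "a \<le> d" "b \<le> e + d" "d \<le> k" "0 \<le> e"
          for y a b d e k :: real
          using that by linarith
        show "\<bar>\<rho> * c\<^sup>2 - 2 * (A * c)\<bar> \<le> 2 * (\<kappa>\<^sup>2 + A\<^sup>2)"
          unfolding distrib_left
        proof (rule mean)
          show "\<bar>\<rho> * c\<^sup>2 - 2 * (A * c)\<bar> \<le> \<rho> * c\<^sup>2 + 2 * \<bar>A * c\<bar>"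
            using abs_triangle_ineq4[of "\<rho> * c\<^sup>2" "2 * (A * c)"] \<rho>(1) by (simp add: abs_mult)
          show "\<rho> * c\<^sup>2 \<le> c\<^sup>2" using \<rho>(1,4) by (simp add: mult_left_le_one_le)
          show "2 * \<bar>A * c\<bar> \<le> A\<^sup>2 + c\<^sup>2"
            using sum_squares_bound[of "\<bar>A\<bar>" "\<bar>c\<bar>"] by (simp add: abs_mult)
        qed (use c in simp_all)
      qed (use \<rho>(1) in simp)
      also have "\<dots> = (2 * \<rho>) * (\<kappa>\<^sup>2 + A\<^sup>2)" by simp
      also have "\<dots> \<le> \<epsilon> * (\<kappa>\<^sup>2 + A\<^sup>2)" using \<rho>(3) by (intro mult_right_mono) simp_all
      finally show ?thesis by (simp add: power2_eq_square)
    qed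
    show "\<bar>sine_cone (sine_cone g) p v v - ?h0 p v\<bar> \<le> \<epsilon> * ?h0 p v"
      unfolding h h0 G_def[symmetric] using d1 d2 by (simp add: distrib_left)
  qed
qed

theorem theorem6p4:
  shows "sasaki_einstein S2xS3 eta omega1 omega2 omega3 \<and>
    (\<exists>g. su2_metric S2xS3 eta omega1 omega2 omega3 g) \<and>
    (\<forall>g. su2_metric S2xS3 eta omega1 omega2 omega3 g \<longrightarrow>
      (nearly_kaehler (S2xS3 \<times> {0<..<pi}) F6 Psi_plus6 Psi_minus6 \<and>
       su3_metric (S2xS3 \<times> {0<..<pi}) F6 Psi_plus6 Psi_minus6 (sine_cone g) \<and>
       (\<forall>t0\<in>{0, pi}. conical_end_6 S2xS3 F6 Psi_plus6 Psi_minus6 (sine_cone g) g t0)) \<and>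
      (nearly_parallel ((S2xS3 \<times> {0<..<pi}) \<times> {0<..<pi}) phi7 \<and>
       g2_metric ((S2xS3 \<times> {0<..<pi}) \<times> {0<..<pi}) phi7 (sine_cone (sine_cone g)) \<and>
       (\<forall>t0\<in>{0, pi}. t_end_7 S2xS3 phi7 (sine_cone (sine_cone g)) g t0) \<and>
       (\<forall>q0\<in>{0, pi}. q_end_7 S2xS3 phi7 (sine_cone (sine_cone g)) (sine_cone g) q0)))"
proof (intro conjI allI impI)
  note sm = smooth_form_eta smooth_form_omega1 smooth_form_omega2 smooth_form_omega3
  note sm6 = smooth_form_cyl_F[OF sm] smooth_form_cyl_Psi_plus[OF sm] smooth_form_cyl_Psi_minus[OF sm]
  note sub = subspace_tangent_space_S2xS3
  have sub6: "subspace (tangent_space (S2xS3 \<times> {0<..<pi}) p)" if "p \<in> S2xS3 \<times> {0<..<pi}" for p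
    using that sub by (auto simp: tangent_space_Times_open subspace_Times)
  note nk = nearly_kaehler_cone[OF sm sasaki_einstein_S2xS3 structure_equations(4) sub]
  show "sasaki_einstein S2xS3 eta omega1 omega2 omega3" by (rule sasaki_einstein_S2xS3)
  show "\<exists>g. su2_metric S2xS3 eta omega1 omega2 omega3 g" using su2_metric_S2xS3 by blast
  show "nearly_kaehler (S2xS3 \<times> {0<..<pi}) F6 Psi_plus6 Psi_minus6"
    unfolding F6_def Psi_plus6_def Psi_minus6_def by (rule nk(1))
  show "nearly_parallel ((S2xS3 \<times> {0<..<pi}) \<times> {0<..<pi}) phi7"
    unfolding phi7_def F6_def Psi_plus6_def Psi_minus6_def by (rule nearly_parallel_cone[OF sm6 nk sub6])
  fix g assume g: "su2_metric S2xS3 eta omega1 omega2 omega3 g"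
  note pos = su2_metric_nonneg[OF g]
  show su3: "su3_metric (S2xS3 \<times> {0<..<pi}) F6 Psi_plus6 Psi_minus6 (sine_cone g)"
    unfolding F6_def Psi_plus6_def Psi_minus6_def by (rule su3_metric_cone[OF g sub])
  show "g2_metric ((S2xS3 \<times> {0<..<pi}) \<times> {0<..<pi}) phi7 (sine_cone (sine_cone g))"
    unfolding phi7_def by (rule g2_metric_cone[OF su3 sub6])
  show "\<forall>t0\<in>{0, pi}. conical_end_6 S2xS3 F6 Psi_plus6 Psi_minus6 (sine_cone g) g t0"
  proof
    fix t0 assume t0: "t0 \<in> {0, pi}"
    then have "sin t0 = 0" by auto
    then show "conical_end_6 S2xS3 F6 Psi_plus6 Psi_minus6 (sine_cone g) g t0"
      unfolding conical_end_6_def Let_def F6_def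
      using leading_order_sine_cone[of S2xS3 g, OF pos t0] by (simp add: su3_degenerate_zero cyl_forms_zero)
  qed
  show "\<forall>t0\<in>{0, pi}. t_end_7 S2xS3 phi7 (sine_cone (sine_cone g)) g t0"
  proof
    fix t0 assume t0: "t0 \<in> {0, pi}"
    then have "sin t0 = 0" by auto
    then show "t_end_7 S2xS3 phi7 (sine_cone (sine_cone g)) g t0"
      unfolding t_end_7_def Let_def phi7_def F6_def Psi_plus6_def Psi_minus6_def
      using leading_order_double_sine_cone[of S2xS3 g, OF pos t0]
      by (simp add: g2_degenerate_zero cyl_phi_zero cyl_forms_zero)
  qed
  show "\<forall>q0\<in>{0, pi}. q_end_7 S2xS3 phi7 (sine_cone (sine_cone g)) (sine_cone g) q0"
  proof
    fix q0 assume q0: "q0 \<in> {0, pi}"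
    then have "sin q0 = 0" by auto
    then show "q_end_7 S2xS3 phi7 (sine_cone (sine_cone g)) (sine_cone g) q0"
      unfolding q_end_7_def Let_def phi7_def
      using leading_order_sine_cone[of "S2xS3 \<times> {0<..<pi}" "sine_cone g", OF sine_cone_nonneg[of S2xS3 g, OF pos] q0]
      by (simp add: g2_degenerate_zero cyl_forms_zero)
  qed
qed

end
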